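(* Let $d\ge 2k+2$. (a) If $M$ is a $k$-stacked homology sphere of dimension $d$, then $M\in\mathcal{K}_k(d)$, and the following two complexes, where $V(M)$ is the vertex set of $M$, coincide: the complex $$\left\{\alpha\subseteq V(M)\,:\,\text{every subset of }\alpha\text{ of size}\le k+1\text{ is a face of }M\right\}\qquad(\ast)$$ (which is the unique $k$-stacked homology $(d+1)$-ball with boundary $M$), and the complex $$\left\{\alpha\subseteq V(M)\,:\,\text{every subset of }\alpha\text{ of size}\le k+2\text{ is a face of }M\right\}.\qquad(\ast\ast)$$ That is, the two definitions of $\overline{M}$ (the first for $k$-stacked homology spheres, the second for members of $\mathcal{K}_k(d)$) agree. (b) For $M\in\mathcal{K}_k(d)$ let $\overline{M}$ be the complex defined by $(\ast\ast)$. Then $M\mapsto\overline{M}$ is a bijection from $\mathcal{K}_k(d)$ onto $\overline{\mathcal{K}}_k(d+1)$. The boundary map $N\mapsto\partial N$ provides its inverse.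
   Context: Simplicial complexes are finite and contain the empty set as a face. A homology sphere (ball) means an $\mathbb{F}$-homology sphere (ball) for some field $\mathbb{F}$. An $\mathbb{F}$-homology $d$-sphere is a $d$-dimensional simplicial complex in which the link of every face $\sigma$ (including $\emptyset$) has the reduced $\mathbb{F}$-homology of a sphere of dimension $d-\dim(\sigma)-1$. An $\mathbb{F}$-homology $d$-ball is a $d$-dimensional complex $B$ with vanishing reduced $\mathbb{F}$-homology, such that the link of every non-empty face $\sigma$ has the reduced $\mathbb{F}$-homology of a $(d-\dim(\sigma)-1)$-sphere or of a point, and such that the faces with acyclic link form an $\mathbb{F}$-homology $(d-1)$-sphere, the boundary $\partial B$. In general the boundary $\partial X$ of a pure $d$-dimensional complex $X$ in which each $(d-1)$-face lies in at most two facets is the pure subcomplex whose facets are the $(d-1)$-faces lying in exactly one facet. $\mathrm{skel}_m(X)$ is the subcomplex of all faces of $X$ of dimension $\le m$. A homology $(e+1)$-ball $B$ is $k$-stacked ($0\le k\le e+1$) if $\mathrm{skel}_{e-k}(B)=\mathrm{skel}_{e-k}(\partial B)$, i.e. all faces of codimension at least $k+1$ lie in the boundary. A homology $e$-sphere is $k$-stacked if it equals $\partial B$ for some $k$-stacked homology $(e+1)$-ball $B$. For $0\le k\le d$, $\mathcal{K}_k(d)$ is the class of connected $d$-dimensional simplicial complexes all of whose vertex-links are $k$-stacked homology $(d-1)$-spheres. $\overline{\mathcal{K}}_k(d+1)$ is the class of all $(d+1)$-dimensional simplicial complexes all of whose vertex-links are $k$-stacked homology $d$-balls.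
   Formalization: Members of the class K̄_k(d+1) are additionally required to be connected; without this (b) fails, e.g. for two disjoint (d+1)-simplices (k=0), whose boundary is disconnected. Fields range over those with elements in an arbitrary fixed type. *)

theory Defs
  imports "HOL-Algebra.AbelCoset" "HOL-Algebra.Module"
begin

section \<open>Finite simplicial complexes\<close>

definition simplicial_complex :: "'a set set \<Rightarrow> bool" where
  "simplicial_complex K \<longleftrightarrow>
     finite K \<and> {} \<in> K \<and> (\<forall>\<sigma>\<in>K. finite \<sigma> \<and> (\<forall>\<tau>. \<tau> \<subseteq> \<sigma> \<longrightarrow> \<tau> \<in> K))"

definition vertices :: "'a set set \<Rightarrow> 'a set" where
  "vertices K = \<Union>K"

definition face_dim :: "'a set \<Rightarrow> int" where
  "face_dim \<sigma> = int (card \<sigma>) - 1"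

definition complex_dim :: "'a set set \<Rightarrow> int" where
  "complex_dim K = Max (face_dim ` K)"

definition complex_of_dim :: "int \<Rightarrow> 'a set set \<Rightarrow> bool" where
  "complex_of_dim d K \<longleftrightarrow> simplicial_complex K \<and> complex_dim K = d"

definition link :: "'a set \<Rightarrow> 'a set set \<Rightarrow> 'a set set" where
  "link \<sigma> K = {\<tau> \<in> K. \<sigma> \<inter> \<tau> = {} \<and> \<sigma> \<union> \<tau> \<in> K}"

definition skel :: "int \<Rightarrow> 'a set set \<Rightarrow> 'a set set" where
  "skel m K = {\<sigma> \<in> K. face_dim \<sigma> \<le> m}"

definition facets :: "'a set set \<Rightarrow> 'a set set" where
  "facets K = {\<sigma> \<in> K. \<forall>\<tau>\<in>K. \<sigma> \<subseteq> \<tau> \<longrightarrow> \<tau> = \<sigma>}"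

definition connected_complex :: "'a set set \<Rightarrow> bool" where
  "connected_complex K \<longleftrightarrow>
     (\<forall>u\<in>vertices K. \<forall>v\<in>vertices K. (u, v) \<in> {(x, y). {x, y} \<in> K}\<^sup>*)"

text \<open>
  The boundary of a pure complex in which each face of codimension 1 lies in at most two
  facets. The empty face is inserted so that a complex without boundary faces has boundary
  \<open>{{}}\<close>; complexes always contain the empty face.
\<close>

definition boundary :: "'a set set \<Rightarrow> 'a set set" where
  "boundary K = insert {} {\<tau>. \<exists>\<rho>\<in>K. face_dim \<rho> = complex_dim K - 1 \<and>
     card {\<sigma> \<in> facets K. \<rho> \<subseteq> \<sigma>} = 1 \<and> \<tau> \<subseteq> \<rho>}"


section \<open>Reduced simplicial homology with coefficients in a field\<close>

text \<open>
  A chain of degree \<open>i\<close> is a function on all vertex sets, vanishing outside the faces of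
  dimension \<open>i\<close>; faces are oriented by the linear order on the vertices. In degree \<open>-1\<close>
  the empty face contributes a copy of the field, which makes the homology reduced. All degrees
  are integers; below \<open>-1\<close> the chain modules are zero. Multiplication and unit of the
  module records play no role.
\<close>

definition chain_module :: "'f ring \<Rightarrow> 'a set set \<Rightarrow> int \<Rightarrow> ('f, 'a set \<Rightarrow> 'f) module" where
  "chain_module F K i =
    \<lparr>carrier = {c. (\<forall>\<sigma>. c \<sigma> \<in> carrier F) \<and>
                   (\<forall>\<sigma>. \<not> (\<sigma> \<in> K \<and> face_dim \<sigma> = i) \<longrightarrow> c \<sigma> = \<zero>\<^bsub>F\<^esub>)},
     mult = undefined, one = undefined,
     zero = (\<lambda>\<sigma>. \<zero>\<^bsub>F\<^esub>),
     add = (\<lambda>c c' \<sigma>. c \<sigma> \<oplus>\<^bsub>F\<^esub> c' \<sigma>),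
     smult = (\<lambda>a c \<sigma>. a \<otimes>\<^bsub>F\<^esub> c \<sigma>)\<rparr>"

text \<open>
  The coefficient of \<open>\<tau>\<close> in the boundary of an oriented face \<open>\<tau> \<union> {v}\<close> is \<open>(-1)\<^sup>j\<close>, where \<open>j\<close>
  is the position of \<open>v\<close>, counted from 0, among the vertices of \<open>\<tau> \<union> {v}\<close>.
\<close>

definition boundary_map ::
  "'f ring \<Rightarrow> 'a::linorder set set \<Rightarrow> ('a set \<Rightarrow> 'f) \<Rightarrow> 'a set \<Rightarrow> 'f" where
  "boundary_map F K c \<tau> =
     (\<Oplus>\<^bsub>F\<^esub>v\<in>vertices K - \<tau>.
        ((\<ominus>\<^bsub>F\<^esub> \<one>\<^bsub>F\<^esub>) [^]\<^bsub>F\<^esub> card {u \<in> \<tau>. u < v}) \<otimes>\<^bsub>F\<^esub> c (insert v \<tau>))"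

definition cycle_module ::
  "'f ring \<Rightarrow> 'a::linorder set set \<Rightarrow> int \<Rightarrow> ('f, 'a set \<Rightarrow> 'f) module" where
  "cycle_module F K i = (chain_module F K i)
     \<lparr>carrier := {c \<in> carrier (chain_module F K i). \<forall>\<tau>. boundary_map F K c \<tau> = \<zero>\<^bsub>F\<^esub>}\<rparr>"

definition boundaries ::
  "'f ring \<Rightarrow> 'a::linorder set set \<Rightarrow> int \<Rightarrow> ('a set \<Rightarrow> 'f) set" where
  "boundaries F K i = boundary_map F K ` carrier (chain_module F K (i + 1))"

definition quotient_module :: "('f, 'm) module \<Rightarrow> 'm set \<Rightarrow> ('f, 'm set) module" where
  "quotient_module M N =
    \<lparr>carrier = a_rcosets\<^bsub>M\<^esub> N,
     mult = undefined, one = undefined,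
     zero = N,
     add = (\<lambda>X Y. X <+>\<^bsub>M\<^esub> Y),
     smult = (\<lambda>a X. \<Union>x\<in>X. N +>\<^bsub>M\<^esub> (a \<odot>\<^bsub>M\<^esub> x))\<rparr>"

definition reduced_homology ::
  "'f ring \<Rightarrow> 'a::linorder set set \<Rightarrow> int \<Rightarrow> ('f, ('a set \<Rightarrow> 'f) set) module" where
  "reduced_homology F K i = quotient_module (cycle_module F K i) (boundaries F K i)"

definition scalar_module :: "'f ring \<Rightarrow> ('f, 'f) module" where
  "scalar_module F =
    \<lparr>carrier = carrier F, mult = mult F, one = one F, zero = zero F, add = add F,
     smult = mult F\<rparr>"

definition linearly_isomorphic ::
  "'f ring \<Rightarrow> ('f, 'm) module \<Rightarrow> ('f, 'n) module \<Rightarrow> bool" where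
  "linearly_isomorphic F M N \<longleftrightarrow>
     (\<exists>h. bij_betw h (carrier M) (carrier N) \<and>
          (\<forall>x\<in>carrier M. \<forall>y\<in>carrier M. h (x \<oplus>\<^bsub>M\<^esub> y) = h x \<oplus>\<^bsub>N\<^esub> h y) \<and>
          (\<forall>a\<in>carrier F. \<forall>x\<in>carrier M. h (a \<odot>\<^bsub>M\<^esub> x) = a \<odot>\<^bsub>N\<^esub> h x))"

definition acyclic_complex :: "'f ring \<Rightarrow> 'a::linorder set set \<Rightarrow> bool" where
  "acyclic_complex F K \<longleftrightarrow>
     (\<forall>i. carrier (reduced_homology F K i) = {\<zero>\<^bsub>reduced_homology F K i\<^esub>})"

definition has_homology_of_sphere :: "'f ring \<Rightarrow> int \<Rightarrow> 'a::linorder set set \<Rightarrow> bool" where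
  "has_homology_of_sphere F m K \<longleftrightarrow>
     (\<forall>i. if i = m then linearly_isomorphic F (reduced_homology F K i) (scalar_module F)
          else carrier (reduced_homology F K i) = {\<zero>\<^bsub>reduced_homology F K i\<^esub>})"


section \<open>Homology spheres and balls over a fixed field\<close>

definition F_homology_sphere :: "'f ring \<Rightarrow> int \<Rightarrow> 'a::linorder set set \<Rightarrow> bool" where
  "F_homology_sphere F d S \<longleftrightarrow> complex_of_dim d S \<and>
     (\<forall>\<sigma>\<in>S. has_homology_of_sphere F (d - face_dim \<sigma> - 1) (link \<sigma> S))"

definition ball_boundary :: "'f ring \<Rightarrow> 'a::linorder set set \<Rightarrow> 'a set set" where
  "ball_boundary F B = {\<sigma> \<in> B. acyclic_complex F (link \<sigma> B)}"

definition F_homology_ball :: "'f ring \<Rightarrow> int \<Rightarrow> 'a::linorder set set \<Rightarrow> bool" where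
  "F_homology_ball F d B \<longleftrightarrow> complex_of_dim d B \<and> acyclic_complex F B \<and>
     (\<forall>\<sigma>\<in>B. \<sigma> \<noteq> {} \<longrightarrow>
        has_homology_of_sphere F (d - face_dim \<sigma> - 1) (link \<sigma> B) \<or>
        acyclic_complex F (link \<sigma> B)) \<and>
     F_homology_sphere F (d - 1) (ball_boundary F B)"

text \<open>Stackedness of a ball of dimension \<open>d = e + 1\<close>.\<close>

definition F_stacked_ball :: "'f ring \<Rightarrow> nat \<Rightarrow> int \<Rightarrow> 'a::linorder set set \<Rightarrow> bool" where
  "F_stacked_ball F k d B \<longleftrightarrow> F_homology_ball F d B \<and> int k \<le> d \<and>
     skel (d - 1 - int k) B = skel (d - 1 - int k) (ball_boundary F B)"


section \<open>Homology spheres and balls over some field\<close>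

text \<open>
  The fields considered are those whose elements form a subset of a type \<open>'f\<close>, passed as a type
  argument. The field may be different for each complex, in particular for each vertex link.
\<close>

definition homology_sphere :: "'f itself \<Rightarrow> int \<Rightarrow> 'a::linorder set set \<Rightarrow> bool" where
  "homology_sphere T d S \<longleftrightarrow> (\<exists>F :: 'f ring. field F \<and> F_homology_sphere F d S)"

definition stacked_ball :: "'f itself \<Rightarrow> nat \<Rightarrow> int \<Rightarrow> 'a::linorder set set \<Rightarrow> bool" where
  "stacked_ball T k d B \<longleftrightarrow> (\<exists>F :: 'f ring. field F \<and> F_stacked_ball F k d B)"

definition stacked_ball_with_boundary ::
  "'f itself \<Rightarrow> nat \<Rightarrow> int \<Rightarrow> 'a::linorder set set \<Rightarrow> 'a set set \<Rightarrow> bool" where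
  "stacked_ball_with_boundary T k d B S \<longleftrightarrow>
     (\<exists>F :: 'f ring. field F \<and> F_stacked_ball F k d B \<and> ball_boundary F B = S)"

definition stacked_sphere :: "'f itself \<Rightarrow> nat \<Rightarrow> int \<Rightarrow> 'a::linorder set set \<Rightarrow> bool" where
  "stacked_sphere T k e S \<longleftrightarrow> homology_sphere T e S \<and>
     (\<exists>B. stacked_ball_with_boundary T k (e + 1) B S)"

definition K_class :: "'f itself \<Rightarrow> nat \<Rightarrow> int \<Rightarrow> 'a::linorder set set set" where
  "K_class T k d = {M. complex_of_dim d M \<and> connected_complex M \<and>
     (\<forall>v\<in>vertices M. stacked_sphere T k (d - 1) (link {v} M))}"

text \<open>
  Connectedness is required here as it is in \<open>K_class\<close>: otherwise the disjoint union of two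
  simplices of dimension \<open>d\<close> would belong to the class, although its boundary is disconnected.
\<close>

definition Kbar_class :: "'f itself \<Rightarrow> nat \<Rightarrow> int \<Rightarrow> 'a::linorder set set set" where
  "Kbar_class T k d = {N. complex_of_dim d N \<and> connected_complex N \<and>
     (\<forall>v\<in>vertices N. stacked_ball T k (d - 1) (link {v} N))}"

definition completion :: "nat \<Rightarrow> 'a set set \<Rightarrow> 'a set set" where
  "completion m M = {\<alpha>. \<alpha> \<subseteq> vertices M \<and> (\<forall>\<beta>. \<beta> \<subseteq> \<alpha> \<and> card \<beta> \<le> m \<longrightarrow> \<beta> \<in> M)}"

end

theory Submission
  imports Defs
begin

text \<open>
  The key fact is that a \<open>k\<close>-stacked homology ball \<open>B\<close> has no missing face \<open>\<alpha>\<close> with \<open>m \<ge> k + 2\<close>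
  vertices. By Alexander duality for the sphere obtained by coning off \<open>\<partial>B\<close>, such an \<open>\<alpha>\<close> would force
  non-trivial homology of \<open>B\<close> modulo \<open>\<partial>B\<close>, restricted to the vertices outside \<open>\<alpha>\<close>, in dimension
  \<open>dim B + 1 - m\<close>; but stackedness leaves no chains of that dimension outside \<open>\<partial>B\<close>. Duality is
  replaced by the long exact sequences of deletion and link of a vertex, applied to the vertices of
  \<open>\<alpha>\<close> one at a time; chains are relative to the family \<open>B - \<partial>B\<close>, so that no cone point is needed.
  Hence \<open>B\<close> is recovered from the small faces of \<open>\<partial>B\<close>. Applied to vertex links, this shows that
  the vertex links of the completion of \<open>M\<close> are the stacked balls bounded by those of \<open>M\<close>, and a
  complex is determined by its vertex links.
\<close>

subsection \<open>Simplicial complexes\<close>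

text \<open>The bound \<open>d \<ge> 2 * k + 2\<close> has a simple source. A
  \<open>k\<close>-stacked ball of dimension \<open>n\<close> is determined by its boundary faces
  with at most \<open>j\<close> vertices whenever \<open>k + 1 \<le> j \<le> n - k\<close>: the
  lower bound excludes missing faces, the upper one places the small faces in the boundary. In a
  vertex link of the completion, test sets through the vertex lose one element while those avoiding
  it keep their size, so both \<open>j = k + 1\<close> and \<open>j = k + 2\<close> are needed for
  balls of dimension \<open>d\<close>. The delicate point of the transport argument is the first
  deleted vertex: the top cycle modulo the boundary must restrict to a generator in the link. This
  is where connectedness of links enters. Two further obstacles are that each link may be a sphere
  or ball over its own field, and that \<open>boundary\<close> counts facets while
  \<open>ball_boundary\<close> tests acyclicity. Completions do not mention a field, so data over
  different fields are never compared; the two boundaries agree on vertex links because both are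
  determined by faces of codimension 1.\<close>

lemma simplicial_complex_subset:
  assumes "simplicial_complex K" "\<sigma> \<in> K" "\<tau> \<subseteq> \<sigma>"
  shows "\<tau> \<in> K"
  using assms unfolding simplicial_complex_def by metis

lemma simplicial_complexI:
  assumes "finite K" "{} \<in> K" "\<And>\<sigma>. \<sigma> \<in> K \<Longrightarrow> finite \<sigma>"
    "\<And>\<sigma> \<tau>. \<sigma> \<in> K \<Longrightarrow> \<tau> \<subseteq> \<sigma> \<Longrightarrow> \<tau> \<in> K"
  shows "simplicial_complex K"
  unfolding simplicial_complex_def using assms by metis

lemma simplicial_complexD:
  assumes "simplicial_complex K"
  shows "finite K" "{} \<in> K" "\<sigma> \<in> K \<Longrightarrow> finite \<sigma>"
  using assms unfolding simplicial_complex_def by metis+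

lemma vertices_iff: "simplicial_complex K \<Longrightarrow> v \<in> vertices K \<longleftrightarrow> {v} \<in> K"
  using simplicial_complex_subset[of K _ "{v}"] unfolding vertices_def by blast

lemma finite_vertices: "simplicial_complex K \<Longrightarrow> finite (vertices K)"
  unfolding vertices_def using simplicial_complexD by blast

lemma complex_of_dim_iff:
  "complex_of_dim d K \<longleftrightarrow> simplicial_complex K \<and>
    (\<forall>\<sigma>\<in>K. int (card \<sigma>) \<le> d + 1) \<and> (\<exists>\<sigma>\<in>K. int (card \<sigma>) = d + 1)"
proof (cases "simplicial_complex K")
  case True
  have "finite (face_dim ` K)" "face_dim ` K \<noteq> {}" using simplicial_complexD[OF True] by auto
  then have "Max (face_dim ` K) = d \<longleftrightarrow> d \<in> face_dim ` K \<and> (\<forall>a\<in>face_dim ` K. a \<le> d)"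
    by (rule Max_eq_iff)
  also have "\<dots> \<longleftrightarrow> (\<forall>\<sigma>\<in>K. int (card \<sigma>) \<le> d + 1) \<and> (\<exists>\<sigma>\<in>K. int (card \<sigma>) = d + 1)"
  proof -
    have "d \<in> face_dim ` K \<longleftrightarrow> (\<exists>\<sigma>\<in>K. int (card \<sigma>) = d + 1)"
      unfolding image_iff by (rule bex_cong[OF refl]) (auto simp: face_dim_def)
    moreover have "(\<forall>a\<in>face_dim ` K. a \<le> d) \<longleftrightarrow> (\<forall>\<sigma>\<in>K. int (card \<sigma>) \<le> d + 1)"
      unfolding ball_simps by (rule ball_cong[OF refl]) (auto simp: face_dim_def)
    ultimately show ?thesis by blast
  qed
  finally show ?thesis using True by (simp add: complex_of_dim_def complex_dim_def)
next
  case False then show ?thesis by (simp add: complex_of_dim_def)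
qed

subsection \<open>Chains relative to a convex family of sets\<close>

text \<open>A finite ambient vertex set \<open>V\<close> is fixed once, so that a complex, its links
  and differences of complexes share one boundary operator; vertices outside a complex contribute
  only zero terms.\<close>

locale face_chains = field F for F :: "'f ring" (structure) +
  fixes V :: "'a::linorder set"
  assumes finite_V: "finite V"
begin

section \<open>Signs, contractions and the boundary operator\<close>

definition sg :: "nat \<Rightarrow> 'f \<Rightarrow> 'f" where
  "sg n x = ((\<ominus> \<one>) [^] n) \<otimes> x"

text \<open>This is the interior product with the vertex \<open>v\<close>. As the boundary is a sum
  of such operators, the sign computations reduce to the fact that two of them anticommute.\<close>

definition contract :: "'a \<Rightarrow> ('a set \<Rightarrow> 'f) \<Rightarrow> 'a set \<Rightarrow> 'f" where
  "contract v c \<tau> = (if v \<in> \<tau> then \<zero> else sg (card {u\<in>\<tau>. u < v}) (c (insert v \<tau>)))"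

text \<open>The range \<open>W\<close> varies for two reasons: the identities below are proved by
  induction on it, and the connectivity argument sums only over the vertices of one
  component.\<close>

definition bd_on :: "'a set \<Rightarrow> ('a set \<Rightarrow> 'f) \<Rightarrow> 'a set \<Rightarrow> 'f" where
  "bd_on W c \<tau> = (\<Oplus>v\<in>W. contract v c \<tau>)"

abbreviation bd :: "('a set \<Rightarrow> 'f) \<Rightarrow> 'a set \<Rightarrow> 'f" where
  "bd \<equiv> bd_on V"

abbreviation coeffs :: "('a set \<Rightarrow> 'f) \<Rightarrow> bool" where
  "coeffs c \<equiv> \<forall>\<sigma>. c \<sigma> \<in> carrier F"

lemma sg_closed [simp]: "x \<in> carrier F \<Longrightarrow> sg n x \<in> carrier F"
  by (simp add: sg_def)

lemma sg_zero [simp]: "sg n \<zero> = \<zero>"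
  by (simp add: sg_def)

lemma sg_0 [simp]: "x \<in> carrier F \<Longrightarrow> sg 0 x = x"
  by (simp add: sg_def)

lemma sg_Suc: "x \<in> carrier F \<Longrightarrow> sg (Suc n) x = \<ominus> sg n x"
  by (simp add: sg_def l_minus r_minus)

lemma sg_minus: "x \<in> carrier F \<Longrightarrow> sg n (\<ominus> x) = \<ominus> sg n x"
  by (simp add: sg_def r_minus)

lemma sg_sg: "x \<in> carrier F \<Longrightarrow> sg n (sg m x) = sg (n + m) x"
  by (induction n) (simp_all add: sg_Suc)

lemma sg_double: "x \<in> carrier F \<Longrightarrow> sg (n + n) x = x"
  by (induction n) (simp_all add: sg_Suc)

lemma sg_involution [simp]: "x \<in> carrier F \<Longrightarrow> sg n (sg n x) = x"
  by (simp add: sg_sg sg_double)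

lemma sg_add: "x \<in> carrier F \<Longrightarrow> y \<in> carrier F \<Longrightarrow> sg n (x \<oplus> y) = sg n x \<oplus> sg n y"
  by (simp add: sg_def r_distr)

lemma sg_mult: "x \<in> carrier F \<Longrightarrow> a \<in> carrier F \<Longrightarrow> sg n (a \<otimes> x) = a \<otimes> sg n x"
  by (simp add: sg_def m_lcomm)

lemma sg_eq_zero: "x \<in> carrier F \<Longrightarrow> sg n x = \<zero> \<longleftrightarrow> x = \<zero>"
  by (metis sg_involution sg_zero)

lemma contract_closed [simp]: "coeffs c \<Longrightarrow> contract v c \<tau> \<in> carrier F"
  by (simp add: contract_def)

lemma contract_add:
  "coeffs c \<Longrightarrow> coeffs c' \<Longrightarrow>
    contract v (\<lambda>\<sigma>. c \<sigma> \<oplus> c' \<sigma>) \<tau> = contract v c \<tau> \<oplus> contract v c' \<tau>"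
  by (simp add: contract_def sg_add)

lemma contract_mult:
  "coeffs c \<Longrightarrow> a \<in> carrier F \<Longrightarrow> contract v (\<lambda>\<sigma>. a \<otimes> c \<sigma>) \<tau> = a \<otimes> contract v c \<tau>"
  by (simp add: contract_def sg_mult)

lemma contract_minus:
  "coeffs c \<Longrightarrow> contract v (\<lambda>\<sigma>. \<ominus> c \<sigma>) \<tau> = \<ominus> contract v c \<tau>"
  by (simp add: contract_def sg_minus)

text \<open>For \<open>u < v\<close>, adding \<open>u\<close> to \<tau> raises the position of
  \<open>v\<close> by one, while adding \<open>v\<close> leaves the position of \<open>u\<close>
  unchanged; the two orders of contraction therefore differ by one sign.\<close>

lemma contract_anticommute:
  assumes c: "coeffs c" and fin: "finite \<tau>"
  shows "contract u (contract v c) \<tau> = \<ominus> contract v (contract u c) \<tau>"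
proof (cases "u = v \<or> u \<in> \<tau> \<or> v \<in> \<tau>")
  case True
  then show ?thesis by (auto simp: contract_def)
next
  case False
  have *: "contract u (contract v c) \<tau> = \<ominus> contract v (contract u c) \<tau>"
    if "u < v" "u \<notin> \<tau>" "v \<notin> \<tau>" for u v
  proof -
    have 1: "{x \<in> insert u \<tau>. x < v} = insert u {x\<in>\<tau>. x < v}" using that by auto
    have 2: "{x \<in> insert v \<tau>. x < u} = {x\<in>\<tau>. x < u}" using that by auto
    have 3: "card {x \<in> insert u \<tau>. x < v} = Suc (card {x\<in>\<tau>. x < v})"
      unfolding 1 using that fin by (subst card_insert_disjoint) auto
    have 4: "u \<noteq> v" using that by auto
    let ?m = "card {x\<in>\<tau>. x < u}" and ?n = "card {x\<in>\<tau>. x < v}"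
    let ?x = "c (insert u (insert v \<tau>))"
    have x: "?x \<in> carrier F" using c by blast
    have "contract u (contract v c) \<tau> = sg ?m (sg (Suc ?n) ?x)"
      using that 3 4 by (auto simp: contract_def insert_commute[of v u])
    also have "\<dots> = \<ominus> sg (?m + ?n) ?x"
      using x sg_sg[OF x, of ?m "Suc ?n"] by (simp only: sg_Suc add_Suc_right)
    also have "?m + ?n = ?n + ?m" by (rule Groups.add.commute)
    also have "sg (?n + ?m) ?x = contract v (contract u c) \<tau>"
      using that 2 4 x by (simp add: contract_def sg_sg)
    finally show ?thesis .
  qed
  show ?thesis
  proof (cases "u < v")
    case True then show ?thesis using * False by auto
  next
    case f: False
    then have "v < u" using False by auto
    then have "contract v (contract u c) \<tau> = \<ominus> contract u (contract v c) \<tau>"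
      using * False by auto
    then show ?thesis using c by simp
  qed
qed

lemma bd_on_closed [simp]: "coeffs c \<Longrightarrow> bd_on W c \<tau> \<in> carrier F"
  unfolding bd_on_def by (rule finsum_closed) auto

lemma bd_on_add:
  "coeffs c \<Longrightarrow> coeffs c' \<Longrightarrow> bd_on W (\<lambda>\<sigma>. c \<sigma> \<oplus> c' \<sigma>) \<tau> = bd_on W c \<tau> \<oplus> bd_on W c' \<tau>"
  unfolding bd_on_def by (simp add: contract_add finsum_addf)

lemma bd_on_mult:
  "coeffs c \<Longrightarrow> a \<in> carrier F \<Longrightarrow> finite W \<Longrightarrow>
    bd_on W (\<lambda>\<sigma>. a \<otimes> c \<sigma>) \<tau> = a \<otimes> bd_on W c \<tau>"
  unfolding bd_on_def by (simp add: contract_mult finsum_rdistr)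

lemma bd_on_minus:
  assumes "coeffs c" "finite W"
  shows "bd_on W (\<lambda>\<sigma>. \<ominus> c \<sigma>) \<tau> = \<ominus> bd_on W c \<tau>"
proof -
  have "(\<lambda>\<sigma>. \<ominus> c \<sigma>) = (\<lambda>\<sigma>. (\<ominus> \<one>) \<otimes> c \<sigma>)" using assms(1) by (auto simp: l_minus)
  then show ?thesis using bd_on_mult[of c "\<ominus> \<one>" W \<tau>] assms by (simp add: l_minus)
qed

lemma bd_on_diff:
  "coeffs c \<Longrightarrow> coeffs c' \<Longrightarrow> finite W \<Longrightarrow>
    bd_on W (\<lambda>\<sigma>. c \<sigma> \<ominus> c' \<sigma>) \<tau> = bd_on W c \<tau> \<ominus> bd_on W c' \<tau>"
  unfolding a_minus_def by (simp add: bd_on_add bd_on_minus)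

lemma contract_diff:
  "coeffs c \<Longrightarrow> coeffs c' \<Longrightarrow>
    contract v (\<lambda>\<sigma>. c \<sigma> \<ominus> c' \<sigma>) \<tau> = contract v c \<tau> \<ominus> contract v c' \<tau>"
  unfolding a_minus_def by (simp add: contract_add contract_minus)

text \<open>The sign comes from termwise anticommutation. Thus contraction, which passes to the link
  of \<open>v\<close>, is a chain map up to sign.\<close>

lemma contract_bd_on:
  assumes c: "coeffs c" and fin: "finite \<tau>" and W: "finite W"
  shows "contract v (bd_on W c) \<tau> = \<ominus> bd_on W (contract v c) \<tau>"
  using W
proof (induction W rule: finite_induct)
  case empty
  then show ?case by (simp add: contract_def bd_on_def)
next
  case (insert w W)
  have e: "bd_on (insert w W) c \<sigma> = contract w c \<sigma> \<oplus> bd_on W c \<sigma>" if "coeffs c" for \<sigma> c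
    unfolding bd_on_def using insert.hyps that by (subst finsum_insert) auto
  have "contract v (bd_on (insert w W) c) \<tau>
      = contract v (\<lambda>\<sigma>. contract w c \<sigma> \<oplus> bd_on W c \<sigma>) \<tau>"
    using e[OF c] by presburger
  also have "\<dots> = contract v (contract w c) \<tau> \<oplus> contract v (bd_on W c) \<tau>"
    using c by (subst contract_add) auto
  also have "\<dots> = \<ominus> contract w (contract v c) \<tau> \<oplus> \<ominus> bd_on W (contract v c) \<tau>"
    by (simp only: contract_anticommute[OF c fin, of v w] insert.IH)
  also have "\<dots> = \<ominus> bd_on (insert w W) (contract v c) \<tau>"
    using c e[of "contract v c" \<tau>] by (simp add: minus_add)
  finally show ?case .
qed

text \<open>When \<open>w\<close> is split off from the range, the square of
  \<open>contract w\<close> vanishes because \<open>w\<close> can be removed only once, and the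
  mixed terms cancel by \<open>contract_bd_on\<close>.\<close>

lemma bd_on_bd_on:
  assumes c: "coeffs c" and fin: "finite \<tau>" and W: "finite W"
  shows "bd_on W (bd_on W c) \<tau> = \<zero>"
  using W c
proof (induction W arbitrary: c rule: finite_induct)
  case empty
  then show ?case by (simp add: bd_on_def)
next
  case (insert w W)
  have e: "bd_on (insert w W) c = (\<lambda>\<sigma>. contract w c \<sigma> \<oplus> bd_on W c \<sigma>)" if "coeffs c" for c
    unfolding bd_on_def using insert.hyps that by (intro ext, subst finsum_insert) auto
  have c: "coeffs c" by fact
  have cc: "coeffs (contract w c)" "coeffs (bd_on W c)" using c by auto
  have "bd_on (insert w W) (bd_on (insert w W) c) \<tau>
      = contract w (\<lambda>\<sigma>. contract w c \<sigma> \<oplus> bd_on W c \<sigma>) \<tau>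
        \<oplus> bd_on W (\<lambda>\<sigma>. contract w c \<sigma> \<oplus> bd_on W c \<sigma>) \<tau>"
    using c by (simp add: e)
  also have "\<dots> = (contract w (contract w c) \<tau> \<oplus> contract w (bd_on W c) \<tau>)
      \<oplus> (bd_on W (contract w c) \<tau> \<oplus> bd_on W (bd_on W c) \<tau>)"
    by (simp only: contract_add[OF cc] bd_on_add[OF cc])
  also have "\<dots> = \<ominus> bd_on W (contract w c) \<tau> \<oplus> bd_on W (contract w c) \<tau>"
  proof -
    have "contract w (contract w c) \<tau> = \<zero>" by (simp add: contract_def)
    then show ?thesis
      using c by (simp add: insert.IH[OF c] contract_bd_on[OF c fin insert.hyps(1)])
  qed
  also have "\<dots> = \<zero>" using c by (simp add: l_neg)
  finally show ?case .
qed

lemma contract_nonzero: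
  "contract v c \<tau> \<noteq> \<zero> \<Longrightarrow> v \<notin> \<tau> \<and> c (insert v \<tau>) \<noteq> \<zero>"
  by (auto simp: contract_def split: if_splits)

lemma contract_eq_zero:
  "coeffs c \<Longrightarrow> contract v c \<tau> = \<zero> \<longleftrightarrow> v \<in> \<tau> \<or> c (insert v \<tau>) = \<zero>"
  by (simp add: contract_def sg_eq_zero)

lemma bd_on_eq_zeroI:
  "(\<And>v. v \<in> W \<Longrightarrow> v \<notin> \<tau> \<Longrightarrow> c (insert v \<tau>) = \<zero>) \<Longrightarrow> bd_on W c \<tau> = \<zero>"
  unfolding bd_on_def by (rule add.finprod_one_eqI) (auto simp: contract_def)

lemma bd_on_nonzero:
  "bd_on W c \<tau> \<noteq> \<zero> \<Longrightarrow> \<exists>v\<in>W. v \<notin> \<tau> \<and> c (insert v \<tau>) \<noteq> \<zero>"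
  using bd_on_eq_zeroI by blast

lemma bd_on_cong:
  assumes "coeffs c'" "\<And>v. v \<in> W \<Longrightarrow> v \<notin> \<tau> \<Longrightarrow> c (insert v \<tau>) = c' (insert v \<tau>)"
  shows "bd_on W c \<tau> = bd_on W c' \<tau>"
  unfolding bd_on_def
  by (rule finsum_cong') (use assms in \<open>auto simp: contract_def\<close>)

text \<open>Degrees are numbers of vertices, so degree \<open>i\<close> is dimension \<open>i - 1\<close>.\<close>

definition chain :: "'a set set \<Rightarrow> nat \<Rightarrow> ('a set \<Rightarrow> 'f) \<Rightarrow> bool" where
  "chain \<Delta> i c \<longleftrightarrow> coeffs c \<and> (\<forall>\<sigma>. c \<sigma> \<noteq> \<zero> \<longrightarrow> \<sigma> \<in> \<Delta> \<and> card \<sigma> = i)"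

text \<open>The boundary is tested only on \<Delta>. For a difference of two complexes this is the
  cycle condition of relative homology; for a whole complex it is the ordinary one, as the boundary
  vanishes elsewhere.\<close>

definition cyc :: "'a set set \<Rightarrow> nat \<Rightarrow> ('a set \<Rightarrow> 'f) \<Rightarrow> bool" where
  "cyc \<Delta> i c \<longleftrightarrow> chain \<Delta> i c \<and> (\<forall>\<tau>\<in>\<Delta>. bd c \<tau> = \<zero>)"

definition exact :: "'a set set \<Rightarrow> nat \<Rightarrow> bool" where
  "exact \<Delta> i \<longleftrightarrow> (\<forall>c. cyc \<Delta> i c \<longrightarrow> (\<exists>b. chain \<Delta> (Suc i) b \<and> (\<forall>\<tau>\<in>\<Delta>. bd b \<tau> = c \<tau>)))"

text \<open>One-dimensional homology expressed by cycles alone. This is the right form where no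
  faces with \<open>i + 1\<close> vertices exist, so that homology classes are cycles.\<close>

definition top_line :: "'a set set \<Rightarrow> nat \<Rightarrow> bool" where
  "top_line \<Delta> i \<longleftrightarrow> (\<exists>z. cyc \<Delta> i z \<and> (\<exists>\<sigma>. z \<sigma> \<noteq> \<zero>) \<and>
     (\<forall>c. cyc \<Delta> i c \<longrightarrow> (\<exists>a\<in>carrier F. \<forall>\<sigma>. c \<sigma> = a \<otimes> z \<sigma>)))"

text \<open>Differences of two complexes are convex in this sense, and convexity makes the boundary
  truncated to \<Delta> square to zero.\<close>

definition family :: "'a set set \<Rightarrow> bool" where
  "family \<Delta> \<longleftrightarrow> \<Delta> \<subseteq> Pow V \<and> (\<forall>\<rho>\<in>\<Delta>. \<forall>\<pi>\<in>\<Delta>. \<forall>\<tau>. \<rho> \<subseteq> \<tau> \<and> \<tau> \<subseteq> \<pi> \<longrightarrow> \<tau> \<in> \<Delta>)"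

definition restr :: "'a set set \<Rightarrow> ('a set \<Rightarrow> 'f) \<Rightarrow> 'a set \<Rightarrow> 'f" where
  "restr \<Delta> c \<tau> = (if \<tau> \<in> \<Delta> then c \<tau> else \<zero>)"

definition del :: "'a set set \<Rightarrow> 'a \<Rightarrow> 'a set set" where
  "del \<Delta> v = {\<tau>\<in>\<Delta>. v \<notin> \<tau>}"

text \<open>Only \<open>insert v \<tau>\<close> has to belong to \<Delta>: a convex family need not
  be closed under subsets, so \<open>link\<close> would be the wrong notion.\<close>

definition lk :: "'a set set \<Rightarrow> 'a \<Rightarrow> 'a set set" where
  "lk \<Delta> v = {\<tau>. v \<notin> \<tau> \<and> insert v \<tau> \<in> \<Delta>}"

text \<open>The sign is that of \<open>contract\<close>, so that contracting the lift of a chain on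
  the link gives the chain back.\<close>

definition lift :: "'a \<Rightarrow> ('a set \<Rightarrow> 'f) \<Rightarrow> 'a set \<Rightarrow> 'f" where
  "lift v e \<tau> = (if v \<in> \<tau> then sg (card {u\<in>\<tau> - {v}. u < v}) (e (\<tau> - {v})) else \<zero>)"

section \<open>Chains, truncation and the maps between a family and its vertex links\<close>

lemma chain_coeffs: "chain \<Delta> i c \<Longrightarrow> coeffs c"
  by (simp add: chain_def)

lemma chain_face: "chain \<Delta> i c \<Longrightarrow> c \<tau> \<noteq> \<zero> \<Longrightarrow> \<tau> \<in> \<Delta>"
  unfolding chain_def by blast

lemma chain_card: "chain \<Delta> i c \<Longrightarrow> c \<tau> \<noteq> \<zero> \<Longrightarrow> card \<tau> = i"
  unfolding chain_def by blast

lemma chain_outside: "chain \<Delta> i c \<Longrightarrow> \<tau> \<notin> \<Delta> \<Longrightarrow> c \<tau> = \<zero>"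
  by (auto simp: chain_def)

lemma chain_add: "chain \<Delta> i c \<Longrightarrow> chain \<Delta> i c' \<Longrightarrow> chain \<Delta> i (\<lambda>\<tau>. c \<tau> \<oplus> c' \<tau>)"
  unfolding chain_def by (metis a_closed l_zero zero_closed)

lemma chain_mult: "chain \<Delta> i c \<Longrightarrow> a \<in> carrier F \<Longrightarrow> chain \<Delta> i (\<lambda>\<tau>. a \<otimes> c \<tau>)"
  unfolding chain_def by (metis m_closed r_null)

lemma chain_minus: "chain \<Delta> i c \<Longrightarrow> chain \<Delta> i (\<lambda>\<tau>. \<ominus> c \<tau>)"
  unfolding chain_def by (metis a_inv_closed minus_zero)

lemma chain_diff: "chain \<Delta> i c \<Longrightarrow> chain \<Delta> i c' \<Longrightarrow> chain \<Delta> i (\<lambda>\<tau>. c \<tau> \<ominus> c' \<tau>)"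
  unfolding a_minus_def by (intro chain_add chain_minus)

lemma chain_zero: "chain \<Delta> i (\<lambda>\<tau>. \<zero>)"
  by (simp add: chain_def)

lemma chain_mono: "chain \<Delta> i c \<Longrightarrow> \<Delta> \<subseteq> \<Delta>' \<Longrightarrow> chain \<Delta>' i c"
  by (auto simp: chain_def)

lemma chain_restr: "chain \<Delta>' i c \<Longrightarrow> chain \<Delta> i (restr \<Delta> c)"
  by (auto simp: chain_def restr_def)

lemma bd_on_zero [simp]: "bd_on W (\<lambda>\<sigma>. \<zero>) \<tau> = \<zero>"
  by (rule bd_on_eq_zeroI) simp

lemma cyc_zero: "cyc \<Delta> i (\<lambda>\<tau>. \<zero>)"
  by (simp add: cyc_def chain_zero)

lemma exact_no_faces:
  assumes "\<And>\<tau>. \<tau> \<in> \<Delta> \<Longrightarrow> card \<tau> \<noteq> i"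
  shows "exact \<Delta> i"
  unfolding exact_def
proof (intro allI impI)
  fix c assume "cyc \<Delta> i c"
  then have "c \<tau> = \<zero>" for \<tau> using assms by (auto simp: cyc_def chain_def)
  then show "\<exists>b. chain \<Delta> (Suc i) b \<and> (\<forall>\<tau>\<in>\<Delta>. bd b \<tau> = c \<tau>)"
    using chain_zero by force
qed

lemma exact_top_zero:
  assumes "exact \<Delta> i" "\<And>\<tau>. \<tau> \<in> \<Delta> \<Longrightarrow> card \<tau> \<noteq> Suc i" "cyc \<Delta> i c"
  shows "c \<tau> = \<zero>"
proof -
  obtain b where b: "chain \<Delta> (Suc i) b" "\<And>\<tau>. \<tau> \<in> \<Delta> \<Longrightarrow> bd b \<tau> = c \<tau>"
    using assms(1,3) by (auto simp: exact_def)
  have "b = (\<lambda>\<tau>. \<zero>)" using assms(2) b(1) by (auto simp: chain_def)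
  then have "\<tau> \<in> \<Delta> \<Longrightarrow> c \<tau> = \<zero>" using b(2) bd_on_zero by metis
  then show ?thesis using assms(3) by (auto simp: cyc_def chain_def)
qed

lemma family_subset: "family \<Delta> \<Longrightarrow> \<Delta> \<subseteq> Pow V"
  unfolding family_def by (rule conjunct1)

lemma family_finite: "family \<Delta> \<Longrightarrow> \<tau> \<in> \<Delta> \<Longrightarrow> finite \<tau>"
  using finite_V family_subset by (blast intro: finite_subset)

text \<open>If the coefficient were nonzero, \<tau> would lie between \<rho> and a larger member of
  \<Delta>, and convexity would put it into \<Delta>.\<close>

lemma bd_outside:
  assumes "family \<Delta>" "chain \<Delta> i b" "\<rho> \<in> \<Delta>" "\<rho> \<subseteq> \<tau>" "\<tau> \<notin> \<Delta>"
  shows "bd b \<tau> = \<zero>"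
proof (rule ccontr)
  assume "bd b \<tau> \<noteq> \<zero>"
  then obtain v where "v \<in> V" "v \<notin> \<tau>" "b (insert v \<tau>) \<noteq> \<zero>" using bd_on_nonzero by blast
  then have "insert v \<tau> \<in> \<Delta>" using assms(2) by (auto simp: chain_def)
  moreover have "\<tau> \<subseteq> insert v \<tau>" by blast
  ultimately show False using assms(1,3,4,5) unfolding family_def by blast
qed

lemma chain_restr_bd:
  assumes "family \<Delta>" "chain \<Delta> (Suc i) b"
  shows "chain \<Delta> i (restr \<Delta> (bd b))"
  unfolding chain_def
proof (intro conjI allI impI)
  show "restr \<Delta> (bd b) \<sigma> \<in> carrier F" for \<sigma>
    using assms by (auto simp: restr_def chain_def)
  fix \<sigma> assume *: "restr \<Delta> (bd b) \<sigma> \<noteq> \<zero>"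
  then show s: "\<sigma> \<in> \<Delta>" by (auto simp: restr_def split: if_splits)
  from * s have "bd b \<sigma> \<noteq> \<zero>" by (simp add: restr_def)
  then obtain v where "v \<in> V" "v \<notin> \<sigma>" "b (insert v \<sigma>) \<noteq> \<zero>"
    using bd_on_nonzero by blast
  then show "card \<sigma> = i"
    using assms(2) family_finite[OF assms(1) s] by (auto simp: chain_def)
qed

text \<open>At a member of \<Delta> only supersets enter the second boundary, and by
  \<open>bd_outside\<close> truncation loses nothing on those that lie outside \<Delta>.\<close>

lemma bd_restr_bd:
  assumes "family \<Delta>" "chain \<Delta> i b" "\<tau> \<in> \<Delta>"
  shows "bd (restr \<Delta> (bd b)) \<tau> = \<zero>"
proof -
  have "bd (restr \<Delta> (bd b)) \<tau> = bd (bd b) \<tau>"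
  proof (rule bd_on_cong)
    show "coeffs (bd b)" using chain_coeffs[OF assms(2)] by simp
    show "restr \<Delta> (bd b) (insert v \<tau>) = bd b (insert v \<tau>)" for v
      using bd_outside[OF assms, of "insert v \<tau>"] by (simp add: restr_def subset_insertI)
  qed
  also have "\<dots> = \<zero>"
    using chain_coeffs[OF assms(2)] family_finite[OF assms(1,3)] finite_V by (rule bd_on_bd_on)
  finally show ?thesis .
qed

lemma cyc_restr_bd:
  "family \<Delta> \<Longrightarrow> chain \<Delta> (Suc i) b \<Longrightarrow> cyc \<Delta> i (restr \<Delta> (bd b))"
  using chain_restr_bd bd_restr_bd by (auto simp: cyc_def)

lemma family_convex:
  assumes "family \<Delta>" "\<rho> \<in> \<Delta>" "\<pi> \<in> \<Delta>" "\<rho> \<subseteq> \<tau>" "\<tau> \<subseteq> \<pi>"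
  shows "\<tau> \<in> \<Delta>"
proof -
  have "\<forall>\<rho>\<in>\<Delta>. \<forall>\<pi>\<in>\<Delta>. \<forall>\<tau>. \<rho> \<subseteq> \<tau> \<and> \<tau> \<subseteq> \<pi> \<longrightarrow> \<tau> \<in> \<Delta>"
    using assms(1) unfolding family_def by (rule conjunct2)
  from spec[OF bspec[OF bspec[OF this assms(2)] assms(3)]] assms(4,5)
  show ?thesis by (iprover intro: conjI elim: mp)
qed

lemma family_lk:
  assumes "family \<Delta>"
  shows "family (lk \<Delta> v)"
  unfolding family_def
proof (intro conjI ballI allI impI)
  show "lk \<Delta> v \<subseteq> Pow V" using family_subset[OF assms] by (auto simp: lk_def)
  fix \<rho> \<pi> \<tau>
  assume r: "\<rho> \<in> lk \<Delta> v" and p: "\<pi> \<in> lk \<Delta> v" and t: "\<rho> \<subseteq> \<tau> \<and> \<tau> \<subseteq> \<pi>"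
  have "insert v \<rho> \<in> \<Delta>" "insert v \<pi> \<in> \<Delta>" "v \<notin> \<pi>"
    using r p by (simp_all add: lk_def)
  then have "insert v \<tau> \<in> \<Delta>"
    using t family_convex[OF assms, of "insert v \<rho>" "insert v \<pi>" "insert v \<tau>"] by blast
  moreover have "v \<notin> \<tau>" using t \<open>v \<notin> \<pi>\<close> by blast
  ultimately show "\<tau> \<in> lk \<Delta> v" by (simp add: lk_def)
qed

lemma chain_contract:
  assumes "family \<Delta>" "chain \<Delta> (Suc i) c"
  shows "chain (lk \<Delta> v) i (contract v c)"
  unfolding chain_def
proof (intro conjI allI impI)
  show "contract v c \<sigma> \<in> carrier F" for \<sigma> using chain_coeffs[OF assms(2)] by simp
  fix \<sigma> assume "contract v c \<sigma> \<noteq> \<zero>"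
  then have *: "v \<notin> \<sigma>" "c (insert v \<sigma>) \<noteq> \<zero>" using contract_nonzero by blast+
  have **: "insert v \<sigma> \<in> \<Delta>" "card (insert v \<sigma>) = Suc i"
    using chain_face[OF assms(2) *(2)] chain_card[OF assms(2) *(2)] .
  show "\<sigma> \<in> lk \<Delta> v" using * ** by (simp add: lk_def)
  show "card \<sigma> = i" using * ** family_finite[OF assms(1) **(1)] by auto
qed

lemma chain_lift:
  assumes "family \<Delta>" "chain (lk \<Delta> v) i e"
  shows "chain \<Delta> (Suc i) (lift v e)"
  unfolding chain_def
proof (intro conjI allI impI)
  show "lift v e \<sigma> \<in> carrier F" for \<sigma> using chain_coeffs[OF assms(2)] by (simp add: lift_def)
  fix \<sigma> assume "lift v e \<sigma> \<noteq> \<zero>"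
  then have *: "v \<in> \<sigma>" "e (\<sigma> - {v}) \<noteq> \<zero>" by (auto simp: lift_def split: if_splits)
  have **: "\<sigma> - {v} \<in> lk \<Delta> v" "card (\<sigma> - {v}) = i"
    using chain_face[OF assms(2) *(2)] chain_card[OF assms(2) *(2)] .
  then show s: "\<sigma> \<in> \<Delta>" using * by (auto simp: lk_def insert_absorb)
  show "card \<sigma> = Suc i" using * ** family_finite[OF assms(1) s]
    by (metis card.remove)
qed

lemma contract_lift:
  assumes "chain (lk \<Delta> v) i e"
  shows "contract v (lift v e) = e"
proof
  fix \<tau>
  show "contract v (lift v e) \<tau> = e \<tau>"
  proof (cases "v \<in> \<tau>")
    case True
    then have "\<tau> \<notin> lk \<Delta> v" by (simp add: lk_def)
    then show ?thesis using True chain_outside[OF assms] by (simp add: contract_def)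
  next
    case False
    then show ?thesis using chain_coeffs[OF assms]
      by (simp add: contract_def lift_def)
  qed
qed

lemma cyc_contract:
  assumes "family \<Delta>" "cyc \<Delta> (Suc i) c"
  shows "cyc (lk \<Delta> v) i (contract v c)"
  unfolding cyc_def
proof (intro conjI ballI)
  have c: "chain \<Delta> (Suc i) c" using assms(2) by (simp add: cyc_def)
  show "chain (lk \<Delta> v) i (contract v c)" using chain_contract[OF assms(1) c] .
  fix \<tau> assume t: "\<tau> \<in> lk \<Delta> v"
  then have f: "finite \<tau>" using family_finite family_lk assms(1) by blast
  have "bd c (insert v \<tau>) = \<zero>" using t assms(2) by (auto simp: cyc_def lk_def)
  then have "contract v (bd c) \<tau> = \<zero>" by (simp add: contract_def)
  then have "\<ominus> bd (contract v c) \<tau> = \<zero>"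
    using contract_bd_on[OF chain_coeffs[OF c] f finite_V] by simp
  then show "bd (contract v c) \<tau> = \<zero>"
    using chain_coeffs[OF c] bd_on_closed contract_closed by (metis minus_minus minus_zero)
qed

text \<open>The next two lemmas are the exactness, at the deletion and at the link of a vertex, of the long
  exact sequence that relates the homology of the deletion, the whole family and the link.\<close>

lemma exact_del:
  assumes fam: "family \<Delta>" and ex: "exact \<Delta> i"
    and onto: "\<And>w. cyc (lk \<Delta> v) i w \<Longrightarrow> \<exists>z e. cyc \<Delta> (Suc i) z \<and> chain (lk \<Delta> v) (Suc i) e \<and>
      (\<forall>\<tau>\<in>lk \<Delta> v. w \<tau> = contract v z \<tau> \<oplus> bd e \<tau>)"
  shows "exact (del \<Delta> v) i"
  unfolding exact_def
proof (intro allI impI)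
  fix c assume c: "cyc (del \<Delta> v) i c"
  have c1: "chain \<Delta> i c" using c by (auto simp: cyc_def del_def intro: chain_mono)
  have cv: "c \<tau> = \<zero>" if "v \<in> \<tau>" for \<tau>
    using c that by (auto simp: cyc_def chain_def del_def)
  have "bd c \<tau> = \<zero>" if "\<tau> \<in> \<Delta>" for \<tau>
  proof (cases "v \<in> \<tau>")
    case True then show ?thesis using cv by (intro bd_on_eq_zeroI) auto
  next
    case False then show ?thesis using c that by (auto simp: cyc_def del_def)
  qed
  then have "cyc \<Delta> i c" using c1 by (simp add: cyc_def)
  then obtain b where b: "chain \<Delta> (Suc i) b" "\<And>\<tau>. \<tau> \<in> \<Delta> \<Longrightarrow> bd b \<tau> = c \<tau>"
    using ex by (auto simp: exact_def)
  have bc: "coeffs b" using chain_coeffs[OF b(1)] .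
  \<comment> \<open>The obstruction to moving \<open>b\<close> off \<open>v\<close>: as
    \<open>c\<close> avoids \<open>v\<close>, the contraction of \<open>b\<close> is a cycle of the
    link, and \<open>onto\<close> says that its class is restricted from a cycle of
    \<Delta>.\<close>
  have "cyc (lk \<Delta> v) i (contract v b)"
    unfolding cyc_def
  proof (intro conjI ballI)
    show "chain (lk \<Delta> v) i (contract v b)" using chain_contract[OF fam b(1)] .
    fix \<tau> assume t: "\<tau> \<in> lk \<Delta> v"
    then have f: "finite \<tau>" using family_finite family_lk fam by blast
    have "contract v (bd b) \<tau> = \<zero>" using t b(2) cv by (auto simp: contract_def lk_def)
    then have "\<ominus> bd (contract v b) \<tau> = \<zero>"
      using contract_bd_on[OF bc f finite_V] by simp
    then show "bd (contract v b) \<tau> = \<zero>"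
      using bc bd_on_closed contract_closed by (metis minus_minus minus_zero)
  qed
  then obtain z e where z: "cyc \<Delta> (Suc i) z" and e: "chain (lk \<Delta> v) (Suc i) e"
    and ze: "\<And>\<tau>. \<tau> \<in> lk \<Delta> v \<Longrightarrow> contract v b \<tau> = contract v z \<tau> \<oplus> bd e \<tau>"
    using onto by blast
  define g where "g = restr \<Delta> (bd (lift v e))"
  have l: "chain \<Delta> (Suc (Suc i)) (lift v e)" using chain_lift[OF fam e] .
  have g: "cyc \<Delta> (Suc i) g" unfolding g_def using cyc_restr_bd[OF fam l] .
  have zg: "chain \<Delta> (Suc i) z" "chain \<Delta> (Suc i) g" using z g by (auto simp: cyc_def)
  have co: "coeffs z" "coeffs g" "coeffs e" "coeffs (lift v e)"
    using chain_coeffs[OF zg(1)] chain_coeffs[OF zg(2)] chain_coeffs[OF e] chain_coeffs[OF l] .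
  \<comment> \<open>Subtracting \<open>z\<close> and adding the truncated boundary of the lift of
    \<open>e\<close> cancels the part of \<open>b\<close> at \<open>v\<close> without changing its
    boundary on \<Delta>. The plus sign is due to the anticommutation of contraction and
    boundary.\<close>
  define b' where "b' = (\<lambda>\<tau>. (b \<tau> \<ominus> z \<tau>) \<oplus> g \<tau>)"
  have b': "chain \<Delta> (Suc i) b'" unfolding b'_def by (intro chain_add chain_diff b zg)
  have "b' \<tau> = \<zero>" if "v \<in> \<tau>" for \<tau>
  proof (cases "\<tau> \<in> \<Delta>")
    case True
    define \<rho> where "\<rho> = \<tau> - {v}"
    have r: "\<tau> = insert v \<rho>" "v \<notin> \<rho>" "\<rho> \<in> lk \<Delta> v"
      using that True by (auto simp: \<rho>_def lk_def insert_absorb)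
    have f: "finite \<rho>" using family_finite[OF fam True] by (simp add: \<rho>_def)
    have "contract v g \<rho> = contract v (bd (lift v e)) \<rho>"
      using r True by (simp add: contract_def g_def restr_def)
    also have "\<dots> = \<ominus> bd e \<rho>"
      using contract_bd_on[OF co(4) f finite_V] contract_lift[OF e] by simp
    finally have cg: "contract v g \<rho> = \<ominus> bd e \<rho>" .
    have "contract v b' \<rho> = (contract v b \<rho> \<ominus> contract v z \<rho>) \<oplus> contract v g \<rho>"
      unfolding b'_def using bc co by (simp add: contract_add contract_diff)
    also have "\<dots> = ((contract v z \<rho> \<oplus> bd e \<rho>) \<ominus> contract v z \<rho>) \<oplus> \<ominus> bd e \<rho>"
      using ze[OF r(3)] cg by simp
    also have "\<dots> = \<zero>"
    proof -
      have "x \<in> carrier F \<Longrightarrow> y \<in> carrier F \<Longrightarrow> ((x \<oplus> y) \<ominus> x) \<oplus> \<ominus> y = \<zero>" for x y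
        by algebra
      then show ?thesis using co by simp
    qed
    finally show ?thesis using r contract_eq_zero[OF chain_coeffs[OF b']] by auto
  next
    case False then show ?thesis using chain_outside[OF b'] by simp
  qed
  then have "chain (del \<Delta> v) (Suc i) b'" using b' by (auto simp: chain_def del_def)
  moreover have "bd b' \<tau> = c \<tau>" if "\<tau> \<in> del \<Delta> v" for \<tau>
  proof -
    have t: "\<tau> \<in> \<Delta>" using that by (simp add: del_def)
    have "bd b' \<tau> = (bd b \<tau> \<ominus> bd z \<tau>) \<oplus> bd g \<tau>"
      unfolding b'_def using bc co finite_V by (simp add: bd_on_add bd_on_diff)
    also have "\<dots> = c \<tau>" using b(2)[OF t] z g t chain_coeffs[OF c1]
      by (simp add: cyc_def a_minus_def)
    finally show ?thesis .
  qed
  ultimately show "\<exists>b. chain (del \<Delta> v) (Suc i) b \<and> (\<forall>\<tau>\<in>del \<Delta> v. bd b \<tau> = c \<tau>)" by blast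
qed

lemma exact_lk:
  assumes fam: "family \<Delta>" and ex: "exact \<Delta> (Suc i)" and exd: "exact (del \<Delta> v) i"
  shows "exact (lk \<Delta> v) i"
  unfolding exact_def
proof (intro allI impI)
  fix w assume w: "cyc (lk \<Delta> v) i w"
  then have wc: "chain (lk \<Delta> v) i w" by (simp add: cyc_def)
  have l: "chain \<Delta> (Suc i) (lift v w)" using chain_lift[OF fam wc] .
  \<comment> \<open>Since \<open>w\<close> is a cycle, this truncated boundary has no coefficient on
    a face through \<open>v\<close>; it is therefore a cycle of the deletion.\<close>
  define g where "g = restr \<Delta> (bd (lift v w))"
  have g: "cyc \<Delta> i g" unfolding g_def using cyc_restr_bd[OF fam l] .
  have gv: "g \<tau> = \<zero>" if "v \<in> \<tau>" for \<tau>
  proof (cases "\<tau> \<in> \<Delta>")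
    case True
    define \<rho> where "\<rho> = \<tau> - {v}"
    have r: "\<tau> = insert v \<rho>" "v \<notin> \<rho>" "\<rho> \<in> lk \<Delta> v"
      using that True by (auto simp: \<rho>_def lk_def insert_absorb)
    have f: "finite \<rho>" using family_finite[OF fam True] by (simp add: \<rho>_def)
    have "contract v (bd (lift v w)) \<rho> = \<ominus> bd w \<rho>"
      using contract_bd_on[OF chain_coeffs[OF l] f finite_V] contract_lift[OF wc] by simp
    also have "\<dots> = \<zero>" using w r by (simp add: cyc_def)
    finally have "bd (lift v w) (insert v \<rho>) = \<zero>"
      using r contract_eq_zero[of "bd (lift v w)"] chain_coeffs[OF l] by auto
    then show ?thesis using r by (simp add: g_def restr_def)
  next
    case False then show ?thesis by (simp add: g_def restr_def)
  qed
  have "cyc (del \<Delta> v) i g"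
    using g gv by (auto simp: cyc_def chain_def del_def)
  then obtain e where e: "chain (del \<Delta> v) (Suc i) e" "\<And>\<tau>. \<tau> \<in> del \<Delta> v \<Longrightarrow> bd e \<tau> = g \<tau>"
    using exd by (auto simp: exact_def)
  have e': "chain \<Delta> (Suc i) e" using e(1) by (auto simp: del_def intro: chain_mono)
  have ev: "e \<tau> = \<zero>" if "v \<in> \<tau>" for \<tau> using that e(1) by (auto simp: chain_def del_def)
  \<comment> \<open>Correcting the lift by a filling in the deletion closes it to a cycle of
    \<Delta> whose contraction at \<open>v\<close> is still \<open>w\<close>.\<close>
  define h where "h = (\<lambda>\<tau>. lift v w \<tau> \<ominus> e \<tau>)"
  have hc: "chain \<Delta> (Suc i) h" unfolding h_def by (intro chain_diff l e')
  have "bd h \<tau> = \<zero>" if t: "\<tau> \<in> \<Delta>" for \<tau>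
  proof -
    have "bd e \<tau> = g \<tau>"
    proof (cases "v \<in> \<tau>")
      case True
      then show ?thesis using gv ev by (auto intro!: bd_on_eq_zeroI)
    next
      case False then show ?thesis using e(2) t by (simp add: del_def)
    qed
    also have "\<dots> = bd (lift v w) \<tau>" using t by (simp add: g_def restr_def)
    finally show ?thesis
      unfolding h_def bd_on_diff[OF chain_coeffs[OF l] chain_coeffs[OF e'] finite_V]
      using chain_coeffs[OF l] by (simp add: r_neg a_minus_def)
  qed
  then have "cyc \<Delta> (Suc i) h" using hc by (simp add: cyc_def)
  then obtain f where f: "chain \<Delta> (Suc (Suc i)) f" "\<And>\<tau>. \<tau> \<in> \<Delta> \<Longrightarrow> bd f \<tau> = h \<tau>"
    using ex by (auto simp: exact_def)
  have fc: "coeffs f" using chain_coeffs[OF f(1)] .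
  have fv: "chain (lk \<Delta> v) (Suc i) (contract v f)" using chain_contract[OF fam f(1)] .
  have "bd (\<lambda>\<tau>. \<ominus> contract v f \<tau>) \<tau> = w \<tau>" if t: "\<tau> \<in> lk \<Delta> v" for \<tau>
  proof -
    have ft: "finite \<tau>" using family_finite[OF family_lk[OF fam] t] .
    have tv: "v \<notin> \<tau>" "insert v \<tau> \<in> \<Delta>" using t by (auto simp: lk_def)
    have "bd (\<lambda>\<tau>. \<ominus> contract v f \<tau>) \<tau> = contract v (bd f) \<tau>"
      using contract_bd_on[OF fc ft finite_V] fc finite_V by (simp add: bd_on_minus)
    also have "\<dots> = contract v h \<tau>" using f(2)[OF tv(2)] by (simp add: contract_def)
    also have "\<dots> = contract v (lift v w) \<tau> \<ominus> contract v e \<tau>"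
      unfolding h_def using chain_coeffs[OF l] chain_coeffs[OF e'] by (simp add: contract_diff)
    also have "\<dots> = w \<tau>"
    proof -
      have "contract v e \<tau> = \<zero>" using ev by (simp add: contract_def)
      then show ?thesis using contract_lift[OF wc] chain_coeffs[OF wc] by (simp add: a_minus_def)
    qed
    finally show ?thesis .
  qed
  then show "\<exists>b. chain (lk \<Delta> v) (Suc i) b \<and> (\<forall>\<tau>\<in>lk \<Delta> v. bd b \<tau> = w \<tau>)"
    using chain_minus[OF fv] by blast
qed

subsection \<open>Reduced homology in terms of chains\<close>

definition subcomplex :: "'a set set \<Rightarrow> bool" where
  "subcomplex K \<longleftrightarrow> K \<subseteq> Pow V \<and> (\<forall>\<sigma>\<in>K. Pow \<sigma> \<subseteq> K)"

text \<open>In contrast to \<open>top_line\<close>, boundaries are divided out: the class of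
  \<open>z\<close> is nonzero and spans the homology.\<close>

definition line :: "'a set set \<Rightarrow> nat \<Rightarrow> bool" where
  "line K i \<longleftrightarrow> (\<exists>z. cyc K i z \<and> \<not> (\<exists>b. chain K (Suc i) b \<and> (\<forall>\<tau>\<in>K. bd b \<tau> = z \<tau>)) \<and>
     (\<forall>c. cyc K i c \<longrightarrow> (\<exists>a\<in>carrier F. \<exists>b. chain K (Suc i) b \<and>
        (\<forall>\<tau>. c \<tau> = a \<otimes> z \<tau> \<oplus> bd b \<tau>))))"

lemma subcomplexD: "subcomplex K \<Longrightarrow> \<sigma> \<in> K \<Longrightarrow> \<tau> \<subseteq> \<sigma> \<Longrightarrow> \<tau> \<in> K"
  unfolding subcomplex_def by (metis PowI subsetD)

lemma subcomplex_finite: "subcomplex K \<Longrightarrow> \<sigma> \<in> K \<Longrightarrow> finite \<sigma>"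
  unfolding subcomplex_def using finite_V by (metis PowD finite_subset subsetD)

lemma subcomplex_subset: "subcomplex K \<Longrightarrow> \<sigma> \<in> K \<Longrightarrow> \<sigma> \<subseteq> V"
  unfolding subcomplex_def by (metis PowD subsetD)

lemma subcomplex_if_simplicial:
  assumes "simplicial_complex K" "vertices K \<subseteq> V"
  shows "subcomplex K"
  unfolding subcomplex_def
proof (intro conjI ballI subsetI)
  show "\<sigma> \<in> Pow V" if "\<sigma> \<in> K" for \<sigma>
    using that assms(2) by (auto simp: vertices_def)
  show "\<tau> \<in> K" if "\<sigma> \<in> K" "\<tau> \<in> Pow \<sigma>" for \<sigma> \<tau>
    using simplicial_complex_subset[OF assms(1)] that by simp
qed

lemma subcomplex_link:
  assumes K: "subcomplex K"
  shows "subcomplex (link \<sigma> K)"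
  unfolding subcomplex_def
proof (intro conjI ballI subsetI)
  show "\<tau> \<in> Pow V" if "\<tau> \<in> link \<sigma> K" for \<tau>
    using that subcomplex_subset[OF K, of \<tau>] by (simp add: link_def)
  fix \<tau> \<tau>' assume t: "\<tau> \<in> link \<sigma> K" "\<tau>' \<in> Pow \<tau>"
  have "\<tau>' \<in> K" using subcomplexD[OF K, of \<tau> \<tau>'] t by (simp add: link_def)
  moreover have "\<sigma> \<union> \<tau>' \<in> K"
    using subcomplexD[OF K, of "\<sigma> \<union> \<tau>" "\<sigma> \<union> \<tau>'"] t by (auto simp: link_def)
  ultimately show "\<tau>' \<in> link \<sigma> K" using t by (auto simp: link_def)
qed

lemma bd_outside_subcomplex:
  assumes "subcomplex K" "chain K i c" "\<tau> \<notin> K"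
  shows "bd c \<tau> = \<zero>"
proof (rule bd_on_eq_zeroI)
  fix v
  have "insert v \<tau> \<notin> K" using assms(3) subcomplexD[OF assms(1), of "insert v \<tau>" \<tau>] by blast
  then show "c (insert v \<tau>) = \<zero>" by (rule chain_outside[OF assms(2)])
qed

lemma chain_bd:
  assumes "subcomplex K" "chain K (Suc i) c"
  shows "chain K i (bd c)"
  unfolding chain_def
proof (intro conjI allI impI)
  show "bd c \<sigma> \<in> carrier F" for \<sigma> using chain_coeffs[OF assms(2)] by simp
  fix \<sigma> assume *: "bd c \<sigma> \<noteq> \<zero>"
  then show s: "\<sigma> \<in> K" using bd_outside_subcomplex[OF assms] by blast
  obtain v where v: "v \<notin> \<sigma>" "c (insert v \<sigma>) \<noteq> \<zero>" using bd_on_nonzero[OF *] by blast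
  have "card (insert v \<sigma>) = Suc i" using chain_card[OF assms(2) v(2)] .
  then show "card \<sigma> = i" using v subcomplex_finite[OF assms(1) s] by simp
qed

lemma boundary_map_eq_bd:
  assumes "subcomplex K" "chain K i c"
  shows "boundary_map F K c = bd c"
proof
  fix \<tau>
  have V: "vertices K \<subseteq> V" using assms(1) by (auto simp: vertices_def subcomplex_def)
  show "boundary_map F K c \<tau> = bd c \<tau>"
    unfolding boundary_map_def bd_on_def
  proof (rule add.finprod_mono_neutral_cong_left)
    show "finite V" by (rule finite_V)
    show "vertices K - \<tau> \<subseteq> V" using V by blast
    show "contract v c \<tau> = \<zero>" if v: "v \<in> V - (vertices K - \<tau>)" for v
    proof (cases "v \<in> \<tau>")
      case True then show ?thesis by (simp add: contract_def)
    next
      case False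
      then have "insert v \<tau> \<notin> K" using v by (auto simp: vertices_def)
      then have "c (insert v \<tau>) = \<zero>" by (rule chain_outside[OF assms(2)])
      then show ?thesis by (simp add: contract_def)
    qed
    show "\<ominus> \<one> [^] card {u \<in> \<tau>. u < v} \<otimes> c (insert v \<tau>) = contract v c \<tau>"
      if "v \<in> vertices K - \<tau>" for v
      using that by (simp add: contract_def sg_def)
    show "(\<lambda>v. contract v c \<tau>) \<in> V \<rightarrow> carrier F" using chain_coeffs[OF assms(2)] by simp
  qed
qed

lemma carrier_chain_module: "c \<in> carrier (chain_module F K (int j - 1)) \<longleftrightarrow> chain K j c"
  unfolding chain_module_def chain_def face_dim_def by auto

lemma carrier_cycle_module:
  assumes "subcomplex K"
  shows "c \<in> carrier (cycle_module F K (int j - 1)) \<longleftrightarrow> cyc K j c"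
proof -
  have "c \<in> carrier (cycle_module F K (int j - 1)) \<longleftrightarrow>
      chain K j c \<and> (\<forall>\<tau>. boundary_map F K c \<tau> = \<zero>)"
    by (simp add: cycle_module_def carrier_chain_module)
  also have "\<dots> \<longleftrightarrow> chain K j c \<and> (\<forall>\<tau>. bd c \<tau> = \<zero>)"
    using boundary_map_eq_bd[OF assms] by auto
  also have "\<dots> \<longleftrightarrow> cyc K j c"
    unfolding cyc_def using bd_outside_subcomplex[OF assms] by blast
  finally show ?thesis .
qed

lemma boundaries_eq:
  assumes "subcomplex K"
  shows "boundaries F K (int j - 1) = {bd b |b. chain K (Suc j) b}"
proof -
  have "carrier (chain_module F K (int j - 1 + 1)) = {b. chain K (Suc j) b}"
    using carrier_chain_module[of _ K "Suc j"] by auto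
  then show ?thesis
    unfolding boundaries_def using boundary_map_eq_bd[OF assms] by (auto simp: image_def)
qed

text \<open>With cosets in this pointwise form, the quotient module can be unfolded without first
  establishing a group structure on the cycles.\<close>

definition coset :: "('a set \<Rightarrow> 'f) set \<Rightarrow> ('a set \<Rightarrow> 'f) \<Rightarrow> ('a set \<Rightarrow> 'f) set" where
  "coset N z = {\<lambda>\<sigma>. h \<sigma> \<oplus> z \<sigma> |h. h \<in> N}"

lemma cosetI: "h \<in> N \<Longrightarrow> w = (\<lambda>\<sigma>. h \<sigma> \<oplus> z \<sigma>) \<Longrightarrow> w \<in> coset N z"
  unfolding coset_def by auto

lemma a_r_coset_eq: "N +>\<^bsub>cycle_module F K i\<^esub> z = coset N z"
  unfolding a_r_coset_defs cycle_module_def chain_module_def coset_def by auto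

lemma carrier_homology:
  "carrier (reduced_homology F K i) =
    coset (boundaries F K i) ` carrier (cycle_module F K i)"
  unfolding reduced_homology_def quotient_module_def A_RCOSETS_def'
  by (auto simp: a_r_coset_eq)

lemma zero_homology: "\<zero>\<^bsub>reduced_homology F K i\<^esub> = boundaries F K i"
  by (simp add: reduced_homology_def quotient_module_def)

lemma smult_homology:
  "a \<odot>\<^bsub>reduced_homology F K i\<^esub> X = (\<Union>x\<in>X. coset (boundaries F K i) (\<lambda>\<sigma>. a \<otimes> x \<sigma>))"
  by (simp add: reduced_homology_def quotient_module_def a_r_coset_eq)
    (simp add: cycle_module_def chain_module_def)

lemma mem_coset_self:
  assumes "subcomplex K" "chain K j z"
  shows "z \<in> coset (boundaries F K (int j - 1)) z"
proof -
  have "(\<lambda>\<sigma>. \<zero>) \<in> boundaries F K (int j - 1)"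
    unfolding boundaries_eq[OF assms(1)] using chain_zero[of K "Suc j"] bd_on_zero
    by (intro CollectI exI[of _ "\<lambda>\<sigma>. \<zero>"]) auto
  moreover have "z = (\<lambda>\<sigma>. \<zero> \<oplus> z \<sigma>)" using chain_coeffs[OF assms(2)] by auto
  ultimately show ?thesis by (rule cosetI)
qed

lemma exact_if_homology_trivial:
  assumes K: "subcomplex K"
    and triv: "carrier (reduced_homology F K (int j - 1)) = {\<zero>\<^bsub>reduced_homology F K (int j - 1)\<^esub>}"
  shows "exact K j"
  unfolding exact_def
proof (intro allI impI)
  fix c assume c: "cyc K j c"
  then have "coset (boundaries F K (int j - 1)) c \<in> carrier (reduced_homology F K (int j - 1))"
    by (simp add: carrier_homology carrier_cycle_module[OF K])
  then have "coset (boundaries F K (int j - 1)) c = boundaries F K (int j - 1)"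
    using triv by (simp add: zero_homology)
  moreover have "chain K j c" using c by (simp add: cyc_def)
  ultimately have "c \<in> boundaries F K (int j - 1)" using mem_coset_self[OF K] by blast
  then show "\<exists>b. chain K (Suc j) b \<and> (\<forall>\<tau>\<in>K. bd b \<tau> = c \<tau>)"
    unfolding boundaries_eq[OF K] by auto
qed

text \<open>The class sent to \<open>\<one>\<close> generates: any other class has some image
  \<open>a\<close>, which is also the image of \<open>a\<close> times the generator, and the
  isomorphism is injective.\<close>

lemma line_if_homology_line:
  assumes K: "subcomplex K"
    and iso: "linearly_isomorphic F (reduced_homology F K (int j - 1)) (scalar_module F)"
  shows "line K j"
proof -
  define N where "N = boundaries F K (int j - 1)"
  let ?H = "reduced_homology F K (int j - 1)"
  have N: "N = {bd b |b. chain K (Suc j) b}" unfolding N_def by (rule boundaries_eq[OF K])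
  have H: "X \<in> carrier ?H \<longleftrightarrow> (\<exists>z. cyc K j z \<and> X = coset N z)" for X
    unfolding carrier_homology N_def using carrier_cycle_module[OF K] by auto
  obtain h where h: "bij_betw h (carrier ?H) (carrier F)"
    and hm: "\<And>a X. a \<in> carrier F \<Longrightarrow> X \<in> carrier ?H \<Longrightarrow> h (a \<odot>\<^bsub>?H\<^esub> X) = a \<otimes> h X"
    using iso unfolding linearly_isomorphic_def by (auto simp: scalar_module_def)
  have N_add: "(\<lambda>\<sigma>. x \<sigma> \<oplus> y \<sigma>) \<in> N" if xy: "x \<in> N" "y \<in> N" for x y
  proof -
    obtain b b' where b: "chain K (Suc j) b" "x = bd b" and b': "chain K (Suc j) b'" "y = bd b'"
      using xy unfolding N by blast
    have "bd (\<lambda>\<sigma>. b \<sigma> \<oplus> b' \<sigma>) = (\<lambda>\<sigma>. x \<sigma> \<oplus> y \<sigma>)"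
      using bd_on_add[OF chain_coeffs[OF b(1)] chain_coeffs[OF b'(1)]] b b' by auto
    then show ?thesis using chain_add[OF b(1) b'(1)] N by force
  qed
  have N_mult: "(\<lambda>\<sigma>. a \<otimes> x \<sigma>) \<in> N" if a: "a \<in> carrier F" and x: "x \<in> N" for x a
  proof -
    obtain b where b: "chain K (Suc j) b" "x = bd b" using x unfolding N by blast
    have "bd (\<lambda>\<sigma>. a \<otimes> b \<sigma>) = (\<lambda>\<sigma>. a \<otimes> x \<sigma>)"
      using bd_on_mult[OF chain_coeffs[OF b(1)] a finite_V] b by auto
    then show ?thesis using chain_mult[OF b(1) a] N by force
  qed
  have N_coeffs: "coeffs x" if x: "x \<in> N" for x
  proof -
    obtain b where "chain K (Suc j) b" "x = bd b" using x unfolding N by blast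
    then show ?thesis using chain_coeffs[of K "Suc j" b] by simp
  qed
  have N_coset: "coset N z = N" if z: "z \<in> N" for z
  proof (intro equalityI subsetI)
    show "x \<in> N" if "x \<in> coset N z" for x using that z N_add unfolding coset_def by blast
    show "x \<in> coset N z" if x: "x \<in> N" for x
    proof -
      have m: "(\<lambda>\<sigma>. x \<sigma> \<oplus> (\<ominus> \<one>) \<otimes> z \<sigma>) \<in> N" using x z by (intro N_add N_mult) auto
      have "x = (\<lambda>\<sigma>. (x \<sigma> \<oplus> (\<ominus> \<one>) \<otimes> z \<sigma>) \<oplus> z \<sigma>)"
        using N_coeffs[OF x] N_coeffs[OF z] by (auto simp: l_minus a_assoc l_neg)
      from m this show ?thesis by (rule cosetI)
    qed
  qed
  \<comment> \<open>The scalar action on the quotient is a union over representatives; all of them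
    yield the same coset, so the union is that coset.\<close>
  have smult: "a \<odot>\<^bsub>?H\<^esub> coset N z = coset N (\<lambda>\<sigma>. a \<otimes> z \<sigma>)"
    if a: "a \<in> carrier F" and z: "coeffs z" for a z
  proof -
    have *: "coset N (\<lambda>\<sigma>. a \<otimes> x \<sigma>) = coset N (\<lambda>\<sigma>. a \<otimes> z \<sigma>)" if x: "x \<in> coset N z" for x
    proof -
      obtain g where g: "g \<in> N" "x = (\<lambda>\<sigma>. g \<sigma> \<oplus> z \<sigma>)" using x unfolding coset_def by blast
      have gc: "coeffs g" using N_coeffs[OF g(1)] .
      define g' where "g' = (\<lambda>\<sigma>. a \<otimes> g \<sigma>)"
      have g': "g' \<in> N" "coeffs g'" unfolding g'_def using N_mult[OF a g(1)] a gc by auto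
      have e: "y \<sigma> \<oplus> a \<otimes> x \<sigma> = (y \<sigma> \<oplus> g' \<sigma>) \<oplus> a \<otimes> z \<sigma>" if "coeffs y" for y \<sigma>
        unfolding g g'_def using that a gc z by (simp add: r_distr a_assoc)
      show ?thesis
      proof (intro equalityI subsetI)
        fix w assume "w \<in> coset N (\<lambda>\<sigma>. a \<otimes> x \<sigma>)"
        then obtain y where y: "y \<in> N" "w = (\<lambda>\<sigma>. y \<sigma> \<oplus> a \<otimes> x \<sigma>)" unfolding coset_def by blast
        then have "w = (\<lambda>\<sigma>. (y \<sigma> \<oplus> g' \<sigma>) \<oplus> a \<otimes> z \<sigma>)" using e[OF N_coeffs[OF y(1)]] by presburger
        with N_add[OF y(1) g'(1)] show "w \<in> coset N (\<lambda>\<sigma>. a \<otimes> z \<sigma>)" by (rule cosetI)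
      next
        fix w assume "w \<in> coset N (\<lambda>\<sigma>. a \<otimes> z \<sigma>)"
        then obtain y where y: "y \<in> N" "w = (\<lambda>\<sigma>. y \<sigma> \<oplus> a \<otimes> z \<sigma>)" unfolding coset_def by blast
        have yc: "coeffs y" using N_coeffs[OF y(1)] .
        define y' where "y' = (\<lambda>\<sigma>. y \<sigma> \<oplus> (\<ominus> \<one>) \<otimes> g' \<sigma>)"
        have y': "y' \<in> N" unfolding y'_def using y(1) g'(1) by (intro N_add N_mult) auto
        have "y' \<sigma> \<oplus> g' \<sigma> = y \<sigma>" for \<sigma>
          using yc g'(2) unfolding y'_def by (simp add: l_minus a_assoc l_neg)
        then have "w = (\<lambda>\<sigma>. y' \<sigma> \<oplus> a \<otimes> x \<sigma>)" using e[OF N_coeffs[OF y']] y(2) by presburger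
        with y' show "w \<in> coset N (\<lambda>\<sigma>. a \<otimes> x \<sigma>)" by (rule cosetI)
      qed
    qed
    have ne: "coset N z \<noteq> {}"
      unfolding coset_def N using chain_zero[of K "Suc j"] by blast
    show ?thesis
      unfolding smult_homology N_def[symmetric] using * ne by auto
  qed
  have "\<exists>X\<in>carrier ?H. h X = \<one>"
    using h one_closed unfolding bij_betw_def by (metis imageE)
  then obtain z where z: "cyc K j z" "h (coset N z) = \<one>" using H by auto
  have zc: "coeffs z" using z(1) chain_coeffs[of K j z] by (simp add: cyc_def)
  have zH: "coset N z \<in> carrier ?H" using H z by auto
  \<comment> \<open>If \<open>z\<close> were a boundary, its class would be the zero class, which
    the scalar \<open>\<zero>\<close> fixes; its image would then be \<open>\<zero>\<close> instead
    of \<open>\<one>\<close>.\<close>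
  have nb: "z \<notin> N"
  proof
    assume "z \<in> N"
    then have e: "coset N z = N" "coset N (\<lambda>\<sigma>. \<zero> \<otimes> z \<sigma>) = N"
      using N_coset N_mult[OF zero_closed] by blast+
    have "h (\<zero> \<odot>\<^bsub>?H\<^esub> coset N z) = \<zero> \<otimes> h (coset N z)" using hm[OF zero_closed zH] .
    then have "h N = \<zero>" using smult[OF zero_closed zc] e z(2) by simp
    then show False using z(2) e by simp
  qed
  show ?thesis
    unfolding line_def
  proof (intro exI[of _ z] conjI allI impI)
    show "cyc K j z" by fact
    show "\<not> (\<exists>b. chain K (Suc j) b \<and> (\<forall>\<tau>\<in>K. bd b \<tau> = z \<tau>))"
    proof
      assume "\<exists>b. chain K (Suc j) b \<and> (\<forall>\<tau>\<in>K. bd b \<tau> = z \<tau>)"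
      then obtain b where b: "chain K (Suc j) b" "\<And>\<tau>. \<tau> \<in> K \<Longrightarrow> bd b \<tau> = z \<tau>" by blast
      have "bd b \<tau> = z \<tau>" for \<tau>
        using b bd_outside_subcomplex[OF K b(1)] chain_outside[of K j z] z(1)
        by (cases "\<tau> \<in> K") (simp_all add: cyc_def)
      then have "z = bd b" by auto
      then show False using nb b(1) N by blast
    qed
    fix c assume c: "cyc K j c"
    have cH: "coset N c \<in> carrier ?H" using H c by auto
    define a where "a = h (coset N c)"
    have a: "a \<in> carrier F" unfolding a_def using h cH by (auto simp: bij_betw_def)
    have "cyc K j (\<lambda>\<sigma>. a \<otimes> z \<sigma>)"
      using z(1) a zc chain_mult bd_on_mult[OF zc a finite_V] by (simp add: cyc_def)
    then have azH: "coset N (\<lambda>\<sigma>. a \<otimes> z \<sigma>) \<in> carrier ?H" using H by auto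
    have "h (coset N (\<lambda>\<sigma>. a \<otimes> z \<sigma>)) = a" using hm[OF a zH] smult[OF a zc] z(2) a by simp
    then have "coset N (\<lambda>\<sigma>. a \<otimes> z \<sigma>) = coset N c"
      using h azH cH unfolding a_def bij_betw_def by (metis inj_onD)
    moreover have "c \<in> coset N c"
      using c mem_coset_self[OF K, of j c] by (simp add: N_def cyc_def)
    ultimately obtain b where b: "chain K (Suc j) b" "c = (\<lambda>\<sigma>. bd b \<sigma> \<oplus> a \<otimes> z \<sigma>)"
      unfolding coset_def N by auto
    have "c \<tau> = a \<otimes> z \<tau> \<oplus> bd b \<tau>" for \<tau>
      unfolding b(2) using a zc chain_coeffs[OF b(1)] by (simp add: a_comm)
    then show "\<exists>a\<in>carrier F. \<exists>b. chain K (Suc j) b \<and> (\<forall>\<tau>. c \<tau> = a \<otimes> z \<tau> \<oplus> bd b \<tau>)"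
      using a b(1) by blast
  qed
qed

lemma exact_if_acyclic: "subcomplex K \<Longrightarrow> acyclic_complex F K \<Longrightarrow> exact K j"
  by (rule exact_if_homology_trivial) (simp_all add: acyclic_complex_def)

lemma exact_if_sphere:
  assumes "subcomplex K" "has_homology_of_sphere F m K" "int j \<noteq> m + 1"
  shows "exact K j"
proof (rule exact_if_homology_trivial[OF assms(1)])
  show "carrier (reduced_homology F K (int j - 1)) = {\<zero>\<^bsub>reduced_homology F K (int j - 1)\<^esub>}"
    using assms(2)[unfolded has_homology_of_sphere_def, rule_format, of "int j - 1"] assms(3)
    by (simp split: if_splits)
qed

lemma line_if_sphere:
  assumes "subcomplex K" "has_homology_of_sphere F m K" "int j = m + 1"
  shows "line K j"
proof (rule line_if_homology_line[OF assms(1)])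
  show "linearly_isomorphic F (reduced_homology F K (int j - 1)) (scalar_module F)"
    using assms(2)[unfolded has_homology_of_sphere_def, rule_format, of "int j - 1"] assms(3)
    by simp
qed

subsection \<open>Pairs of complexes and connectedness\<close>

lemma family_pair:
  assumes "subcomplex K" "subcomplex L"
  shows "family (K - L)"
  unfolding family_def
proof (intro conjI ballI allI impI)
  show "K - L \<subseteq> Pow V" using subcomplex_subset[OF assms(1)] by auto
  fix \<rho> \<pi> \<tau> assume "\<rho> \<in> K - L" "\<pi> \<in> K - L" "\<rho> \<subseteq> \<tau> \<and> \<tau> \<subseteq> \<pi>"
  then show "\<tau> \<in> K - L"
    using subcomplexD[OF assms(1), of \<pi> \<tau>] subcomplexD[OF assms(2), of \<tau> \<rho>] by auto
qed

lemma bd_restr_pair: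
  assumes L: "subcomplex L" and f: "chain K i f" and t: "\<tau> \<in> K - L"
  shows "bd (restr (K - L) f) \<tau> = bd f \<tau>"
proof (rule bd_on_cong[OF chain_coeffs[OF f]])
  fix v
  have "insert v \<tau> \<notin> L" using t subcomplexD[OF L, of "insert v \<tau>" \<tau>] by blast
  then show "restr (K - L) f (insert v \<tau>) = f (insert v \<tau>)"
    using chain_outside[OF f] by (auto simp: restr_def)
qed

text \<open>The connecting map of the pair on the level of chains: the relative cycle condition
  removes the coefficients on \<open>K - L\<close>, so the boundary lives on
  \<open>L\<close>.\<close>

lemma cyc_bd_pair:
  assumes K: "subcomplex K" and L: "subcomplex L" and c: "cyc (K - L) (Suc i) c"
  shows "cyc L i (bd c)"
proof -
  have cc: "chain K (Suc i) c" using c chain_mono[of "K - L" "Suc i" c K] by (auto simp: cyc_def)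
  have b: "chain K i (bd c)" using chain_bd[OF K cc] .
  have z: "bd c \<tau> = \<zero>" if "\<tau> \<notin> L" for \<tau>
    using that c chain_outside[OF b] by (cases "\<tau> \<in> K") (auto simp: cyc_def)
  have "chain L i (bd c)"
    unfolding chain_def using chain_coeffs[OF b] chain_card[OF b] z by blast
  moreover have "bd (bd c) \<tau> = \<zero>" if "\<tau> \<in> L" for \<tau>
    using chain_coeffs[OF cc] subcomplex_finite[OF L that] finite_V by (rule bd_on_bd_on)
  ultimately show ?thesis by (simp add: cyc_def)
qed

text \<open>A piece of the long exact sequence of the pair. Filling the boundary of \<open>c\<close>
  inside \<open>L\<close> turns \<open>c\<close> into an absolute cycle of \<open>K\<close>; a
  filling of that cycle, truncated to \<open>K - L\<close>, fills \<open>c\<close>.\<close>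

lemma exact_pair:
  assumes K: "subcomplex K" and L: "subcomplex L" and LK: "L \<subseteq> K"
    and exK: "exact K (Suc i)" and exL: "exact L i"
  shows "exact (K - L) (Suc i)"
  unfolding exact_def
proof (intro allI impI)
  fix c assume c: "cyc (K - L) (Suc i) c"
  have cD: "chain (K - L) (Suc i) c" using c by (simp add: cyc_def)
  have cc: "chain K (Suc i) c" using chain_mono[OF cD] by auto
  have b: "cyc L i (bd c)" using cyc_bd_pair[OF K L c] .
  then obtain e where e: "chain L (Suc i) e" "\<And>\<tau>. \<tau> \<in> L \<Longrightarrow> bd e \<tau> = bd c \<tau>"
    using exL unfolding exact_def by blast
  have eK: "chain K (Suc i) e" using chain_mono[OF e(1) LK] .
  have be: "bd e \<tau> = bd c \<tau>" for \<tau>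
    using e(2) bd_outside_subcomplex[OF L e(1)] chain_outside[of L i "bd c" \<tau>] b
    by (cases "\<tau> \<in> L") (simp_all add: cyc_def)
  define h where "h = (\<lambda>\<tau>. c \<tau> \<ominus> e \<tau>)"
  have h: "chain K (Suc i) h" unfolding h_def using chain_diff[OF cc eK] .
  have "bd h \<tau> = \<zero>" for \<tau>
    unfolding h_def bd_on_diff[OF chain_coeffs[OF cc] chain_coeffs[OF eK] finite_V] be
    using chain_coeffs[OF cc] by (simp add: r_neg a_minus_def)
  then have "cyc K (Suc i) h" using h by (simp add: cyc_def)
  then obtain f where f: "chain K (Suc (Suc i)) f" "\<And>\<tau>. \<tau> \<in> K \<Longrightarrow> bd f \<tau> = h \<tau>"
    using exK unfolding exact_def by blast
  have "bd (restr (K - L) f) \<tau> = c \<tau>" if t: "\<tau> \<in> K - L" for \<tau>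
  proof -
    have "e \<tau> = \<zero>" using t chain_outside[OF e(1)] by blast
    then have "h \<tau> = c \<tau>" using chain_coeffs[OF cc] by (simp add: h_def a_minus_def)
    then show ?thesis using bd_restr_pair[OF L f(1) t] f(2) t by simp
  qed
  then show "\<exists>b. chain (K - L) (Suc (Suc i)) b \<and> (\<forall>\<tau>\<in>K - L. bd b \<tau> = c \<tau>)"
    using chain_restr[OF f(1)] by blast
qed

text \<open>With the homology of \<open>K\<close> zero in both degrees, the connecting map
  identifies the relative homology with that of \<open>L\<close>; by \<open>top\<close>, relative
  classes are cycles.\<close>

lemma top_line_pair:
  assumes K: "subcomplex K" and L: "subcomplex L" and LK: "L \<subseteq> K"
    and top: "\<And>\<tau>. \<tau> \<in> K \<Longrightarrow> card \<tau> \<noteq> Suc (Suc i)"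
    and exK: "exact K (Suc i)" "exact K i" and L1: "line L i"
  shows "top_line (K - L) (Suc i)"
proof -
  obtain z where z: "cyc L i z" "\<nexists>b. chain L (Suc i) b \<and> (\<forall>\<tau>\<in>L. bd b \<tau> = z \<tau>)"
    and gen: "\<And>c. cyc L i c \<Longrightarrow> \<exists>a\<in>carrier F. \<exists>b. chain L (Suc i) b \<and> (\<forall>\<tau>. c \<tau> = a \<otimes> z \<tau> \<oplus> bd b \<tau>)"
    using L1 unfolding line_def by blast
  have zL: "chain L i z" using z(1) by (simp add: cyc_def)
  have zK: "chain K i z" using chain_mono[OF zL LK] .
  have "bd z \<tau> = \<zero>" for \<tau>
    using z(1) bd_outside_subcomplex[OF L zL] by (cases "\<tau> \<in> L") (simp_all add: cyc_def)
  then have "cyc K i z" using zK by (simp add: cyc_def)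
  then obtain f where f: "chain K (Suc i) f" "\<And>\<tau>. \<tau> \<in> K \<Longrightarrow> bd f \<tau> = z \<tau>"
    using exK(2) unfolding exact_def by blast
  define f1 where "f1 = restr (K - L) f"
  have f1: "chain (K - L) (Suc i) f1" unfolding f1_def using chain_restr[OF f(1)] .
  have "bd f1 \<tau> = \<zero>" if t: "\<tau> \<in> K - L" for \<tau>
    unfolding f1_def bd_restr_pair[OF L f(1) t] using f(2) t chain_outside[OF zL] by simp
  then have cf1: "cyc (K - L) (Suc i) f1" using f1 by (simp add: cyc_def)
  \<comment> \<open>Without a coefficient on \<open>K - L\<close>, the filling \<open>f\<close>
    would be a chain of \<open>L\<close> and would bound \<open>z\<close> there.\<close>
  have nz: "\<exists>\<sigma>. f1 \<sigma> \<noteq> \<zero>"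
  proof (rule ccontr)
    assume "\<nexists>\<sigma>. f1 \<sigma> \<noteq> \<zero>"
    then have "f \<sigma> = \<zero>" if "\<sigma> \<in> K - L" for \<sigma> using that unfolding f1_def restr_def by metis
    then have "chain L (Suc i) f"
      using chain_face[OF f(1)] chain_card[OF f(1)] chain_coeffs[OF f(1)] unfolding chain_def by blast
    then show False using z(2) f(2) LK by blast
  qed
  show ?thesis
    unfolding top_line_def
  proof (intro exI[of _ f1] conjI allI impI cf1 nz)
    fix c assume c: "cyc (K - L) (Suc i) c"
    have cD: "chain (K - L) (Suc i) c" using c by (simp add: cyc_def)
    have cc: "chain K (Suc i) c" using chain_mono[OF cD] by auto
    obtain a e where a: "a \<in> carrier F" and e: "chain L (Suc i) e"
      and ce: "\<And>\<tau>. bd c \<tau> = a \<otimes> z \<tau> \<oplus> bd e \<tau>"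
      using gen[OF cyc_bd_pair[OF K L c]] by blast
    have eK: "chain K (Suc i) e" using chain_mono[OF e LK] .
    have af: "chain K (Suc i) (\<lambda>\<tau>. a \<otimes> f \<tau>)" using chain_mult[OF f(1) a] .
    have s: "chain K (Suc i) (\<lambda>\<tau>. a \<otimes> f \<tau> \<oplus> e \<tau>)" using chain_add[OF af eK] .
    define h where "h = (\<lambda>\<tau>. c \<tau> \<ominus> (a \<otimes> f \<tau> \<oplus> e \<tau>))"
    have h: "chain K (Suc i) h" unfolding h_def using chain_diff[OF cc s] .
    have "bd h \<tau> = \<zero>" if t: "\<tau> \<in> K" for \<tau>
      unfolding h_def bd_on_diff[OF chain_coeffs[OF cc] chain_coeffs[OF s] finite_V]
        bd_on_add[OF chain_coeffs[OF af] chain_coeffs[OF eK]]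
        bd_on_mult[OF chain_coeffs[OF f(1)] a finite_V] f(2)[OF t] ce
      using a chain_coeffs[OF zL] chain_coeffs[OF e] by (simp add: r_neg a_minus_def)
    then have "cyc K (Suc i) h" using h by (simp add: cyc_def)
    then have h0: "h \<tau> = \<zero>" for \<tau> using exact_top_zero[OF exK(1) top] by blast
    have "c \<sigma> = a \<otimes> f1 \<sigma>" for \<sigma>
    proof (cases "\<sigma> \<in> K - L")
      case True
      then have "e \<sigma> = \<zero>" using chain_outside[OF e] by blast
      then have "c \<sigma> \<ominus> a \<otimes> f \<sigma> = \<zero>" using h0[of \<sigma>] a chain_coeffs[OF f(1)] by (simp add: h_def)
      then have "c \<sigma> = a \<otimes> f \<sigma>"
        using a chain_coeffs[OF f(1)] chain_coeffs[OF cc] minus_equality[of "c \<sigma>" "\<ominus> (a \<otimes> f \<sigma>)"]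
        by (simp add: a_minus_def)
      then show ?thesis using True by (simp add: f1_def restr_def)
    next
      case False
      then have "f1 \<sigma> = \<zero>" by (simp only: f1_def restr_def if_False)
      then show ?thesis using a chain_outside[OF cD False] by simp
    qed
    then show "\<exists>a\<in>carrier F. \<forall>\<sigma>. c \<sigma> = a \<otimes> f1 \<sigma>" using a by blast
  qed
qed

lemma top_line_if_line:
  assumes top: "\<And>\<tau>. \<tau> \<in> K \<Longrightarrow> card \<tau> \<noteq> Suc i" and "line K i"
  shows "top_line K i"
proof -
  obtain z where z: "cyc K i z" "\<nexists>b. chain K (Suc i) b \<and> (\<forall>\<tau>\<in>K. bd b \<tau> = z \<tau>)"
    and gen: "\<And>c. cyc K i c \<Longrightarrow> \<exists>a\<in>carrier F. \<exists>b. chain K (Suc i) b \<and> (\<forall>\<tau>. c \<tau> = a \<otimes> z \<tau> \<oplus> bd b \<tau>)"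
    using assms(2) unfolding line_def by blast
  have z0: "\<exists>\<sigma>. z \<sigma> \<noteq> \<zero>"
  proof (rule ccontr)
    assume "\<nexists>\<sigma>. z \<sigma> \<noteq> \<zero>"
    then have "\<forall>\<tau>\<in>K. bd (\<lambda>\<sigma>. \<zero>) \<tau> = z \<tau>" by simp
    then show False using z(2) chain_zero by blast
  qed
  have "\<exists>a\<in>carrier F. \<forall>\<sigma>. c \<sigma> = a \<otimes> z \<sigma>" if c: "cyc K i c" for c
  proof -
    obtain a b where a: "a \<in> carrier F" and b: "chain K (Suc i) b"
      and cb: "\<And>\<tau>. c \<tau> = a \<otimes> z \<tau> \<oplus> bd b \<tau>" using gen[OF c] by blast
    have "b \<sigma> = \<zero>" for \<sigma> using chain_face[OF b] chain_card[OF b] top by blast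
    then have "bd b \<tau> = \<zero>" for \<tau> by (simp add: bd_on_eq_zeroI)
    moreover have "coeffs z" using z(1) chain_coeffs[of K i z] by (simp add: cyc_def)
    ultimately show ?thesis using a cb by (intro bexI[of _ a]) auto
  qed
  then show ?thesis unfolding top_line_def using z(1) z0 by blast
qed

section \<open>Connectedness and zero-dimensional complexes\<close>

lemma bd_on_diff_points:
  assumes "u \<in> W" "v \<in> W" "finite W" "u \<noteq> v"
  shows "bd_on W (\<lambda>\<sigma>. if \<sigma> = {u} then \<one> else if \<sigma> = {v} then \<ominus> \<one> else \<zero>) {} = \<zero>"
proof -
  have "bd_on W (\<lambda>\<sigma>. if \<sigma> = {u} then \<one> else if \<sigma> = {v} then \<ominus> \<one> else \<zero>) {} =
      (\<Oplus>x\<in>W. (if x = u then \<one> else \<zero>) \<oplus> (if x = v then \<ominus> \<one> else \<zero>))"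
    unfolding bd_on_def
    by (rule finsum_cong') (use assms(4) in \<open>auto simp: contract_def\<close>)
  also have "\<dots> = (\<Oplus>x\<in>W. if x = u then \<one> else \<zero>) \<oplus> (\<Oplus>x\<in>W. if x = v then \<ominus> \<one> else \<zero>)"
    by (rule finsum_addf) auto
  also have "(\<Oplus>x\<in>W. if x = u then \<one> else \<zero>) = \<one>"
    using add.finprod_singleton_swap[OF assms(1,3), of "\<lambda>_. \<one>"] by simp
  also have "(\<Oplus>x\<in>W. if x = v then \<ominus> \<one> else \<zero>) = \<ominus> \<one>"
    using add.finprod_singleton_swap[OF assms(2,3), of "\<lambda>_. \<ominus> \<one>"] by simp
  finally show ?thesis by (simp add: r_neg)
qed

lemma cyc_diff_points:
  assumes K: "subcomplex K" and u: "{u} \<in> K" and v: "{v} \<in> K" and "u \<noteq> v"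
  shows "cyc K 1 (\<lambda>\<sigma>. if \<sigma> = {u} then \<one> else if \<sigma> = {v} then \<ominus> \<one> else \<zero>)" (is "cyc K 1 ?c")
proof -
  have "u \<in> V" "v \<in> V" using subcomplex_subset[OF K u] subcomplex_subset[OF K v] by simp_all
  then have "bd ?c {} = \<zero>" using finite_V assms(4) by (rule bd_on_diff_points)
  moreover have "bd ?c \<tau> = \<zero>" if "\<tau> \<noteq> {}" for \<tau>
  proof (rule bd_on_eq_zeroI)
    fix x assume "x \<notin> \<tau>"
    then have "insert x \<tau> \<noteq> {w}" for w using that by (auto simp: insert_eq_iff)
    then show "?c (insert x \<tau>) = \<zero>" by simp
  qed
  ultimately have "bd ?c \<tau> = \<zero>" for \<tau> by (cases "\<tau> = {}") simp_all
  moreover have "chain K 1 ?c"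
    unfolding chain_def
  proof (intro conjI allI impI)
    show "?c \<sigma> \<in> carrier F" for \<sigma> by simp
    fix \<sigma> assume "?c \<sigma> \<noteq> \<zero>"
    then have "\<sigma> = {u} \<or> \<sigma> = {v}" by (simp split: if_splits)
    then show "\<sigma> \<in> K" "card \<sigma> = 1" using u v by auto
  qed
  ultimately show ?thesis by (simp add: cyc_def)
qed

text \<open>A chain \<open>b\<close> filling the difference of \<open>u\<close> and \<open>v\<close>
  is summed only over the component \<open>C\<close> of \<open>u\<close>. No edge leaves
  \<open>C\<close>, so on \<open>C\<close> the boundary is still that difference, with coefficient
  sum \<open>\<one>\<close>; but this sum vanishes by \<open>bd_on_bd_on\<close> with range
  \<open>C\<close>.\<close>

lemma connected_if_exact:
  assumes K: "subcomplex K" and ex: "exact K 1" and u: "{u} \<in> K" and v: "{v} \<in> K"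
  shows "(u, v) \<in> {(x, y). {x, y} \<in> K}\<^sup>*"
proof (rule ccontr)
  let ?R = "{(x, y). {x, y} \<in> K}"
  assume nc: "(u, v) \<notin> ?R\<^sup>*"
  then have uv: "u \<noteq> v" by auto
  define c where "c = (\<lambda>\<sigma>. if \<sigma> = {u} then \<one> else if \<sigma> = {v} then \<ominus> \<one> else \<zero>)"
  have "cyc K 1 c" unfolding c_def using cyc_diff_points[OF K u v uv] .
  then obtain b where b: "chain K (Suc 1) b" and bc: "\<And>\<tau>. \<tau> \<in> K \<Longrightarrow> bd b \<tau> = c \<tau>"
    using ex unfolding exact_def by blast
  have co: "coeffs b" using chain_coeffs[OF b] .
  define C where "C = {x \<in> V. {x} \<in> K \<and> (u, x) \<in> ?R\<^sup>*}"
  have C: "finite C" "C \<subseteq> V" using finite_V by (auto simp: C_def)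
  have uC: "u \<in> C" using u subcomplex_subset[OF K u] by (auto simp: C_def)
  have vC: "v \<notin> C" using nc by (auto simp: C_def)
  have step: "bd_on C b {x} = c {x}" if x: "x \<in> C" for x
  proof -
    have "bd_on C b {x} = bd b {x}"
      unfolding bd_on_def
    proof (rule add.finprod_mono_neutral_cong_left[OF finite_V C(2)])
      fix w assume w: "w \<in> V - C"
      show "contract w b {x} = \<zero>"
      proof (rule ccontr)
        assume "contract w b {x} \<noteq> \<zero>"
        then have "b {w, x} \<noteq> \<zero>" using contract_nonzero by blast
        then have "{w, x} \<in> K" by (rule chain_face[OF b])
        then have "(x, w) \<in> ?R" "{w} \<in> K" using subcomplexD[OF K, of "{w,x}" "{w}"]
          by (auto simp: insert_commute)
        then show False using w x rtrancl.rtrancl_into_rtrancl[of u x ?R w] by (auto simp: C_def)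
      qed
    qed (use co in auto)
    then show ?thesis using bc x by (simp add: C_def)
  qed
  have "\<zero> = bd_on C (bd_on C b) {}" using bd_on_bd_on[OF co _ C(1)] by simp
  also have "\<dots> = (\<Oplus>x\<in>C. if x = u then \<one> else \<zero>)"
    unfolding bd_on_def[of C "bd_on C b"]
  proof (rule finsum_cong')
    fix x assume x: "x \<in> C"
    have "contract x (bd_on C b) {} = bd_on C b {x}" using co by (simp add: contract_def)
    also have "\<dots> = (if x = u then \<one> else \<zero>)" using step[OF x] x vC by (auto simp: c_def)
    finally show "contract x (bd_on C b) {} = (if x = u then \<one> else \<zero>)" .
  qed auto
  also have "\<dots> = \<one>"
    using add.finprod_singleton_swap[OF uC C(1), of "\<lambda>_. \<one>"] by simp
  finally show False using one_not_zero by simp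
qed

lemma bd_at_empty_single:
  assumes "chain K 1 c" "\<And>w. {w} \<in> K \<Longrightarrow> w = v" "v \<in> V"
  shows "bd c {} = c {v}"
proof -
  have co: "coeffs c" using chain_coeffs[OF assms(1)] .
  have "bd c {} = (\<Oplus>x\<in>V. if x = v then c {x} else \<zero>)"
    unfolding bd_on_def
  proof (rule finsum_cong')
    fix x
    show "contract x c {} = (if x = v then c {x} else \<zero>)"
      using assms(2) chain_outside[OF assms(1), of "{x}"] co by (auto simp: contract_def)
  qed (use co in auto)
  also have "\<dots> = c {v}" using add.finprod_singleton_swap[OF assms(3) finite_V, of "\<lambda>x. c {x}"] co by simp
  finally show ?thesis .
qed

text \<open>Reduced homology in degree 0 vanishes only if the empty face bounds, which requires a
  vertex; degree 1 gives connectedness, which in the absence of edges leaves a single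
  vertex.\<close>

lemma zero_dim_acyclic_unique:
  assumes K: "subcomplex K" "{} \<in> K" and dim: "\<And>x y. {x, y} \<in> K \<Longrightarrow> x = y"
    and ex: "exact K 0" "exact K 1"
  shows "\<exists>!v. {v} \<in> K"
proof (rule ex_ex1I)
  define c :: "'a set \<Rightarrow> 'f" where "c = (\<lambda>\<sigma>. if \<sigma> = {} then \<one> else \<zero>)"
  have "chain K 0 c" using K(2) by (auto simp: chain_def c_def)
  moreover have "bd c \<tau> = \<zero>" for \<tau> by (rule bd_on_eq_zeroI) (auto simp: c_def)
  ultimately have "cyc K 0 c" by (simp add: cyc_def)
  then obtain b where b: "chain K (Suc 0) b" "\<And>\<tau>. \<tau> \<in> K \<Longrightarrow> bd b \<tau> = c \<tau>"
    using ex(1) unfolding exact_def by blast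
  have "bd b {} \<noteq> \<zero>" using b(2)[OF K(2)] by (simp add: c_def)
  then obtain v where "b {v} \<noteq> \<zero>" using bd_on_nonzero by blast
  then show "\<exists>v. {v} \<in> K" using chain_face[OF b(1)] by blast
next
  fix u v assume "{u} \<in> K" "{v} \<in> K"
  then have "(u, v) \<in> {(x, y). {x, y} \<in> K}\<^sup>*" by (rule connected_if_exact[OF K(1) ex(2)])
  then show "u = v" by induction (use dim in auto)
qed

text \<open>With one vertex, the boundary of a degree 1 chain at the empty face is its only
  coefficient, so every cycle is zero.\<close>

lemma zero_dim_line_not_unique:
  assumes K: "subcomplex K" and L: "line K 1"
  shows "\<not> (\<exists>!v. {v} \<in> K)"
proof
  assume "\<exists>!v. {v} \<in> K"
  then obtain v where v: "{v} \<in> K" "\<And>w. {w} \<in> K \<Longrightarrow> w = v" by blast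
  obtain z where z: "cyc K 1 z" "\<nexists>b. chain K (Suc 1) b \<and> (\<forall>\<tau>\<in>K. bd b \<tau> = z \<tau>)"
    using L unfolding line_def by blast
  have zc: "chain K 1 z" using z(1) by (simp add: cyc_def)
  have "{} \<in> K" using subcomplexD[OF K v(1)] by blast
  then have "bd z {} = \<zero>" using z(1) by (simp add: cyc_def)
  then have "z {v} = \<zero>" using bd_at_empty_single[OF zc v(2)] subcomplex_subset[OF K v(1)] by simp
  have "z \<tau> = \<zero>" for \<tau>
  proof (rule ccontr)
    assume n: "z \<tau> \<noteq> \<zero>"
    then have "\<tau> \<in> K" "card \<tau> = 1" using chain_face[OF zc] chain_card[OF zc] by blast+
    then obtain w where "\<tau> = {w}" by (auto simp: card_1_singleton_iff)
    then show False using n \<open>\<tau> \<in> K\<close> v(2) \<open>z {v} = \<zero>\<close> by blast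
  qed
  then have "\<forall>\<tau>\<in>K. bd (\<lambda>\<sigma>. \<zero>) \<tau> = z \<tau>" by simp
  then show False using z(2) chain_zero by blast
qed

lemma line_has_face:
  assumes "line K i"
  shows "\<exists>\<tau>\<in>K. card \<tau> = i"
proof (rule ccontr)
  assume "\<not> (\<exists>\<tau>\<in>K. card \<tau> = i)"
  then have "exact K i" by (intro exact_no_faces) auto
  then show False using assms unfolding exact_def line_def by blast
qed

end

subsection \<open>Relative homology manifolds: homology balls modulo their boundary\<close>

lemma card_le_complex_dim:
  assumes "simplicial_complex K" "\<sigma> \<in> K"
  shows "int (card \<sigma>) \<le> complex_dim K + 1"
proof -
  have "face_dim \<sigma> \<le> complex_dim K"
    unfolding complex_dim_def using assms by (intro Max_ge) (auto simp: simplicial_complex_def)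
  then show ?thesis by (simp add: face_dim_def)
qed

locale homology_ball = field F for F :: "'f ring" (structure) +
  fixes B :: "'a::linorder set set" and n :: int
  assumes ball: "F_homology_ball F n B"
begin

definition M :: "'a set set" where
  "M = ball_boundary F B"

definition top_card :: nat where
  "top_card = nat (n + 1)"

lemma B_simplicial: "simplicial_complex B" and B_dim: "complex_dim B = n"
  and M_sphere: "F_homology_sphere F (n - 1) M"
  using ball by (auto simp: F_homology_ball_def complex_of_dim_def M_def)

lemma M_simplicial: "simplicial_complex M" and M_dim: "complex_dim M = n - 1"
  using M_sphere by (auto simp: F_homology_sphere_def complex_of_dim_def)

sublocale face_chains F "vertices B"
  using B_simplicial by unfold_locales (auto simp: vertices_def simplicial_complex_def)

lemma empty_in: "{} \<in> B" "{} \<in> M"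
  using B_simplicial M_simplicial by (auto simp: simplicial_complex_def)

lemma M_subset: "M \<subseteq> B"
  by (auto simp: M_def ball_boundary_def)

lemma subcomplex_B: "subcomplex B" and subcomplex_M: "subcomplex M"
  using subcomplex_if_simplicial[OF B_simplicial] subcomplex_if_simplicial[OF M_simplicial] M_subset
  by (auto simp: vertices_def)

lemma top_card: "int top_card = n + 1"
  using card_le_complex_dim[OF B_simplicial empty_in(1)] B_dim by (simp add: top_card_def)

lemma card_le_top: "\<sigma> \<in> B \<Longrightarrow> card \<sigma> \<le> top_card"
  using card_le_complex_dim[OF B_simplicial, of \<sigma>] B_dim top_card by simp

lemma card_less_top: "\<sigma> \<in> M \<Longrightarrow> card \<sigma> < top_card"
  using card_le_complex_dim[OF M_simplicial, of \<sigma>] M_dim top_card by simp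

lemma link_boundary_acyclic: "\<sigma> \<in> M \<Longrightarrow> acyclic_complex F (link \<sigma> B)"
  by (simp add: M_def ball_boundary_def)

text \<open>The empty face belongs to \<open>M\<close>, so an interior face is nonempty, and of the
  two alternatives for its link only the sphere is left.\<close>

lemma link_interior_sphere:
  assumes "\<sigma> \<in> B" "\<sigma> \<notin> M"
  shows "has_homology_of_sphere F (n - int (card \<sigma>)) (link \<sigma> B)"
proof -
  have "\<sigma> \<noteq> {}" using assms empty_in by blast
  moreover have "\<not> acyclic_complex F (link \<sigma> B)"
    using assms by (simp add: M_def ball_boundary_def)
  ultimately show ?thesis using ball assms(1) by (auto simp: F_homology_ball_def face_dim_def)
qed

lemma link_M_sphere:
  assumes "\<sigma> \<in> M"
  shows "has_homology_of_sphere F (n - 1 - int (card \<sigma>)) (link \<sigma> M)"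
proof -
  have "has_homology_of_sphere F (n - 1 - face_dim \<sigma> - 1) (link \<sigma> M)"
    using M_sphere assms by (simp add: F_homology_sphere_def)
  moreover have "n - 1 - face_dim \<sigma> - 1 = n - 1 - int (card \<sigma>)" by (simp add: face_dim_def)
  ultimately show ?thesis by simp
qed

text \<open>The link of \<sigma> in \<open>B\<close> modulo \<open>M\<close>, without the vertices
  of \<open>A\<close>. For empty \<open>A\<close> it is the ordinary link if \<sigma> is interior,
  and the pair of links in \<open>B\<close> and \<open>M\<close> if \<sigma> lies on the boundary;
  both have the homology of a sphere.\<close>

definition rel :: "'a set \<Rightarrow> 'a set \<Rightarrow> 'a set set" where
  "rel \<sigma> A = {\<tau>. \<tau> \<inter> (\<sigma> \<union> A) = {} \<and> \<tau> \<union> \<sigma> \<in> B - M}"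

lemma family_rel: "family (rel \<sigma> A)"
  unfolding family_def
proof (intro conjI ballI allI impI)
  show "rel \<sigma> A \<subseteq> Pow (vertices B)" by (auto simp: rel_def vertices_def)
  fix \<rho> \<pi> \<tau> assume r: "\<rho> \<in> rel \<sigma> A" and p: "\<pi> \<in> rel \<sigma> A" and t: "\<rho> \<subseteq> \<tau> \<and> \<tau> \<subseteq> \<pi>"
  have "\<rho> \<union> \<sigma> \<subseteq> \<tau> \<union> \<sigma>" "\<tau> \<union> \<sigma> \<subseteq> \<pi> \<union> \<sigma>" using t by auto
  moreover have "\<rho> \<union> \<sigma> \<in> B - M" "\<pi> \<union> \<sigma> \<in> B - M" using r p by (auto simp: rel_def)
  ultimately have "\<tau> \<union> \<sigma> \<in> B - M"
    using family_convex[OF family_pair[OF subcomplex_B subcomplex_M]] by blast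
  then show "\<tau> \<in> rel \<sigma> A" using t p unfolding rel_def by blast
qed

text \<open>Deletion and link of a vertex stay within these families: the vertex passes into
  \<open>A\<close> or, by \<open>lk_rel\<close>, into \<sigma>. This makes the inductions on deleted
  vertices possible.\<close>

lemma del_rel: "del (rel \<sigma> A) v = rel \<sigma> (insert v A)"
  unfolding del_def rel_def by auto

lemma lk_rel: "v \<notin> \<sigma> \<Longrightarrow> v \<notin> A \<Longrightarrow> lk (rel \<sigma> A) v = rel (insert v \<sigma>) A"
  unfolding lk_def rel_def by auto

lemma rel_empty:
  assumes "\<sigma> \<in> B"
  shows "rel \<sigma> {} = link \<sigma> B - link \<sigma> M"
proof -
  have "\<tau> \<in> rel \<sigma> {} \<longleftrightarrow> \<tau> \<in> link \<sigma> B - link \<sigma> M" for \<tau>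
    using subcomplexD[OF subcomplex_B, of "\<sigma> \<union> \<tau>" \<tau>] subcomplexD[OF subcomplex_M, of "\<sigma> \<union> \<tau>" \<tau>]
    unfolding rel_def link_def by (auto simp: Un_commute Int_commute)
  then show ?thesis by blast
qed

lemma rel_empty_interior:
  assumes "\<sigma> \<in> B" "\<sigma> \<notin> M"
  shows "rel \<sigma> {} = link \<sigma> B"
proof -
  have "link \<sigma> M = {}" using assms(2) subcomplexD[OF subcomplex_M] by (auto simp: link_def)
  then show ?thesis using rel_empty[OF assms(1)] by simp
qed

lemma card_link:
  assumes "\<tau> \<in> link \<sigma> B"
  shows "card \<tau> + card \<sigma> \<le> top_card"
proof -
  have u: "\<sigma> \<union> \<tau> \<in> B" "\<sigma> \<inter> \<tau> = {}" using assms by (auto simp: link_def)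
  then have "finite \<sigma>" "finite \<tau>" using subcomplex_finite[OF subcomplex_B u(1)] by auto
  then show ?thesis using card_le_top[OF u(1)] u(2) card_Un_disjoint[of \<sigma> \<tau>] by simp
qed

lemma card_rel: "\<tau> \<in> rel \<sigma> {} \<Longrightarrow> \<sigma> \<in> B \<Longrightarrow> card \<tau> + card \<sigma> \<le> top_card"
  using card_link by (simp add: rel_empty)

text \<open>The link of a boundary face is acyclic in \<open>B\<close> and a homology sphere of one
  dimension less in \<open>M\<close>, so the pair has its only homology in the degree that an
  interior face of the same size would give.\<close>

lemma exact_rel:
  assumes s: "\<sigma> \<in> B" and i: "i + card \<sigma> \<noteq> top_card"
  shows "exact (rel \<sigma> {}) i"
proof (cases "\<sigma> \<in> M")
  case True
  show ?thesis
  proof (cases i)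
    case 0
    \<comment> \<open>Degree 0 is too low for the sequence of the pair, but it has no chains either:
      the empty set is excluded because \<sigma> lies in \<open>M\<close>.\<close>
    have "{} \<notin> rel \<sigma> {}" using True by (simp add: rel_def)
    then have "card \<tau> \<noteq> i" if "\<tau> \<in> rel \<sigma> {}" for \<tau>
      using 0 that family_finite[OF family_rel] card_0_eq by metis
    then show ?thesis by (rule exact_no_faces)
  next
    case (Suc j)
    have "exact (link \<sigma> M) j"
      using i Suc top_card
      by (intro exact_if_sphere[OF subcomplex_link[OF subcomplex_M] link_M_sphere[OF True]]) auto
    moreover have "exact (link \<sigma> B) (Suc j)"
      using exact_if_acyclic[OF subcomplex_link[OF subcomplex_B] link_boundary_acyclic[OF True]] .
    moreover have "link \<sigma> M \<subseteq> link \<sigma> B" using M_subset by (auto simp: link_def)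
    ultimately show ?thesis
      unfolding rel_empty[OF s] Suc
      using exact_pair[OF subcomplex_link[OF subcomplex_B] subcomplex_link[OF subcomplex_M]] by blast
  qed
next
  case False
  show ?thesis
    unfolding rel_empty_interior[OF s False]
    using i top_card
    by (intro exact_if_sphere[OF subcomplex_link[OF subcomplex_B] link_interior_sphere[OF s False]]) auto
qed

lemma top_line_rel:
  assumes s: "\<sigma> \<in> B" and i: "i + card \<sigma> = top_card"
  shows "top_line (rel \<sigma> {}) i"
proof (cases "\<sigma> \<in> M")
  case True
  obtain j where j: "i = Suc j" using i card_less_top[OF True] by (cases i) auto
  have ex: "exact (link \<sigma> B) m" for m
    using exact_if_acyclic[OF subcomplex_link[OF subcomplex_B] link_boundary_acyclic[OF True]] .
  have L: "line (link \<sigma> M) j"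
    using i j top_card
    by (intro line_if_sphere[OF subcomplex_link[OF subcomplex_M] link_M_sphere[OF True]]) auto
  have LB: "link \<sigma> M \<subseteq> link \<sigma> B" using M_subset by (auto simp: link_def)
  have top: "card \<tau> \<noteq> Suc (Suc j)" if "\<tau> \<in> link \<sigma> B" for \<tau>
    using card_link[OF that] i j by simp
  show ?thesis
    unfolding rel_empty[OF s] j
    by (rule top_line_pair[OF subcomplex_link[OF subcomplex_B] subcomplex_link[OF subcomplex_M]
          LB top ex ex L])
next
  case False
  have L: "line (link \<sigma> B) i"
    using i top_card
    by (intro line_if_sphere[OF subcomplex_link[OF subcomplex_B] link_interior_sphere[OF s False]]) auto
  have "card \<tau> \<noteq> Suc i" if "\<tau> \<in> link \<sigma> B" for \<tau>
    using card_link[OF that] i by simp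
  then show ?thesis unfolding rel_empty_interior[OF s False] using L by (rule top_line_if_line)
qed

text \<open>The link is acyclic or has the homology of a sphere of positive dimension: the bound on
  \<open>card \<sigma>\<close> rules out two points.\<close>

lemma exact_link_1:
  assumes s: "\<sigma> \<in> B" and c: "card \<sigma> + 2 \<le> top_card \<or> \<sigma> \<in> M"
  shows "exact (link \<sigma> B) 1"
proof (cases "\<sigma> \<in> M")
  case True
  then show ?thesis
    using exact_if_acyclic[OF subcomplex_link[OF subcomplex_B] link_boundary_acyclic] by blast
next
  case False
  then show ?thesis
    using c top_card
    by (intro exact_if_sphere[OF subcomplex_link[OF subcomplex_B] link_interior_sphere[OF s False]]) auto
qed

lemma vertex_in_link: "v \<notin> \<sigma> \<Longrightarrow> insert v \<sigma> \<in> B \<Longrightarrow> {v} \<in> link \<sigma> B"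
  using subcomplexD[OF subcomplex_B, of "insert v \<sigma>" "{v}"] by (auto simp: link_def)

text \<open>A top cycle modulo the boundary has full support: restricted to the link of a vertex it is
  zero or has full support, by induction, and the vertices are joined by edge paths.\<close>

lemma top_cycle_full_support:
  assumes "\<sigma> \<in> B" "i + card \<sigma> = top_card" "cyc (rel \<sigma> {}) i z" "z \<tau>0 \<noteq> \<zero>"
    "v \<notin> \<sigma>" "insert v \<sigma> \<in> B"
  shows "\<exists>\<tau>. contract v z \<tau> \<noteq> \<zero>"
  using assms
proof (induction i arbitrary: \<sigma> z \<tau>0 v)
  case 0
  have "finite \<sigma>" using subcomplex_finite[OF subcomplex_B 0(1)] .
  then show ?case using 0 card_le_top[OF 0(6)] by simp
next
  case (Suc i)
  note s = Suc.prems(1) and card = Suc.prems(2) and z = Suc.prems(3)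
  have fs: "finite \<sigma>" using subcomplex_finite[OF subcomplex_B s] .
  have zc: "chain (rel \<sigma> {}) (Suc i) z" using z by (simp add: cyc_def)
  have co: "coeffs z" using chain_coeffs[OF zc] .
  have t0: "\<tau>0 \<in> rel \<sigma> {}" "card \<tau>0 = Suc i"
    using chain_face[OF zc Suc.prems(4)] chain_card[OF zc Suc.prems(4)] .
  then obtain w where w: "w \<in> \<tau>0" by fastforce
  have vL: "{v} \<in> link \<sigma> B" using vertex_in_link Suc.prems(5,6) .
  have "\<tau>0 \<in> link \<sigma> B" using t0(1) rel_empty[OF s] by blast
  then have wL: "{w} \<in> link \<sigma> B"
    using subcomplexD[OF subcomplex_link[OF subcomplex_B]] w by blast
  have wz: "contract w z (\<tau>0 - {w}) \<noteq> \<zero>"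
    using contract_eq_zero[OF co] w Suc.prems(4) by (simp add: insert_absorb)
  let ?R = "{(x, y). {x, y} \<in> link \<sigma> B}"
  show ?case
  proof (cases i)
    case 0
    obtain w' where "\<tau>0 = {w'}" using t0(2) 0 by (auto simp: card_1_singleton_iff)
    then have t0w: "\<tau>0 = {w}" using w by simp
    show ?thesis
    proof (cases "v = w")
      case True then show ?thesis using wz by blast
    next
      case vw: False
      have noedge: "x = y" if "{x, y} \<in> link \<sigma> B" for x y
      proof (rule ccontr)
        assume "x \<noteq> y"
        then have "card {x, y} = 2" by simp
        then show False using card_link[OF that] card 0 by simp
      qed
      \<comment> \<open>The link has no edges here. For a boundary face it would be acyclic, hence
        connected, and \<open>v\<close> and \<open>w\<close> would coincide.\<close>
      have nM: "\<sigma> \<notin> M"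
      proof
        assume "\<sigma> \<in> M"
        then have "exact (link \<sigma> B) 1" using exact_link_1[OF s] by blast
        then have "(w, v) \<in> ?R\<^sup>*"
          using connected_if_exact[OF subcomplex_link[OF subcomplex_B] _ wL vL] by blast
        then have "w = v" by induction (use noedge in auto)
        then show False using vw by blast
      qed
      \<comment> \<open>The difference of \<open>w\<close> and \<open>v\<close> is a cycle with a
        coefficient at \<open>v\<close>. Both it and \<open>z\<close> are multiples of one
        generator, so \<open>z\<close> does not vanish at \<open>v\<close>.\<close>
      define c where "c = (\<lambda>\<sigma>. if \<sigma> = {w} then \<one> else if \<sigma> = {v} then \<ominus> \<one> else \<zero>)"
      have "cyc (link \<sigma> B) 1 c"
        unfolding c_def
        by (rule cyc_diff_points[OF subcomplex_link[OF subcomplex_B] wL vL]) (use vw in auto)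
      then have c: "cyc (rel \<sigma> {}) (Suc i) c" using rel_empty_interior[OF s nM] 0 by simp
      obtain y where y: "cyc (rel \<sigma> {}) (Suc i) y"
        and gen: "\<And>c. cyc (rel \<sigma> {}) (Suc i) c \<Longrightarrow> \<exists>a\<in>carrier F. \<forall>\<sigma>. c \<sigma> = a \<otimes> y \<sigma>"
        using top_line_rel[OF s card] unfolding top_line_def by blast
      have yco: "coeffs y" using y chain_coeffs[of "rel \<sigma> {}" "Suc i" y] by (simp add: cyc_def)
      obtain a where a: "a \<in> carrier F" "\<And>\<sigma>. c \<sigma> = a \<otimes> y \<sigma>" using gen[OF c] by blast
      obtain b where b: "b \<in> carrier F" "\<And>\<sigma>. z \<sigma> = b \<otimes> y \<sigma>" using gen[OF z] by blast
      have "c {v} \<noteq> \<zero>" using vw by (simp add: c_def)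
      then have "y {v} \<noteq> \<zero>" using a by auto
      moreover have "b \<noteq> \<zero>" using b Suc.prems(4) yco by auto
      ultimately have "z {v} \<noteq> \<zero>" using b yco by (simp add: integral_iff)
      then have "contract v z {} \<noteq> \<zero>" using contract_eq_zero[OF co] by simp
      then show ?thesis by blast
    qed
  next
    case (Suc j)
    have "exact (link \<sigma> B) 1" using exact_link_1[OF s] card Suc by simp
    then have "(w, v) \<in> ?R\<^sup>*"
      using connected_if_exact[OF subcomplex_link[OF subcomplex_B] _ wL vL] by blast
    then show ?thesis
    proof induction
      case base show ?case using wz by blast
    next
      case (step x y)
      obtain \<tau> where t: "contract x z \<tau> \<noteq> \<zero>" using step.IH by blast
      show ?case
      proof (cases "x = y")
        case True then show ?thesis using t by blast
      next
        case False
        have xy: "x \<notin> \<sigma>" "y \<notin> \<sigma>" "insert x (insert y \<sigma>) \<in> B"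
          using step.hyps(2) by (auto simp: link_def)
        have xs: "insert x \<sigma> \<in> B" using subcomplexD[OF subcomplex_B xy(3)] by blast
        have cx: "cyc (rel (insert x \<sigma>) {}) i (contract x z)"
          using cyc_contract[OF family_rel z, of x] lk_rel[OF xy(1), of "{}"] by simp
        \<comment> \<open>Induction in the link of \<open>x\<close> gives a nonzero coefficient on a
          face through \<open>x\<close> and \<open>y\<close>; the same coefficient, seen from
          \<open>y\<close>, shows that the contraction at \<open>y\<close> is nonzero.\<close>
        have "\<exists>\<tau>. contract y (contract x z) \<tau> \<noteq> \<zero>"
          by (rule Suc.IH[OF xs _ cx t]) (use card xy fs False in \<open>auto simp: insert_commute\<close>)
        then obtain \<rho> where "contract y (contract x z) \<rho> \<noteq> \<zero>" by blast
        then have r: "y \<notin> \<rho>" "contract x z (insert y \<rho>) \<noteq> \<zero>" using contract_nonzero by blast+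
        then have r2: "x \<notin> insert y \<rho>" "z (insert x (insert y \<rho>)) \<noteq> \<zero>" using contract_nonzero by blast+
        have "contract y z (insert x \<rho>) \<noteq> \<zero>"
          using contract_eq_zero[OF co, of y "insert x \<rho>"] r r2 by (auto simp: insert_commute)
        then show ?thesis by blast
      qed
    qed
  qed
qed

text \<open>The complement of the vertices of a face in a sphere is acyclic, an instance of
  Alexander duality. For the first vertex this rests on the full support of the top cycle; for a
  further vertex \<open>v\<close>, the family with \<open>A\<close> deleted and its link at
  \<open>v\<close> are already exact.\<close>

lemma exact_rel_face:
  assumes "finite A" "A \<noteq> {}" "\<sigma> \<inter> A = {}" "\<sigma> \<union> A \<in> B"
  shows "exact (rel \<sigma> A) i"
  using assms
proof (induction A arbitrary: \<sigma> i rule: finite_ne_induct)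
  case (singleton v \<sigma> i)
  have v: "v \<notin> \<sigma>" "insert v \<sigma> \<in> B" using singleton by auto
  have s: "\<sigma> \<in> B" using subcomplexD[OF subcomplex_B v(2)] by blast
  have fs: "finite \<sigma>" using subcomplex_finite[OF subcomplex_B s] .
  have lkv: "lk (rel \<sigma> {}) v = rel (insert v \<sigma>) {}" using lk_rel[OF v(1), of "{}"] by simp
  have cv: "card (insert v \<sigma>) = Suc (card \<sigma>)" using v fs by simp
  have "exact (del (rel \<sigma> {}) v) i"
  proof (cases "i + card \<sigma> = top_card")
    case True
    \<comment> \<open>In the top degree, a cycle avoiding \<open>v\<close> contradicts full support
      unless it is zero.\<close>
    show ?thesis
      unfolding exact_def
    proof (intro allI impI)
      fix c assume c: "cyc (del (rel \<sigma> {}) v) i c"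
      have cD: "chain (del (rel \<sigma> {}) v) i c" using c by (simp add: cyc_def)
      have cc: "chain (rel \<sigma> {}) i c" using chain_mono[OF cD] by (auto simp: del_def)
      have out: "c \<tau> = \<zero>" if "v \<in> \<tau>" for \<tau>
        using that chain_outside[OF cD, of \<tau>] by (simp add: del_def)
      have "bd c \<tau> = \<zero>" if t: "\<tau> \<in> rel \<sigma> {}" for \<tau>
      proof (cases "v \<in> \<tau>")
        case True
        then show ?thesis by (intro bd_on_eq_zeroI out) simp
      next
        case False then show ?thesis using c t by (simp add: cyc_def del_def)
      qed
      then have cy: "cyc (rel \<sigma> {}) i c" using cc by (simp add: cyc_def)
      have "c \<tau> = \<zero>" for \<tau>
      proof (rule ccontr)
        assume "c \<tau> \<noteq> \<zero>"
        then obtain \<rho> where "contract v c \<rho> \<noteq> \<zero>"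
          using top_cycle_full_support[OF s True cy _ v] by blast
        then have "c (insert v \<rho>) \<noteq> \<zero>" using contract_nonzero by blast
        then show False using out by blast
      qed
      then have "\<forall>\<tau>\<in>del (rel \<sigma> {}) v. bd (\<lambda>\<sigma>. \<zero>) \<tau> = c \<tau>" by simp
      then show "\<exists>b. chain (del (rel \<sigma> {}) v) (Suc i) b \<and> (\<forall>\<tau>\<in>del (rel \<sigma> {}) v. bd b \<tau> = c \<tau>)"
        using chain_zero by blast
    qed
  next
    case False
    show ?thesis
    proof (rule exact_del[OF family_rel exact_rel[OF s False]])
      fix w assume w: "cyc (lk (rel \<sigma> {}) v) i w"
      have wco: "coeffs w" using w chain_coeffs[of "lk (rel \<sigma> {}) v" i w] by (simp add: cyc_def)
      show "\<exists>z e. cyc (rel \<sigma> {}) (Suc i) z \<and> chain (lk (rel \<sigma> {}) v) (Suc i) e \<and>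
          (\<forall>\<tau>\<in>lk (rel \<sigma> {}) v. w \<tau> = contract v z \<tau> \<oplus> bd e \<tau>)"
      proof (cases "i + card (insert v \<sigma>) = top_card")
        case f: False
        obtain e where e: "chain (lk (rel \<sigma> {}) v) (Suc i) e"
            "\<And>\<tau>. \<tau> \<in> lk (rel \<sigma> {}) v \<Longrightarrow> bd e \<tau> = w \<tau>"
          using exact_rel[OF v(2) f] w unfolding exact_def lkv by blast
        have "\<forall>\<tau>\<in>lk (rel \<sigma> {}) v. w \<tau> = contract v (\<lambda>\<sigma>. \<zero>) \<tau> \<oplus> bd e \<tau>"
          using e(2) wco by (simp add: contract_def)
        then show ?thesis using e(1) cyc_zero by blast
      next
        case True
        then have "Suc i + card \<sigma> = top_card" using cv by simp
        then obtain z \<tau>0 where z: "cyc (rel \<sigma> {}) (Suc i) z" "z \<tau>0 \<noteq> \<zero>"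
          using top_line_rel[OF s] unfolding top_line_def by blast
        have zc: "chain (rel \<sigma> {}) (Suc i) z" using z(1) by (simp add: cyc_def)
        have zco: "coeffs z" using chain_coeffs[OF zc] .
        obtain \<rho> where r: "contract v z \<rho> \<noteq> \<zero>"
          using top_cycle_full_support[OF s _ z v] True cv by auto
        have cy: "cyc (rel (insert v \<sigma>) {}) i (contract v z)"
          using cyc_contract[OF family_rel z(1), of v] lkv by simp
        obtain g where g: "cyc (rel (insert v \<sigma>) {}) i g"
          and gen: "\<And>c. cyc (rel (insert v \<sigma>) {}) i c \<Longrightarrow> \<exists>a\<in>carrier F. \<forall>\<sigma>. c \<sigma> = a \<otimes> g \<sigma>"
          using top_line_rel[OF v(2) True] unfolding top_line_def by blast
        have gco: "coeffs g" using g chain_coeffs[of "rel (insert v \<sigma>) {}" i g] by (simp add: cyc_def)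
        obtain b where b: "b \<in> carrier F" "\<And>\<sigma>. contract v z \<sigma> = b \<otimes> g \<sigma>" using gen[OF cy] by blast
        obtain a where a: "a \<in> carrier F" "\<And>\<sigma>. w \<sigma> = a \<otimes> g \<sigma>" using gen w lkv by metis
        have b0: "b \<noteq> \<zero>" using r b(2) gco by auto
        then have ib: "inv b \<in> carrier F" "inv b \<otimes> b = \<one>" using b(1) field_Units by auto
        \<comment> \<open>Full support makes the contraction of \<open>z\<close> a nonzero multiple
          of the generator \<open>g\<close>, so a rescaled \<open>z\<close> restricts to the given
          \<open>w\<close>. This is the surjectivity that \<open>exact_del\<close> asks for.\<close>
        define q where "q = a \<otimes> inv b"
        have q: "q \<in> carrier F" unfolding q_def using a ib by simp
        have wq: "w \<tau> = q \<otimes> contract v z \<tau>" for \<tau>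
        proof -
          have "q \<otimes> contract v z \<tau> = a \<otimes> (inv b \<otimes> b) \<otimes> g \<tau>"
            unfolding q_def b(2) using a(1) b(1) ib(1) gco by (simp add: m_assoc)
          then show ?thesis using ib(2) a by simp
        qed
        have "cyc (rel \<sigma> {}) (Suc i) (\<lambda>\<tau>. q \<otimes> z \<tau>)"
          using z(1) q chain_mult[OF zc q] bd_on_mult[OF zco q finite_V] by (simp add: cyc_def)
        moreover have "\<forall>\<tau>\<in>lk (rel \<sigma> {}) v. w \<tau> = contract v (\<lambda>\<tau>. q \<otimes> z \<tau>) \<tau> \<oplus> bd (\<lambda>\<sigma>. \<zero>) \<tau>"
          using wq q zco by (simp add: contract_mult)
        ultimately show ?thesis using chain_zero by blast
      qed
    qed
  qed
  then show ?case by (simp add: del_rel)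
next
  case (insert v A \<sigma> i)
  have v: "v \<notin> \<sigma>" "v \<notin> A" using insert.hyps insert.prems by auto
  have "\<sigma> \<union> A \<in> B" using subcomplexD[OF subcomplex_B insert.prems(2)] by blast
  then have 1: "exact (rel \<sigma> A) i" using insert.IH insert.prems by blast
  have 2: "exact (lk (rel \<sigma> A) v) i"
    unfolding lk_rel[OF v] using insert.IH[of "insert v \<sigma>" i] insert.prems v by auto
  have "exact (del (rel \<sigma> A) v) i"
  proof (rule exact_del[OF family_rel 1])
    fix w assume w: "cyc (lk (rel \<sigma> A) v) i w"
    have wco: "coeffs w" using w chain_coeffs[of "lk (rel \<sigma> A) v" i w] by (simp add: cyc_def)
    obtain e where e: "chain (lk (rel \<sigma> A) v) (Suc i) e"
        "\<And>\<tau>. \<tau> \<in> lk (rel \<sigma> A) v \<Longrightarrow> bd e \<tau> = w \<tau>"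
      using 2 w unfolding exact_def by blast
    have "\<forall>\<tau>\<in>lk (rel \<sigma> A) v. w \<tau> = contract v (\<lambda>\<sigma>. \<zero>) \<tau> \<oplus> bd e \<tau>"
      using e(2) wco by (simp add: contract_def)
    then show "\<exists>z e. cyc (rel \<sigma> A) (Suc i) z \<and> chain (lk (rel \<sigma> A) v) (Suc i) e \<and>
        (\<forall>\<tau>\<in>lk (rel \<sigma> A) v. w \<tau> = contract v z \<tau> \<oplus> bd e \<tau>)"
      using e(1) cyc_zero by blast
  qed
  then show ?case by (simp add: del_rel)
qed

text \<open>Moving the vertices of a missing face \<open>\<alpha>\<close> one by one from the deleted set to the link
  transports the vanishing of the relative homology of the complement of \<open>\<alpha>\<close>, where there are no
  chains at all, to the link of a facet of the boundary of \<open>\<alpha>\<close>, which carries a top cycle.\<close>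

lemma no_large_missing_face:
  assumes fin: "finite \<alpha>" and ne: "\<alpha> \<noteq> {}" and "\<alpha> \<notin> B"
    and proper: "\<And>\<beta>. \<beta> \<subset> \<alpha> \<Longrightarrow> \<beta> \<in> B"
    and skel: "\<And>\<tau>. \<tau> \<in> B \<Longrightarrow> card \<tau> + card \<alpha> = Suc top_card \<Longrightarrow> \<tau> \<in> M"
  shows False
proof -
  obtain v where v: "v \<in> \<alpha>" using ne by blast
  define \<sigma> where "\<sigma> = \<alpha> - {v}"
  have s: "\<sigma> \<in> B" unfolding \<sigma>_def using v by (intro proper) blast
  have cs: "Suc (card \<sigma>) = card \<alpha>" unfolding \<sigma>_def using fin v by (metis card.remove)
  \<comment> \<open>This is the degree in which the link of \<sigma> carries its top cycle, and also
    the number of vertices of the faces that \<open>skel\<close> places in \<open>M\<close>.\<close>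
  obtain i where i: "i + card \<sigma> = top_card" using card_le_top[OF s] le_add_diff_inverse2 by blast
  have ia: "i + card \<alpha> = Suc top_card" using i cs by simp
  have "exact (rel \<rho> (\<alpha> - \<rho>)) i" if "finite \<rho>" "\<rho> \<subset> \<alpha>" for \<rho>
    using that
  proof (induction \<rho> rule: finite_induct)
    case empty
    have "card \<tau> \<noteq> i" if "\<tau> \<in> rel {} \<alpha>" for \<tau>
      using that skel[of \<tau>] ia by (auto simp: rel_def)
    then show ?case by (simp add: exact_no_faces)
  next
    case (insert x \<rho>)
    define A where "A = \<alpha> - insert x \<rho>"
    have A: "finite A" "A \<noteq> {}" "x \<notin> A" "insert x A = \<alpha> - \<rho>"
      using fin insert by (auto simp: A_def)
    \<comment> \<open>The vertex \<open>x\<close> is missing from this union, which is therefore a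
      proper subset of \<alpha> and a face of \<open>B\<close>, as \<open>exact_rel_face\<close>
      requires.\<close>
    have "\<rho> \<union> A \<subset> \<alpha>" using insert by (auto simp: A_def)
    then have "exact (rel \<rho> A) (Suc i)"
      using A insert.prems by (intro exact_rel_face proper) (auto simp: A_def)
    moreover have "exact (del (rel \<rho> A) x) i"
      unfolding del_rel A(4) using insert by blast
    ultimately have "exact (lk (rel \<rho> A) x) i" by (rule exact_lk[OF family_rel])
    then show ?case using lk_rel[OF insert.hyps(2) A(3)] by (simp add: A_def)
  qed
  then have "exact (rel \<sigma> (\<alpha> - \<sigma>)) i" using fin v by (auto simp: \<sigma>_def)
  \<comment> \<open>Deleting the last vertex changes nothing: together with \<sigma> it forms
    \<alpha>, which is not a face.\<close>
  moreover have "rel \<sigma> (\<alpha> - \<sigma>) = rel \<sigma> {}"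
  proof -
    have e: "\<alpha> - \<sigma> = {v}" using v by (auto simp: \<sigma>_def)
    have "v \<notin> \<tau>" if "\<tau> \<union> \<sigma> \<in> B" for \<tau>
    proof
      assume "v \<in> \<tau>"
      then have "\<alpha> \<subseteq> \<tau> \<union> \<sigma>" by (auto simp: \<sigma>_def)
      then show False using subcomplexD[OF subcomplex_B that] assms(3) by blast
    qed
    then show ?thesis unfolding e by (auto simp: rel_def)
  qed
  ultimately have ex: "exact (rel \<sigma> {}) i" by simp
  have top: "card \<tau> \<noteq> Suc i" if "\<tau> \<in> rel \<sigma> {}" for \<tau>
    using card_rel[OF that s] i by simp
  obtain z \<tau> where z: "cyc (rel \<sigma> {}) i z" "z \<tau> \<noteq> \<zero>"
    using top_line_rel[OF s i] unfolding top_line_def by blast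
  show False using exact_top_zero[OF ex top z(1)] z(2) by blast
qed

text \<open>Faces of \<open>B\<close> with at most \<open>n - k\<close> vertices lie in
  \<open>M\<close>, which gives one inclusion. For the other, a minimal nonface inside a member of
  the completion would have more than \<open>j\<close> vertices, hence at least
  \<open>k + 2\<close>, and \<open>no_large_missing_face\<close> excludes it.\<close>

lemma stacked_ball_eq_completion:
  assumes st: "skel (n - 1 - int k) B = skel (n - 1 - int k) M"
    and j: "k + 1 \<le> j" "int j \<le> n - int k"
  shows "B = completion j M"
proof -
  have sk: "\<sigma> \<in> M" if "\<sigma> \<in> B" "int (card \<sigma>) \<le> n - int k" for \<sigma>
  proof -
    have "\<sigma> \<in> skel (n - 1 - int k) B" using that by (simp add: skel_def face_dim_def)
    then show ?thesis unfolding st by (simp add: skel_def)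
  qed
  show ?thesis
  proof (intro equalityI subsetI)
    fix \<alpha> assume a: "\<alpha> \<in> B"
    have "x \<in> vertices M" if "x \<in> \<alpha>" for x
    proof -
      have "{x} \<in> B" using subcomplexD[OF subcomplex_B a] that by blast
      then have "{x} \<in> M" using j by (intro sk) auto
      then show ?thesis by (auto simp: vertices_def)
    qed
    moreover have "\<beta> \<in> M" if "\<beta> \<subseteq> \<alpha>" "card \<beta> \<le> j" for \<beta>
      using subcomplexD[OF subcomplex_B a that(1)] that(2) j(2) by (intro sk) auto
    ultimately show "\<alpha> \<in> completion j M" unfolding completion_def by blast
  next
    fix \<alpha> assume a: "\<alpha> \<in> completion j M"
    have "\<alpha> \<subseteq> vertices M" using a unfolding completion_def by blast
    also have "\<dots> \<subseteq> vertices B" using M_subset by (auto simp: vertices_def)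
    finally have fa: "finite \<alpha>" using finite_V by (rule finite_subset)
    have "\<gamma> \<in> B" if "\<gamma> \<subseteq> \<alpha>" for \<gamma>
    proof -
      have "finite \<gamma>" using that fa by (rule finite_subset)
      then show ?thesis using that
      proof (induction \<gamma> rule: finite_psubset_induct)
        case (psubset \<gamma>)
        show ?case
        proof (rule ccontr)
          assume n: "\<gamma> \<notin> B"
          have small: "\<not> card \<gamma> \<le> j"
          proof
            assume "card \<gamma> \<le> j"
            then have "\<gamma> \<in> M" using a psubset.prems unfolding completion_def by blast
            then show False using n M_subset by blast
          qed
          show False
          proof (rule no_large_missing_face[OF psubset.hyps _ n])
            show "\<gamma> \<noteq> {}" using n empty_in by blast
            show "\<beta> \<in> B" if "\<beta> \<subset> \<gamma>" for \<beta> using psubset.IH[OF that] that psubset.prems by blast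
            \<comment> \<open>Such a face has \<open>n + 2 - card \<gamma>\<close> vertices, which
              is at most \<open>n - k\<close> because
              \<open>card \<gamma> \<ge> k + 2\<close>.\<close>
            show "\<tau> \<in> M" if "\<tau> \<in> B" "card \<tau> + card \<gamma> = Suc top_card" for \<tau>
              using that(2) small j(1) top_card by (intro sk that(1)) linarith
          qed
        qed
      qed
    qed
    then show "\<alpha> \<in> B" by blast
  qed
qed

end

subsection \<open>Vertex links of complexes, spheres and balls\<close>

lemma mem_link_vertex:
  assumes "simplicial_complex K"
  shows "\<tau> \<in> link {v} K \<longleftrightarrow> v \<notin> \<tau> \<and> insert v \<tau> \<in> K"
  unfolding link_def using simplicial_complex_subset[OF assms, of "insert v \<tau>" \<tau>] by auto

lemma simplicial_link:
  assumes K: "simplicial_complex K" and v: "v \<in> vertices K"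
  shows "simplicial_complex (link {v} K)"
proof (rule simplicial_complexI)
  have s: "link {v} K \<subseteq> K" by (auto simp: link_def)
  show "finite (link {v} K)" using s simplicial_complexD(1)[OF K] by (rule finite_subset)
  show "{} \<in> link {v} K" using v by (simp add: mem_link_vertex[OF K] vertices_iff[OF K])
  show "finite \<sigma>" if "\<sigma> \<in> link {v} K" for \<sigma> using that s simplicial_complexD(3)[OF K] by blast
  show "\<tau> \<in> link {v} K" if "\<sigma> \<in> link {v} K" "\<tau> \<subseteq> \<sigma>" for \<sigma> \<tau>
    using that simplicial_complex_subset[OF K, of "insert v \<sigma>" "insert v \<tau>"]
    unfolding mem_link_vertex[OF K] by blast
qed

lemma link_link_vertex:
  assumes K: "simplicial_complex K" and s: "\<sigma> \<in> link {v} K"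
  shows "link \<sigma> (link {v} K) = link (insert v \<sigma>) K"
proof -
  have v: "v \<notin> \<sigma>" using s by (simp add: mem_link_vertex[OF K])
  have "\<tau> \<in> link \<sigma> (link {v} K) \<longleftrightarrow> \<tau> \<in> link (insert v \<sigma>) K" for \<tau>
    using v simplicial_complex_subset[OF K, of "insert v (\<sigma> \<union> \<tau>)" "insert v \<tau>"]
      simplicial_complex_subset[OF K, of "insert v \<tau>" \<tau>]
    unfolding link_def[of \<sigma>] link_def[of "insert v \<sigma>"] mem_Collect_eq mem_link_vertex[OF K]
    by auto
  then show ?thesis by blast
qed

lemma link_empty: "link {} K = K"
  by (auto simp: link_def)

lemma simplicial_complex_eqI:
  assumes K: "simplicial_complex K" and L: "simplicial_complex L"
    and V: "vertices K = vertices L"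
    and links: "\<And>v. v \<in> vertices K \<Longrightarrow> link {v} K = link {v} L"
  shows "K = L"
proof -
  have "\<sigma> \<in> K \<longleftrightarrow> \<sigma> \<in> L" for \<sigma>
  proof (cases "\<sigma> = {}")
    case True then show ?thesis using simplicial_complexD(2) K L by auto
  next
    case False
    then obtain v where v: "v \<in> \<sigma>" by blast
    define \<rho> where "\<rho> = \<sigma> - {v}"
    have e: "\<sigma> = insert v \<rho>" "v \<notin> \<rho>" using v by (auto simp: \<rho>_def)
    show ?thesis
    proof (cases "v \<in> vertices K")
      case True
      have "\<rho> \<in> link {v} K \<longleftrightarrow> \<rho> \<in> link {v} L" using links[OF True] by simp
      then show ?thesis using e(2) unfolding mem_link_vertex[OF K] mem_link_vertex[OF L] e(1) by simp
    next
      case False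
      then have "\<sigma> \<notin> K" "\<sigma> \<notin> L" using v V unfolding vertices_def by blast+
      then show ?thesis by simp
    qed
  qed
  then show ?thesis by blast
qed

section \<open>Purity, links and connectedness of homology spheres\<close>

lemma sphere_face_chains:
  assumes "field F" "F_homology_sphere F d S"
  shows "face_chains F (vertices S)" "face_chains.subcomplex (vertices S) S"
proof -
  have S: "simplicial_complex S" using assms(2) by (simp add: F_homology_sphere_def complex_of_dim_def)
  interpret field F by fact
  show "face_chains F (vertices S)"
    using finite_vertices[OF S] by unfold_locales
  then interpret face_chains F "vertices S" .
  show "subcomplex S" using subcomplex_if_simplicial[OF S] by simp
qed

text \<open>The homology of the link of \<sigma> is nonzero in its top degree, so the link contains
  a face large enough to complete \<sigma> to one of full dimension.\<close>

lemma homology_sphere_pure: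
  assumes F: "field F" and S: "F_homology_sphere F d S" and s: "\<sigma> \<in> S"
  shows "\<exists>\<rho>\<in>S. \<sigma> \<subseteq> \<rho> \<and> int (card \<rho>) = d + 1"
proof -
  interpret face_chains F "vertices S" using sphere_face_chains[OF F S] by blast
  have dim: "complex_of_dim d S" using S by (simp add: F_homology_sphere_def)
  have le: "int (card \<sigma>) \<le> d + 1" using dim s by (simp add: complex_of_dim_iff)
  define j where "j = nat (d + 1 - int (card \<sigma>))"
  have hs: "has_homology_of_sphere F (d - face_dim \<sigma> - 1) (link \<sigma> S)"
    using S s by (simp add: F_homology_sphere_def)
  have "line (link \<sigma> S) j"
    using le j_def
    by (intro line_if_sphere[OF subcomplex_link[OF sphere_face_chains(2)[OF F S]] hs])
      (auto simp: face_dim_def)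
  then obtain \<tau> where t: "\<tau> \<in> link \<sigma> S" "card \<tau> = j" using line_has_face by blast
  have u: "\<sigma> \<union> \<tau> \<in> S" "\<sigma> \<inter> \<tau> = {}" using t(1) by (auto simp: link_def)
  have "simplicial_complex S" using dim by (simp add: complex_of_dim_def)
  then have "finite (\<sigma> \<union> \<tau>)" using u(1) by (rule simplicial_complexD(3))
  then have "card (\<sigma> \<union> \<tau>) = card \<sigma> + j" using t(2) u(2) by (simp add: card_Un_disjoint)
  then have "int (card (\<sigma> \<union> \<tau>)) = d + 1" using le by (simp add: j_def)
  then show ?thesis using u(1) by blast
qed

text \<open>The homology condition passes on because links of links are links; purity provides a
  face of full dimension through \<open>v\<close>, and with it the dimension of the link.\<close>

lemma homology_sphere_link:
  assumes F: "field F" and S: "F_homology_sphere F d S" and v: "v \<in> vertices S"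
  shows "F_homology_sphere F (d - 1) (link {v} S)"
proof -
  have dim: "complex_of_dim d S" using S by (simp add: F_homology_sphere_def)
  then have sc: "simplicial_complex S" by (simp add: complex_of_dim_def)
  have vS: "{v} \<in> S" using v vertices_iff[OF sc] by blast
  have dimle: "int (card \<sigma>) \<le> d + 1" if "\<sigma> \<in> S" for \<sigma>
    using dim that unfolding complex_of_dim_iff by blast
  have card: "int (card (insert v \<sigma>)) = int (card \<sigma>) + 1" if "\<sigma> \<in> link {v} S" for \<sigma>
    using that simplicial_complexD(3)[OF simplicial_link[OF sc v] that]
    by (simp add: mem_link_vertex[OF sc])
  obtain \<rho> where r: "\<rho> \<in> S" "{v} \<subseteq> \<rho>" "int (card \<rho>) = d + 1"
    using homology_sphere_pure[OF F S vS] by blast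
  have vr: "insert v (\<rho> - {v}) = \<rho>" using r(2) by blast
  have rl: "\<rho> - {v} \<in> link {v} S" unfolding mem_link_vertex[OF sc] vr using r(1) by simp
  have "complex_of_dim (d - 1) (link {v} S)"
    unfolding complex_of_dim_iff
  proof (intro conjI ballI bexI)
    show "simplicial_complex (link {v} S)" by (rule simplicial_link[OF sc v])
    show "int (card \<sigma>) \<le> d - 1 + 1" if "\<sigma> \<in> link {v} S" for \<sigma>
      using card[OF that] dimle[of "insert v \<sigma>"] that by (simp add: mem_link_vertex[OF sc])
    show "int (card (\<rho> - {v})) = d - 1 + 1" using card[OF rl] r(3) unfolding vr by linarith
  qed (rule rl)
  moreover have "has_homology_of_sphere F (d - 1 - face_dim \<sigma> - 1) (link \<sigma> (link {v} S))"
    if s: "\<sigma> \<in> link {v} S" for \<sigma>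
  proof -
    have "insert v \<sigma> \<in> S" using s by (simp add: mem_link_vertex[OF sc])
    then have "has_homology_of_sphere F (d - face_dim (insert v \<sigma>) - 1) (link (insert v \<sigma>) S)"
      using S by (simp add: F_homology_sphere_def)
    moreover have "d - face_dim (insert v \<sigma>) - 1 = d - 1 - face_dim \<sigma> - 1"
      using card[OF s] by (simp add: face_dim_def)
    ultimately show ?thesis by (simp only: link_link_vertex[OF sc s])
  qed
  ultimately show ?thesis by (simp add: F_homology_sphere_def)
qed

lemma homology_sphere_connected:
  fixes S :: "'a::linorder set set"
  assumes F: "field F" and S: "F_homology_sphere F d S" and d: "d \<ge> 1"
  shows "connected_complex S"
proof -
  interpret face_chains F "vertices S" using sphere_face_chains[OF F S] by blast
  have sc: "simplicial_complex S" using S by (simp add: F_homology_sphere_def complex_of_dim_def)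
  have "has_homology_of_sphere F (d - face_dim ({} :: 'a set) - 1) (link {} S)"
    using S simplicial_complexD(2)[OF sc] by (simp only: F_homology_sphere_def)
  then have "has_homology_of_sphere F d S" by (simp add: face_dim_def link_empty)
  then have "exact S 1"
    using d sphere_face_chains(2)[OF F S] by (intro exact_if_sphere) auto
  then show ?thesis
    unfolding connected_complex_def
    using connected_if_exact[OF sphere_face_chains(2)[OF F S]] vertices_iff[OF sc] by blast
qed

context homology_ball
begin

text \<open>The link of a face of codimension 1 consists of points only: exactly one if it is
  acyclic, and a number other than one if it has the homology of two points. This translates
  acyclicity of links into a count of facets.\<close>

lemma ridge_vertex:
  assumes r: "\<rho> \<in> B" "int (card \<rho>) = n"
  shows "\<exists>u. {u} \<in> link \<rho> B" "(\<exists>!u. {u} \<in> link \<rho> B) \<longleftrightarrow> \<rho> \<in> ball_boundary F B"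
proof -
  note K = subcomplex_link[OF subcomplex_B, of \<rho>]
  have e: "{} \<in> link \<rho> B" using r empty_in by (simp add: link_def)
  have noedge: "x = y" if "{x, y} \<in> link \<rho> B" for x y
  proof (rule ccontr)
    assume "x \<noteq> y"
    then have "card {x, y} = 2" by simp
    then show False using card_link[OF that] r(2) top_card by simp
  qed
  have 1: "\<exists>!u. {u} \<in> link \<rho> B" if "\<rho> \<in> M"
  proof -
    have "exact (link \<rho> B) i" for i using exact_if_acyclic[OF K link_boundary_acyclic[OF that]] .
    then show ?thesis using zero_dim_acyclic_unique[OF K e noedge] by blast
  qed
  have L: "line (link \<rho> B) 1" if "\<rho> \<notin> M"
    using r(2) by (intro line_if_sphere[OF K link_interior_sphere[OF r(1) that]]) simp
  have 2: "\<exists>u. {u} \<in> link \<rho> B" if nM: "\<rho> \<notin> M"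
  proof -
    obtain \<tau> where "\<tau> \<in> link \<rho> B" "card \<tau> = 1" using line_has_face[OF L[OF nM]] by blast
    then show ?thesis by (auto simp: card_1_singleton_iff)
  qed
  show "\<exists>u. {u} \<in> link \<rho> B" using 1 2 by blast
  show "(\<exists>!u. {u} \<in> link \<rho> B) \<longleftrightarrow> \<rho> \<in> ball_boundary F B"
    unfolding M_def[symmetric] using 1 zero_dim_line_not_unique[OF K L] by blast
qed

lemma ball_boundary_link:
  assumes v: "v \<in> vertices B"
  shows "ball_boundary F (link {v} B) = link {v} (ball_boundary F B)"
proof -
  have "\<sigma> \<in> ball_boundary F (link {v} B) \<longleftrightarrow> \<sigma> \<in> link {v} M" for \<sigma>
  proof (cases "\<sigma> \<in> link {v} B")
    case True
    then show ?thesis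
      by (simp add: ball_boundary_def link_link_vertex[OF B_simplicial True]
          mem_link_vertex[OF M_simplicial] mem_link_vertex[OF B_simplicial])
        (simp add: M_def ball_boundary_def)
  next
    case False
    then have "\<sigma> \<notin> link {v} M" using M_subset by (auto simp: link_def)
    then show ?thesis using False by (simp add: ball_boundary_def)
  qed
  then show ?thesis by (auto simp: M_def)
qed

text \<open>The vertex is taken on the boundary, where its link is acyclic. A facet through it
  arises by extending a boundary face of codimension 1, which gives the link its full
  dimension.\<close>

lemma homology_ball_link:
  assumes v: "v \<in> vertices (ball_boundary F B)"
  shows "F_homology_ball F (n - 1) (link {v} B)"
proof -
  have F: "field F" by (rule field_axioms)
  have vM: "{v} \<in> M" using v vertices_iff[OF M_simplicial] by (simp add: M_def)
  then have vB: "v \<in> vertices B" using M_subset by (auto simp: vertices_def)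
  have card: "int (card (insert v \<sigma>)) = int (card \<sigma>) + 1" if "\<sigma> \<in> link {v} B" for \<sigma>
    using that simplicial_complexD(3)[OF simplicial_link[OF B_simplicial vB] that]
    by (simp add: mem_link_vertex[OF B_simplicial])
  obtain \<rho> where r: "\<rho> \<in> M" "{v} \<subseteq> \<rho>" "int (card \<rho>) = n"
    using homology_sphere_pure[OF F M_sphere vM] by auto
  have rB: "\<rho> \<in> B" using r(1) M_subset by blast
  obtain u where u: "{u} \<in> link \<rho> B" using ridge_vertex(1)[OF rB r(3)] by blast
  have u': "u \<notin> \<rho>" "insert u \<rho> \<in> B" using u by (auto simp: link_def)
  have cu: "int (card (insert u \<rho>)) = n + 1"
    using u' r(3) simplicial_complexD(3)[OF B_simplicial rB] by simp
  have vu: "insert v (insert u \<rho> - {v}) = insert u \<rho>" using r(2) by blast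
  have ul: "insert u \<rho> - {v} \<in> link {v} B"
    unfolding mem_link_vertex[OF B_simplicial] vu using u' by simp
  have "complex_of_dim (n - 1) (link {v} B)"
    unfolding complex_of_dim_iff
  proof (intro conjI ballI bexI)
    show "simplicial_complex (link {v} B)" by (rule simplicial_link[OF B_simplicial vB])
    show "int (card \<sigma>) \<le> n - 1 + 1" if "\<sigma> \<in> link {v} B" for \<sigma>
      using card[OF that] that card_le_top[of "insert v \<sigma>"] top_card
      by (auto simp: mem_link_vertex[OF B_simplicial])
    show "int (card (insert u \<rho> - {v})) = n - 1 + 1" using card[OF ul] cu unfolding vu by linarith
  qed (rule ul)
  moreover have "acyclic_complex F (link {v} B)" using link_boundary_acyclic[OF vM] .
  moreover have "has_homology_of_sphere F (n - 1 - face_dim \<sigma> - 1) (link \<sigma> (link {v} B)) \<or>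
      acyclic_complex F (link \<sigma> (link {v} B))" if s: "\<sigma> \<in> link {v} B" for \<sigma>
  proof -
    have "insert v \<sigma> \<in> B" using s by (simp add: mem_link_vertex[OF B_simplicial])
    then have "has_homology_of_sphere F (n - face_dim (insert v \<sigma>) - 1) (link (insert v \<sigma>) B) \<or>
        acyclic_complex F (link (insert v \<sigma>) B)"
      using ball by (simp add: F_homology_ball_def)
    moreover have "n - face_dim (insert v \<sigma>) - 1 = n - 1 - face_dim \<sigma> - 1"
      using card[OF s] by (simp add: face_dim_def)
    ultimately show ?thesis by (simp only: link_link_vertex[OF B_simplicial s])
  qed
  moreover have "F_homology_sphere F (n - 1 - 1) (ball_boundary F (link {v} B))"
    unfolding ball_boundary_link[OF vB]
    using homology_sphere_link[OF F M_sphere] v by (simp add: M_def)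
  ultimately show ?thesis unfolding F_homology_ball_def by blast
qed

end

section \<open>Stacked balls and their vertex links\<close>

lemma homology_ballI: "field F \<Longrightarrow> F_stacked_ball F k n B \<Longrightarrow> homology_ball F B n"
  by (simp add: homology_ball_def homology_ball_axioms_def F_stacked_ball_def)

lemma stacked_ball_low_faces:
  assumes "F_stacked_ball F k n B" "\<sigma> \<in> B" "int (card \<sigma>) \<le> n - int k"
  shows "\<sigma> \<in> ball_boundary F B"
proof -
  have "\<sigma> \<in> skel (n - 1 - int k) B" using assms(2,3) by (simp add: skel_def face_dim_def)
  also have "\<dots> = skel (n - 1 - int k) (ball_boundary F B)"
    using assms(1) by (simp add: F_stacked_ball_def)
  finally show ?thesis by (simp add: skel_def)
qed

lemma stacked_ball_completion:
  assumes "field F" "F_stacked_ball F k n B" "k + 1 \<le> j" "int j \<le> n - int k"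
  shows "B = completion j (ball_boundary F B)"
proof -
  interpret homology_ball F B n using assms homology_ballI by blast
  show ?thesis
    using stacked_ball_eq_completion[OF _ assms(3,4)] assms(2)
    by (simp add: M_def F_stacked_ball_def)
qed

text \<open>By \<open>int k \<le> n - 1\<close>, single vertices are small enough to lie on the
  boundary, so every vertex link is a ball. Adding \<open>v\<close> to a face raises its size by
  one, which matches the drop in dimension.\<close>

lemma stacked_ball_link:
  assumes F: "field F" and B: "F_stacked_ball F k n B" and k: "int k \<le> n - 1"
    and v: "v \<in> vertices B"
  shows "F_stacked_ball F k (n - 1) (link {v} B)"
    "ball_boundary F (link {v} B) = link {v} (ball_boundary F B)"
proof -
  interpret homology_ball F B n using F B homology_ballI by blast
  have "{v} \<in> B" using v vertices_iff[OF B_simplicial] by blast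
  then have vM: "{v} \<in> M"
    unfolding M_def using k by (intro stacked_ball_low_faces[OF B]) auto
  then have v': "v \<in> vertices (ball_boundary F B)" by (auto simp: vertices_def M_def)
  show eq: "ball_boundary F (link {v} B) = link {v} (ball_boundary F B)"
    using ball_boundary_link[OF v] .
  have "\<sigma> \<in> skel (n - 1 - 1 - int k) (link {v} B) \<longleftrightarrow>
      \<sigma> \<in> skel (n - 1 - 1 - int k) (link {v} M)" for \<sigma>
  proof -
    have "\<sigma> \<in> link {v} M" if s: "\<sigma> \<in> link {v} B" "face_dim \<sigma> \<le> n - 1 - 1 - int k"
    proof -
      have vs: "v \<notin> \<sigma>" "insert v \<sigma> \<in> B" using s by (auto simp: mem_link_vertex[OF B_simplicial])
      then have "int (card (insert v \<sigma>)) \<le> n - int k"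
        using s(2) simplicial_complexD(3)[OF B_simplicial vs(2)] by (simp add: face_dim_def)
      then have "insert v \<sigma> \<in> M" using stacked_ball_low_faces[OF B vs(2)] by (simp add: M_def)
      then show ?thesis using vs by (simp add: mem_link_vertex[OF M_simplicial])
    qed
    moreover have "link {v} M \<subseteq> link {v} B" using M_subset by (auto simp: link_def)
    ultimately show ?thesis by (auto simp: skel_def)
  qed
  then have "skel (n - 1 - 1 - int k) (link {v} B) =
      skel (n - 1 - 1 - int k) (ball_boundary F (link {v} B))"
    unfolding eq M_def[symmetric] by blast
  then show "F_stacked_ball F k (n - 1) (link {v} B)"
    using homology_ball_link[OF v'] k by (simp add: F_stacked_ball_def)
qed

subsection \<open>Completions and boundaries\<close>

lemma completionI:
  assumes "\<alpha> \<subseteq> vertices M" "\<And>\<beta>. \<beta> \<subseteq> \<alpha> \<Longrightarrow> card \<beta> \<le> m \<Longrightarrow> \<beta> \<in> M"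
  shows "\<alpha> \<in> completion m M"
  unfolding completion_def using assms by blast

lemma completionD:
  assumes "\<alpha> \<in> completion m M"
  shows "\<alpha> \<subseteq> vertices M" "\<beta> \<subseteq> \<alpha> \<Longrightarrow> card \<beta> \<le> m \<Longrightarrow> \<beta> \<in> M"
  using assms unfolding completion_def by blast+

lemma subset_completion:
  assumes "simplicial_complex M"
  shows "M \<subseteq> completion m M"
proof
  fix \<alpha> assume a: "\<alpha> \<in> M"
  show "\<alpha> \<in> completion m M"
    using a simplicial_complex_subset[OF assms a] by (intro completionI) (auto simp: vertices_def)
qed

lemma simplicial_completion:
  assumes M: "simplicial_complex M"
  shows "simplicial_complex (completion m M)"
proof (rule simplicial_complexI)
  have s: "completion m M \<subseteq> Pow (vertices M)" using completionD(1) by blast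
  then show "finite (completion m M)"
    using finite_vertices[OF M] by (meson finite_Pow_iff finite_subset)
  show "{} \<in> completion m M" using subset_completion[OF M] simplicial_complexD(2)[OF M] by blast
  show "finite \<sigma>" if "\<sigma> \<in> completion m M" for \<sigma>
    using completionD(1)[OF that] finite_vertices[OF M] by (rule finite_subset)
  show "\<tau> \<in> completion m M" if s: "\<sigma> \<in> completion m M" and t: "\<tau> \<subseteq> \<sigma>" for \<sigma> \<tau>
  proof (rule completionI)
    show "\<tau> \<subseteq> vertices M" using completionD(1)[OF s] t by blast
    show "\<beta> \<in> M" if "\<beta> \<subseteq> \<tau>" "card \<beta> \<le> m" for \<beta>
      using completionD(2)[OF s _ that(2)] that(1) t by blast
  qed
qed

lemma vertices_completion:
  assumes "simplicial_complex M"
  shows "vertices (completion m M) = vertices M"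
proof
  show "vertices (completion m M) \<subseteq> vertices M"
    unfolding vertices_def[of "completion m M"] using completionD(1) by blast
  show "vertices M \<subseteq> vertices (completion m M)"
    using subset_completion[OF assms] unfolding vertices_def by blast
qed

text \<open>Both \<open>k + 1\<close> and \<open>k + 2\<close> lie in the range of sizes that determine the stacked ball \<open>D\<close>.\<close>

lemma link_completion:
  assumes M: "simplicial_complex M" and v: "v \<in> vertices M" and F: "field F"
    and D: "F_stacked_ball F k (int d) D" and b: "ball_boundary F D = link {v} M"
    and d: "d \<ge> 2 * k + 2"
  shows "link {v} (completion (k + 2) M) = D"
proof -
  let ?L = "link {v} M"
  note N = simplicial_completion[OF M, of "k + 2"]
  have D1: "D = completion (k + 1) ?L" and D2: "D = completion (k + 2) ?L"
    by (rule stacked_ball_completion[OF F D, unfolded b]; use d in simp)+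
  have LM: "?L \<subseteq> M" by (auto simp: link_def)
  show ?thesis
  proof (intro equalityI subsetI)
    fix \<tau> assume "\<tau> \<in> link {v} (completion (k + 2) M)"
    then have t: "v \<notin> \<tau>" "insert v \<tau> \<in> completion (k + 2) M"
      unfolding mem_link_vertex[OF N] by blast+
    have L: "\<beta> \<in> ?L" if "\<beta> \<subseteq> \<tau>" "card \<beta> \<le> k + 1" for \<beta>
    proof -
      \<comment> \<open>Membership of \<beta> in the link concerns a face with one vertex more, so
        size \<open>k + 2\<close> for \<open>M\<close> becomes size \<open>k + 1\<close> for the
        link.\<close>
      have "card (insert v \<beta>) \<le> k + 2" using that(2) card_insert_le_m1[of "k + 2" \<beta> v] by simp
      then have "insert v \<beta> \<in> M" using completionD(2)[OF t(2), of "insert v \<beta>"] that(1) by blast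
      then show ?thesis using that(1) t(1) by (auto simp: mem_link_vertex[OF M])
    qed
    have "\<tau> \<in> completion (k + 1) ?L"
    proof (rule completionI)
      show "\<tau> \<subseteq> vertices ?L"
      proof
        fix x assume "x \<in> \<tau>"
        then have "{x} \<in> ?L" by (intro L) auto
        then show "x \<in> vertices ?L" by (auto simp: vertices_def)
      qed
    qed (rule L)
    then show "\<tau> \<in> D" using D1 by simp
  next
    fix \<tau> assume t: "\<tau> \<in> D"
    then have t1: "\<tau> \<in> completion (k + 1) ?L" and t2: "\<tau> \<in> completion (k + 2) ?L"
      using D1 D2 by auto
    have vL: "vertices ?L \<subseteq> vertices M - {v}" by (auto simp: vertices_def link_def)
    have vt: "v \<notin> \<tau>" "insert v \<tau> \<subseteq> vertices M" using completionD(1)[OF t1] vL v by auto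
    have "insert v \<tau> \<in> completion (k + 2) M"
    proof (rule completionI[OF vt(2)])
      fix \<beta> assume be: "\<beta> \<subseteq> insert v \<tau>" "card \<beta> \<le> k + 2"
      \<comment> \<open>A subset through \<open>v\<close> loses it in the link and is governed by
        size \<open>k + 1\<close>; a subset avoiding \<open>v\<close> may have \<open>k + 2\<close>
        vertices, which requires the description of \<open>D\<close> by the larger size.\<close>
      show "\<beta> \<in> M"
      proof (cases "v \<in> \<beta>")
        case True
        have "finite \<beta>" using be(1) vt(2) finite_vertices[OF M] by (meson finite_subset)
        then have "card (\<beta> - {v}) \<le> k + 1" using True be(2) by simp
        then have "\<beta> - {v} \<in> ?L" using completionD(2)[OF t1] be(1) by blast
        then show ?thesis using True by (simp add: mem_link_vertex[OF M] insert_absorb)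
      next
        case False
        then have "\<beta> \<in> ?L" using completionD(2)[OF t2] be by blast
        then show ?thesis using LM by blast
      qed
    qed
    then show "\<tau> \<in> link {v} (completion (k + 2) M)" unfolding mem_link_vertex[OF N] using vt(1) by blast
  qed
qed

section \<open>The two classes and the links of their members\<close>

lemma connected_complex_edges:
  assumes K: "connected_complex K" and V: "vertices L = vertices K"
    and E: "\<And>x y. {x, y} \<in> K \<Longrightarrow> {x, y} \<in> L"
  shows "connected_complex L"
proof -
  have "{(x, y). {x, y} \<in> K}\<^sup>* \<subseteq> {(x, y). {x, y} \<in> L}\<^sup>*" using E by (intro rtrancl_mono) blast
  then show ?thesis using K V unfolding connected_complex_def by blast
qed

lemma K_classD:
  assumes "M \<in> K_class T k d"
  shows "simplicial_complex M" "complex_of_dim d M" "connected_complex M"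
    "v \<in> vertices M \<Longrightarrow> stacked_sphere T k (d - 1) (link {v} M)"
  using assms by (auto simp: K_class_def complex_of_dim_def)

lemma Kbar_classD:
  assumes "N \<in> Kbar_class T k d"
  shows "simplicial_complex N" "complex_of_dim d N" "connected_complex N"
    "v \<in> vertices N \<Longrightarrow> stacked_ball T k (d - 1) (link {v} N)"
  using assms by (auto simp: Kbar_class_def complex_of_dim_def)

text \<open>The ball bounded by the link of \<open>v\<close> comes with a field that depends on
  \<open>v\<close>. Identifying it with the link of a complex defined without a field makes this
  dependence harmless.\<close>

lemma K_class_link_ball:
  fixes T :: "'f itself"
  assumes M: "M \<in> K_class T k (int d)" and v: "v \<in> vertices M" and d: "d \<ge> 2 * k + 2"
  obtains F :: "'f ring" where "field F" "F_stacked_ball F k (int d) (link {v} (completion (k + 2) M))"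
    "ball_boundary F (link {v} (completion (k + 2) M)) = link {v} M"
proof -
  obtain D where "stacked_ball_with_boundary T k (int d - 1 + 1) D (link {v} M)"
    using K_classD(4)[OF M v] by (auto simp: stacked_sphere_def)
  then obtain F :: "'f ring" where F: "field F" "F_stacked_ball F k (int d) D" "ball_boundary F D = link {v} M"
    by (auto simp: stacked_ball_with_boundary_def)
  have "link {v} (completion (k + 2) M) = D"
    by (rule link_completion[OF K_classD(1)[OF M] v F d])
  then show thesis using that F by blast
qed

lemma stacked_ball_dim: "F_stacked_ball F k n D \<Longrightarrow> complex_of_dim n D"
  by (simp add: F_stacked_ball_def F_homology_ball_def)

lemma complex_of_dim_card_le: "complex_of_dim d K \<Longrightarrow> \<sigma> \<in> K \<Longrightarrow> int (card \<sigma>) \<le> d + 1"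
  unfolding complex_of_dim_iff by blast

lemma complex_of_dim_ex: "complex_of_dim d K \<Longrightarrow> \<exists>\<sigma>\<in>K. int (card \<sigma>) = d + 1"
  unfolding complex_of_dim_iff by blast

lemma complex_of_dim_vertex:
  assumes "complex_of_dim (int d) K"
  shows "\<exists>v. v \<in> vertices K"
proof -
  obtain \<sigma> where "\<sigma> \<in> K" "int (card \<sigma>) = int d + 1" using complex_of_dim_ex[OF assms] by blast
  moreover then have "\<sigma> \<noteq> {}" by auto
  ultimately show ?thesis by (auto simp: vertices_def)
qed

lemma complex_of_dim_links:
  assumes K: "simplicial_complex K" and ne: "v \<in> vertices K" and d: "d \<ge> 0"
    and links: "\<And>v. v \<in> vertices K \<Longrightarrow> complex_of_dim (d - 1) (link {v} K)"
  shows "complex_of_dim d K"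
proof -
  have card: "int (card (insert v \<sigma>)) = int (card \<sigma>) + 1" if "\<sigma> \<in> link {v} K" for \<sigma> v
  proof -
    have s: "v \<notin> \<sigma>" "insert v \<sigma> \<in> K" using that by (simp_all add: mem_link_vertex[OF K])
    show ?thesis using s(1) simplicial_complexD(3)[OF K s(2)] by simp
  qed
  have "int (card \<sigma>) \<le> d + 1" if s: "\<sigma> \<in> K" for \<sigma>
  proof (cases "\<sigma> = {}")
    case True then show ?thesis using d by simp
  next
    case False
    then obtain x where x: "x \<in> \<sigma>" by blast
    then have xV: "x \<in> vertices K" using s by (auto simp: vertices_def)
    have e: "insert x (\<sigma> - {x}) = \<sigma>" using x by blast
    have l: "\<sigma> - {x} \<in> link {x} K" unfolding mem_link_vertex[OF K] e using s by simp
    show ?thesis using card[OF l] complex_of_dim_card_le[OF links[OF xV] l] unfolding e by linarith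
  qed
  moreover obtain \<sigma> where s: "\<sigma> \<in> link {v} K" "int (card \<sigma>) = d - 1 + 1"
    using complex_of_dim_ex[OF links[OF ne]] by blast
  then have "insert v \<sigma> \<in> K" "int (card (insert v \<sigma>)) = d + 1"
    using card[OF s(1)] by (simp_all add: mem_link_vertex[OF K])
  ultimately show ?thesis unfolding complex_of_dim_iff using K by blast
qed

lemma completion_in_Kbar:
  fixes T :: "'f itself"
  assumes M: "M \<in> K_class T k (int d)" and d: "d \<ge> 2 * k + 2"
  shows "completion (k + 2) M \<in> Kbar_class T k (int d + 1)"
proof -
  let ?N = "completion (k + 2) M"
  note sM = K_classD(1)[OF M]
  have V: "vertices ?N = vertices M" by (rule vertices_completion[OF sM])
  have N: "simplicial_complex ?N" by (rule simplicial_completion[OF sM])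
  have ball: "stacked_ball T k (int d + 1 - 1) (link {v} ?N) \<and>
      complex_of_dim (int d + 1 - 1) (link {v} ?N)" if v: "v \<in> vertices ?N" for v
  proof -
    have "v \<in> vertices M" using v V by simp
    from M this d obtain F :: "'f ring" where "field F" "F_stacked_ball F k (int d) (link {v} ?N)"
      by (rule K_class_link_ball)
    then show ?thesis using stacked_ball_dim by (auto simp: stacked_ball_def)
  qed
  obtain v where "v \<in> vertices ?N" using complex_of_dim_vertex[OF K_classD(2)[OF M]] V by auto
  then have "complex_of_dim (int d + 1) ?N" using ball by (intro complex_of_dim_links[OF N]) auto
  moreover have "connected_complex ?N"
    using subset_completion[OF sM]
    by (intro connected_complex_edges[OF K_classD(3)[OF M] V]) blast
  ultimately show ?thesis using ball by (simp add: Kbar_class_def)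
qed

text \<open>The facets over \<rho> correspond to the vertices of its link, and this link equals that
  of \<open>\<rho> - {v}\<close> inside the vertex link, where \<open>ridge_vertex\<close>
  applies.\<close>

lemma card_facets_containing_ridge:
  assumes N: "complex_of_dim (int d + 1) N" and r: "\<rho> \<in> N" "card \<rho> = d + 1"
    and v: "v \<in> \<rho>" and F: "field F" and D: "F_homology_ball F (int d) (link {v} N)"
  shows "card {\<sigma> \<in> facets N. \<rho> \<subseteq> \<sigma>} = 1 \<longleftrightarrow> \<rho> - {v} \<in> ball_boundary F (link {v} N)"
proof -
  have sN: "simplicial_complex N" using N by (simp add: complex_of_dim_def)
  interpret homology_ball F "link {v} N" "int d"
    using F D by (simp add: homology_ball_def homology_ball_axioms_def)
  have e: "insert v (\<rho> - {v}) = \<rho>" using v by blast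
  have l: "\<rho> - {v} \<in> link {v} N" unfolding mem_link_vertex[OF sN] e using r by simp
  have c: "int (card (\<rho> - {v})) = int d" using r(2) v by (simp add: card_Diff_singleton)
  have ll: "link (\<rho> - {v}) (link {v} N) = link \<rho> N"
    using link_link_vertex[OF sN l] unfolding e .
  define U where "U = {u. {u} \<in> link \<rho> N}"
  have U: "u \<in> U \<longleftrightarrow> u \<notin> \<rho> \<and> insert u \<rho> \<in> N" for u
    using simplicial_complex_subset[OF sN, of "insert u \<rho>" "{u}"] by (auto simp: U_def link_def)
  \<comment> \<open>Otherwise \<rho> would itself be a facet and be counted.\<close>
  have Une: "U \<noteq> {}" using ridge_vertex(1)[OF l c] unfolding ll U_def by blast
  have fr: "finite \<rho>" using simplicial_complexD(3)[OF sN r(1)] .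
  have "{\<sigma> \<in> facets N. \<rho> \<subseteq> \<sigma>} = (\<lambda>u. insert u \<rho>) ` U"
  proof (intro equalityI subsetI)
    fix \<sigma> assume "\<sigma> \<in> {\<sigma> \<in> facets N. \<rho> \<subseteq> \<sigma>}"
    then have s: "\<sigma> \<in> N" "\<rho> \<subseteq> \<sigma>" and max: "\<And>\<tau>. \<tau> \<in> N \<Longrightarrow> \<sigma> \<subseteq> \<tau> \<Longrightarrow> \<tau> = \<sigma>"
      unfolding facets_def by blast+
    have "\<sigma> \<noteq> \<rho>"
    proof
      assume eq: "\<sigma> = \<rho>"
      obtain u where "u \<in> U" using Une by blast
      then have "u \<notin> \<rho>" "insert u \<rho> \<in> N" unfolding U by blast+
      then show False using max[of "insert u \<rho>"] eq by blast
    qed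
    then obtain u where u: "u \<in> \<sigma>" "u \<notin> \<rho>" using s(2) by blast
    have su: "insert u \<rho> \<subseteq> \<sigma>" using u s by blast
    have "insert u \<rho> \<in> N" using simplicial_complex_subset[OF sN s(1) su] .
    then have "u \<in> U" unfolding U using u by blast
    moreover have "insert u \<rho> = \<sigma>"
    proof (rule card_seteq[OF _ su])
      show "finite \<sigma>" using simplicial_complexD(3)[OF sN s(1)] .
      show "card \<sigma> \<le> card (insert u \<rho>)"
        using complex_of_dim_card_le[OF N s(1)] u(2) fr r(2) by simp
    qed
    ultimately show "\<sigma> \<in> (\<lambda>u. insert u \<rho>) ` U" by blast
  next
    fix \<sigma> assume "\<sigma> \<in> (\<lambda>u. insert u \<rho>) ` U"
    then obtain u where "u \<in> U" and us: "\<sigma> = insert u \<rho>" by blast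
    then have u: "u \<notin> \<rho>" "insert u \<rho> \<in> N" "\<sigma> = insert u \<rho>" unfolding U by blast+
    have "\<tau> = \<sigma>" if t: "\<tau> \<in> N" "\<sigma> \<subseteq> \<tau>" for \<tau>
    proof (rule card_seteq[symmetric, OF _ t(2)])
      show "finite \<tau>" using simplicial_complexD(3)[OF sN t(1)] .
      show "card \<tau> \<le> card \<sigma>"
        using complex_of_dim_card_le[OF N t(1)] u fr r(2) by simp
    qed
    then show "\<sigma> \<in> {\<sigma> \<in> facets N. \<rho> \<subseteq> \<sigma>}" using u unfolding facets_def by blast
  qed
  moreover have "inj_on (\<lambda>u. insert u \<rho>) U"
  proof (rule inj_onI)
    fix u w assume "u \<in> U" "w \<in> U" and e: "insert u \<rho> = insert w \<rho>"
    then have "u \<notin> \<rho>" "w \<notin> \<rho>" unfolding U by blast+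
    then show "u = w" using e by blast
  qed
  ultimately have "card {\<sigma> \<in> facets N. \<rho> \<subseteq> \<sigma>} = card U" by (simp add: card_image)
  also have "card U = 1 \<longleftrightarrow> (\<exists>!u. u \<in> U)"
    by (auto simp: card_1_singleton_iff)
  also have "\<dots> \<longleftrightarrow> \<rho> - {v} \<in> ball_boundary F (link {v} N)"
    using ridge_vertex(2)[OF l c] unfolding ll U_def by simp
  finally show ?thesis .
qed

section \<open>The boundary defined by counting facets\<close>

lemma boundary_subset: "simplicial_complex N \<Longrightarrow> boundary N \<subseteq> N"
  using simplicial_complexD(2) simplicial_complex_subset unfolding boundary_def by blast

lemma simplicial_boundary:
  assumes N: "simplicial_complex N"
  shows "simplicial_complex (boundary N)"
proof (rule simplicial_complexI)
  show "finite (boundary N)" using boundary_subset[OF N] simplicial_complexD(1)[OF N] by (rule finite_subset)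
  show "{} \<in> boundary N" by (simp add: boundary_def)
  show "finite \<sigma>" if "\<sigma> \<in> boundary N" for \<sigma>
    using boundary_subset[OF N] that simplicial_complexD(3)[OF N] by blast
  show "\<tau> \<in> boundary N" if "\<sigma> \<in> boundary N" "\<tau> \<subseteq> \<sigma>" for \<sigma> \<tau>
    using that unfolding boundary_def by blast
qed

text \<open>Here the boundary defined by facets meets the one defined by acyclic links. Both are
  generated by faces of codimension 1: the former by definition, the latter because it is a homology
  sphere and hence pure.\<close>

lemma link_boundary:
  assumes N: "complex_of_dim (int d + 1) N" and v: "v \<in> vertices N"
    and F: "field F" and D: "F_homology_ball F (int d) (link {v} N)"
  shows "link {v} (boundary N) = ball_boundary F (link {v} N)"
proof -
  have sN: "simplicial_complex N" and dN: "complex_dim N = int d + 1"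
    using N by (simp_all add: complex_of_dim_def)
  interpret homology_ball F "link {v} N" "int d"
    using F D by (simp add: homology_ball_def homology_ball_axioms_def)
  note sB = simplicial_boundary[OF sN]
  have bd: "\<tau> \<in> boundary N \<longleftrightarrow> \<tau> = {} \<or>
      (\<exists>\<rho>\<in>N. card \<rho> = d + 1 \<and> card {\<sigma> \<in> facets N. \<rho> \<subseteq> \<sigma>} = 1 \<and> \<tau> \<subseteq> \<rho>)" for \<tau>
    unfolding boundary_def dN face_dim_def by auto
  show ?thesis
  proof (intro equalityI subsetI)
    fix \<tau> assume "\<tau> \<in> link {v} (boundary N)"
    then have t: "v \<notin> \<tau>" "insert v \<tau> \<in> boundary N" by (simp_all add: mem_link_vertex[OF sB])
    then obtain \<rho> where r: "\<rho> \<in> N" "card \<rho> = d + 1" "card {\<sigma> \<in> facets N. \<rho> \<subseteq> \<sigma>} = 1"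
        "insert v \<tau> \<subseteq> \<rho>"
      unfolding bd by blast
    have "\<rho> - {v} \<in> M"
      unfolding M_def using card_facets_containing_ridge[OF N r(1,2) _ F D] r(3,4) by blast
    then have "\<tau> \<in> M" using simplicial_complex_subset[OF M_simplicial, of "\<rho> - {v}" \<tau>] t(1) r(4) by blast
    then show "\<tau> \<in> ball_boundary F (link {v} N)" by (simp add: M_def)
  next
    fix \<tau> assume "\<tau> \<in> ball_boundary F (link {v} N)"
    then obtain \<rho> where r: "\<rho> \<in> M" "\<tau> \<subseteq> \<rho>" "card \<rho> = d"
      using homology_sphere_pure[OF F M_sphere, of \<tau>] by (auto simp: M_def)
    have l: "\<rho> \<in> link {v} N" using r(1) M_subset by blast
    then have vr: "v \<notin> \<rho>" "insert v \<rho> \<in> N" by (simp_all add: mem_link_vertex[OF sN])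
    have "card (insert v \<rho>) = d + 1"
      using vr r(3) simplicial_complexD(3)[OF B_simplicial l] by simp
    moreover from this have "card {\<sigma> \<in> facets N. insert v \<rho> \<subseteq> \<sigma>} = 1"
      using card_facets_containing_ridge[OF N vr(2) _ insertI1 F D] vr(1) r(1) by (simp add: M_def)
    ultimately have "insert v \<tau> \<in> boundary N" unfolding bd using vr(2) r(2) by blast
    then show "\<tau> \<in> link {v} (boundary N)"
      unfolding mem_link_vertex[OF sB] using vr(1) r(2) by blast
  qed
qed

text \<open>The boundary of a ball contains the empty face; for the link of \<open>v\<close> this
  says that \<open>v\<close> survives in the boundary of \<open>N\<close>.\<close>

lemma vertices_boundary:
  fixes T :: "'f itself"
  assumes N: "N \<in> Kbar_class T k (int d + 1)"
  shows "vertices (boundary N) = vertices N"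
proof
  note sN = Kbar_classD(1)[OF N]
  show "vertices (boundary N) \<subseteq> vertices N"
    using boundary_subset[OF sN] unfolding vertices_def by blast
  show "vertices N \<subseteq> vertices (boundary N)"
  proof
    fix v assume v: "v \<in> vertices N"
    obtain F :: "'f ring" where F: "field F" "F_stacked_ball F k (int d) (link {v} N)"
      using Kbar_classD(4)[OF N v] by (auto simp: stacked_ball_def)
    interpret homology_ball F "link {v} N" "int d" using F by (rule homology_ballI)
    have "{} \<in> link {v} (boundary N)"
      using link_boundary[OF Kbar_classD(2)[OF N] v F(1) ball] empty_in(2) by (simp add: M_def)
    then show "v \<in> vertices (boundary N)" by (auto simp: link_def vertices_def)
  qed
qed

text \<open>Each vertex link of \<open>N\<close> is a stacked ball bounded by the corresponding link
  of \<open>boundary N\<close>, so \<open>link_completion\<close> recovers it from the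
  boundary.\<close>

lemma boundary_in_K_class:
  fixes T :: "'f itself"
  assumes N: "N \<in> Kbar_class T k (int d + 1)" and d: "d \<ge> 2 * k + 2"
  shows "boundary N \<in> K_class T k (int d)" "completion (k + 2) (boundary N) = N"
proof -
  note sN = Kbar_classD(1)[OF N] and dN = Kbar_classD(2)[OF N]
  note sB = simplicial_boundary[OF sN]
  have V: "vertices (boundary N) = vertices N" by (rule vertices_boundary[OF N])
  have ball: "\<exists>F :: 'f ring. field F \<and> F_stacked_ball F k (int d) (link {v} N) \<and>
      ball_boundary F (link {v} N) = link {v} (boundary N)" if v: "v \<in> vertices N" for v
  proof -
    obtain F :: "'f ring" where F: "field F" "F_stacked_ball F k (int d) (link {v} N)"
      using Kbar_classD(4)[OF N v] by (auto simp: stacked_ball_def)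
    have "F_homology_ball F (int d) (link {v} N)" using F(2) by (simp add: F_stacked_ball_def)
    then show ?thesis using F link_boundary[OF dN v F(1)] by metis
  qed
  have sphere: "stacked_sphere T k (int d - 1) (link {v} (boundary N)) \<and>
      complex_of_dim (int d - 1) (link {v} (boundary N))" if v: "v \<in> vertices (boundary N)" for v
  proof -
    have "v \<in> vertices N" using v V by simp
    then obtain F :: "'f ring" where F: "field F" "F_stacked_ball F k (int d) (link {v} N)"
        "ball_boundary F (link {v} N) = link {v} (boundary N)"
      using ball by blast
    have S: "F_homology_sphere F (int d - 1) (link {v} (boundary N))"
      using F(2,3) by (simp add: F_stacked_ball_def F_homology_ball_def)
    then have "homology_sphere T (int d - 1) (link {v} (boundary N))"
      using F(1) unfolding homology_sphere_def by blast
    moreover have "stacked_ball_with_boundary T k (int d - 1 + 1) (link {v} N) (link {v} (boundary N))"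
      unfolding stacked_ball_with_boundary_def using F by auto
    ultimately show ?thesis using S unfolding stacked_sphere_def F_homology_sphere_def by blast
  qed
  have "complex_of_dim (int (d + 1)) N" using dN by (simp add: add.commute)
  then obtain v where "v \<in> vertices (boundary N)"
    using complex_of_dim_vertex[of "d + 1" N] V by blast
  then have dim: "complex_of_dim (int d) (boundary N)"
    using sphere by (intro complex_of_dim_links[OF sB]) auto
  \<comment> \<open>Every edge of \<open>N\<close> lies in the boundary: in the link of an end point
    it becomes a vertex, and single vertices of a stacked ball of dimension \<open>d\<close> are
    boundary faces since \<open>1 \<le> d - k\<close>.\<close>
  have "connected_complex (boundary N)"
  proof (rule connected_complex_edges[OF Kbar_classD(3)[OF N] V])
    fix x y assume xy: "{x, y} \<in> N"
    then have x: "x \<in> vertices N" by (auto simp: vertices_def)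
    show "{x, y} \<in> boundary N"
    proof (cases "x = y")
      case True then show ?thesis using x V vertices_iff[OF sB] by auto
    next
      case False
      obtain F :: "'f ring" where F: "field F" "F_stacked_ball F k (int d) (link {x} N)"
          "ball_boundary F (link {x} N) = link {x} (boundary N)"
        using ball[OF x] by blast
      have "{y} \<in> link {x} N" using xy False by (simp add: mem_link_vertex[OF sN])
      then have "{y} \<in> link {x} (boundary N)"
        unfolding F(3)[symmetric] using d by (intro stacked_ball_low_faces[OF F(2)]) auto
      then show ?thesis by (simp add: mem_link_vertex[OF sB])
    qed
  qed
  then show K: "boundary N \<in> K_class T k (int d)"
    unfolding K_class_def using dim sphere by blast
  show "completion (k + 2) (boundary N) = N"
  proof (rule simplicial_complex_eqI[OF simplicial_completion[OF sB] sN])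
    show V': "vertices (completion (k + 2) (boundary N)) = vertices N"
      using vertices_completion[OF sB] V by simp
    fix v assume "v \<in> vertices (completion (k + 2) (boundary N))"
    then have v: "v \<in> vertices N" using V' by simp
    obtain F :: "'f ring" where F: "field F" "F_stacked_ball F k (int d) (link {v} N)"
        "ball_boundary F (link {v} N) = link {v} (boundary N)"
      using ball[OF v] by blast
    have "v \<in> vertices (boundary N)" using v V by simp
    then show "link {v} (completion (k + 2) (boundary N)) = link {v} N"
      using F d by (rule link_completion[OF sB])
  qed
qed

lemma boundary_completion:
  fixes T :: "'f itself"
  assumes M: "M \<in> K_class T k (int d)" and d: "d \<ge> 2 * k + 2"
  shows "boundary (completion (k + 2) M) = M"
proof -
  let ?N = "completion (k + 2) M"
  note sM = K_classD(1)[OF M]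
  have N: "?N \<in> Kbar_class T k (int d + 1)" by (rule completion_in_Kbar[OF M d])
  have V: "vertices (boundary ?N) = vertices M"
    using vertices_boundary[OF N] vertices_completion[OF sM] by simp
  show ?thesis
  proof (rule simplicial_complex_eqI[OF simplicial_boundary[OF simplicial_completion[OF sM]] sM V])
    fix v assume "v \<in> vertices (boundary ?N)"
    then have v: "v \<in> vertices M" "v \<in> vertices ?N" using V vertices_completion[OF sM] by auto
    from M v(1) d obtain F :: "'f ring" where F: "field F" "F_stacked_ball F k (int d) (link {v} ?N)"
      "ball_boundary F (link {v} ?N) = link {v} M" by (rule K_class_link_ball)
    have "F_homology_ball F (int d) (link {v} ?N)" using F(2) by (simp add: F_stacked_ball_def)
    then show "link {v} (boundary ?N) = link {v} M"
      using link_boundary[OF Kbar_classD(2)[OF N] v(2) F(1)] F(3) by simp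
  qed
qed

text \<open>The sphere \<open>M\<close> and the ball it bounds may live over different fields
  \<open>F\<close> and \<open>G\<close>. Vertex links inherit the two properties separately, so the
  fields need not be related.\<close>

lemma stacked_sphere_in_K_class:
  fixes T :: "'f itself"
  assumes M: "stacked_sphere T k (int d) M" and d: "d \<ge> 2 * k + 2"
  shows "M \<in> K_class T k (int d)"
proof -
  obtain F :: "'f ring" where F: "field F" "F_homology_sphere F (int d) M"
    using M by (auto simp: stacked_sphere_def homology_sphere_def)
  obtain B and G :: "'f ring" where G: "field G" "F_stacked_ball G k (int d + 1) B" "ball_boundary G B = M"
    using M by (auto simp: stacked_sphere_def stacked_ball_with_boundary_def)
  have "stacked_sphere T k (int d - 1) (link {v} M)" if v: "v \<in> vertices M" for v
  proof -
    have vB: "v \<in> vertices B" using v G(3) by (auto simp: vertices_def ball_boundary_def)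
    have k: "int k \<le> int d + 1 - 1" using d by simp
    have "stacked_ball_with_boundary T k (int d - 1 + 1) (link {v} B) (link {v} M)"
      using stacked_ball_link[OF G(1,2) k vB] G(1,3) unfolding stacked_ball_with_boundary_def by auto
    moreover have "homology_sphere T (int d - 1) (link {v} M)"
      using homology_sphere_link[OF F v] F(1) unfolding homology_sphere_def by blast
    ultimately show ?thesis unfolding stacked_sphere_def by blast
  qed
  moreover have "complex_of_dim (int d) M" using F(2) by (simp add: F_homology_sphere_def)
  moreover have "connected_complex M" using d by (intro homology_sphere_connected[OF F]) simp
  ultimately show ?thesis by (simp add: K_class_def)
qed

lemma stacked_ball_with_boundary_unique:
  fixes T :: "'f itself"
  assumes "stacked_ball_with_boundary T k (int d + 1) B M" and d: "d \<ge> 2 * k + 2"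
  shows "B = completion (k + 1) M" "B = completion (k + 2) M"
proof -
  obtain F :: "'f ring" where F: "field F" "F_stacked_ball F k (int d + 1) B" "ball_boundary F B = M"
    using assms(1) by (auto simp: stacked_ball_with_boundary_def)
  show "B = completion (k + 1) M" "B = completion (k + 2) M"
    by (rule stacked_ball_completion[OF F(1,2), unfolded F(3)]; use d in simp)+
qed

text \<open>The equivalence for \<open>B\<close> expresses existence and uniqueness of the stacked
  ball at once. The type \<open>'f\<close> hosts the coefficient fields on both sides of the
  bijection.\<close>

theorem mainTheorem2:
  fixes k d :: nat
  assumes "d \<ge> 2 * k + 2"
  shows
    "(\<forall>M :: 'a::linorder set set. stacked_sphere TYPE('f) k (int d) M \<longrightarrow>
        M \<in> K_class TYPE('f) k (int d) \<and>
        (\<forall>B. stacked_ball_with_boundary TYPE('f) k (int d + 1) B M \<longleftrightarrow> B = completion (k + 1) M) \<and>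
        completion (k + 1) M = completion (k + 2) M)
     \<and>
     bij_betw (completion (k + 2))
       (K_class TYPE('f) k (int d) :: 'a set set set) (Kbar_class TYPE('f) k (int d + 1)) \<and>
     (\<forall>M \<in> (K_class TYPE('f) k (int d) :: 'a set set set). boundary (completion (k + 2) M) = M) \<and>
     (\<forall>N \<in> (Kbar_class TYPE('f) k (int d + 1) :: 'a set set set).
        boundary N \<in> K_class TYPE('f) k (int d) \<and> completion (k + 2) (boundary N) = N)"
proof (intro conjI allI impI ballI)
  fix M :: "'a set set" assume M: "stacked_sphere TYPE('f) k (int d) M"
  show "M \<in> K_class TYPE('f) k (int d)" using M assms by (rule stacked_sphere_in_K_class)
  obtain B where B: "stacked_ball_with_boundary TYPE('f) k (int d + 1) B M"
    using M unfolding stacked_sphere_def by blast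
  show "completion (k + 1) M = completion (k + 2) M"
    by (rule trans[OF stacked_ball_with_boundary_unique(1)[OF B assms, symmetric]
          stacked_ball_with_boundary_unique(2)[OF B assms]])
  show "stacked_ball_with_boundary TYPE('f) k (int d + 1) B' M \<longleftrightarrow> B' = completion (k + 1) M" for B'
  proof
    assume "stacked_ball_with_boundary TYPE('f) k (int d + 1) B' M"
    then show "B' = completion (k + 1) M" using assms by (rule stacked_ball_with_boundary_unique)
  next
    assume "B' = completion (k + 1) M"
    then have "B' = B" using stacked_ball_with_boundary_unique(1)[OF B assms] by simp
    then show "stacked_ball_with_boundary TYPE('f) k (int d + 1) B' M" using B by simp
  qed
next
  show "bij_betw (completion (k + 2))
      (K_class TYPE('f) k (int d) :: 'a set set set) (Kbar_class TYPE('f) k (int d + 1))"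
  proof (rule bij_betw_byWitness[where f' = boundary]; (intro ballI image_subsetI)?)
    fix M :: "'a set set" assume M: "M \<in> K_class TYPE('f) k (int d)"
    show "boundary (completion (k + 2) M) = M" using M assms by (rule boundary_completion)
    show "completion (k + 2) M \<in> Kbar_class TYPE('f) k (int d + 1)"
      using M assms by (rule completion_in_Kbar)
  next
    fix N :: "'a set set" assume N: "N \<in> Kbar_class TYPE('f) k (int d + 1)"
    show "completion (k + 2) (boundary N) = N" "boundary N \<in> K_class TYPE('f) k (int d)"
      using boundary_in_K_class[OF N assms] by simp_all
  qed
next
  show "boundary (completion (k + 2) M) = M"
    if "M \<in> K_class TYPE('f) k (int d)" for M :: "'a set set"
    using that assms by (rule boundary_completion)
next
  fix N :: "'a set set" assume N: "N \<in> Kbar_class TYPE('f) k (int d + 1)"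
  show "boundary N \<in> K_class TYPE('f) k (int d)" "completion (k + 2) (boundary N) = N"
    using boundary_in_K_class[OF N assms] .
qed

end
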